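(* Let $p$ be an odd prime. Then $\operatorname{index}_{\mathbb{Z}/p}\Delta_{p-1,p}=\operatorname{index}_{\mathbb{Z}/p}S(W_p)=H^{\geq p-1}(\mathrm{B}(\mathbb{Z}/p);\mathbb{F}_p)$.
   Context: The chessboard complex $\Delta_{p-1,p}$ has vertex set $[p-1]\times[p]$, simplices being vertex sets with pairwise distinct first and pairwise distinct second coordinates; $\mathbb{Z}/p$ (generated by $(12\cdots p)\in\mathfrak{S}_p$) acts by permuting the second coordinate. $W_p=\{t\in\mathbb{R}^p:\sum t_i=0\}$ with cyclic coordinate permutation, $S(W_p)$ its unit sphere. For a $G$-space $X$, $\operatorname{index}_G X=\ker\big(H^*(\mathrm{B}G;\mathbb{F}_p)\to H^*(\mathrm{E}G\times_G X;\mathbb{F}_p)\big)$ (Fadell–Husseini index). $H^{\geq m}$ denotes the ideal of elements of degree at least $m$ in $H^*(\mathrm{B}(\mathbb{Z}/p);\mathbb{F}_p)=\mathbb{F}_p[t]\otimes\Lambda[e]$, $\deg t=2$, $\deg e=1$. *)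

theory Defs
  imports "HOL-Homology.Homology" "HOL-Computational_Algebra.Primes" "HOL-Algebra.Sym_Groups" "HOL-Algebra.Group_Action"
begin

section \<open>Singular cohomology with coefficients in an abelian group\<close>

text \<open>The group $\mathrm{Hom}(C_n(X), A)$ of singular cochains, where $C_n(X)$ is the library's
  free abelian group of singular chains. Cochains are \<open>undefined\<close> off the singular
  chains of \<open>X\<close>, so that distinct elements are distinct homomorphisms.\<close>

definition cochain_group ::
    "nat \<Rightarrow> 'a topology \<Rightarrow> ('c, 'm) monoid_scheme \<Rightarrow> ('a chain \<Rightarrow> 'c) monoid" where
  "cochain_group n X A =
     \<lparr>carrier = hom (chain_group n X) A \<inter> extensional (singular_chain_set n X),
      monoid.mult = (\<lambda>\<phi> \<psi>. \<lambda>c\<in>singular_chain_set n X. \<phi> c \<otimes>\<^bsub>A\<^esub> \<psi> c),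
      one = (\<lambda>c\<in>singular_chain_set n X. \<one>\<^bsub>A\<^esub>)\<rparr>"

definition coboundary :: "nat \<Rightarrow> 'a topology \<Rightarrow> ('a chain \<Rightarrow> 'c) \<Rightarrow> 'a chain \<Rightarrow> 'c" where
  "coboundary n X \<phi> = (\<lambda>c\<in>singular_chain_set (Suc n) X. \<phi> (chain_boundary (Suc n) c))"

definition cocycles ::
    "nat \<Rightarrow> 'a topology \<Rightarrow> ('c, 'm) monoid_scheme \<Rightarrow> ('a chain \<Rightarrow> 'c) set" where
  "cocycles n X A = kernel (cochain_group n X A) (cochain_group (Suc n) X A) (coboundary n X)"

fun coboundaries ::
    "nat \<Rightarrow> 'a topology \<Rightarrow> ('c, 'm) monoid_scheme \<Rightarrow> ('a chain \<Rightarrow> 'c) set" where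
  "coboundaries 0 X A = {\<one>\<^bsub>cochain_group 0 X A\<^esub>}"
| "coboundaries (Suc n) X A = coboundary n X ` carrier (cochain_group n X A)"

definition cohomology_group ::
    "nat \<Rightarrow> 'a topology \<Rightarrow> ('c, 'm) monoid_scheme \<Rightarrow> ('a chain \<Rightarrow> 'c) set monoid" where
  "cohomology_group n X A =
     subgroup_generated (cochain_group n X A) (cocycles n X A) Mod coboundaries n X A"

definition cochain_pullback ::
    "nat \<Rightarrow> 'a topology \<Rightarrow> ('a \<Rightarrow> 'b) \<Rightarrow> ('b chain \<Rightarrow> 'c) \<Rightarrow> 'a chain \<Rightarrow> 'c" where
  "cochain_pullback n X f \<phi> = (\<lambda>c\<in>singular_chain_set n X. \<phi> (chain_map n f c))"

text \<open>For continuous \<open>f\<close> from \<open>X\<close> to \<open>Y\<close>, the induced map from $H^n(Y; A)$ to $H^n(X; A)$.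
  Elements of these groups are cosets; the pullback of a coset lies in a single coset of the
  coboundaries of \<open>X\<close>, which is recovered by adding all coboundaries.\<close>

definition cohomology_induced ::
    "nat \<Rightarrow> 'a topology \<Rightarrow> ('c, 'm) monoid_scheme \<Rightarrow> ('a \<Rightarrow> 'b) \<Rightarrow>
     ('b chain \<Rightarrow> 'c) set \<Rightarrow> ('a chain \<Rightarrow> 'c) set" where
  "cohomology_induced n X A f K =
     coboundaries n X A <#>\<^bsub>cochain_group n X A\<^esub> (cochain_pullback n X f ` K)"

text \<open>The total cohomology $H^*(X; A) = \bigoplus_n H^n(X; A)$, the map induced on it, and the
  elements of degree at least \<open>m\<close>, i.e. those with vanishing components in all degrees
  below \<open>m\<close>.\<close>

definition cohomology ::
    "'a topology \<Rightarrow> ('c, 'm) monoid_scheme \<Rightarrow> (nat \<Rightarrow> ('a chain \<Rightarrow> 'c) set) monoid" where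
  "cohomology X A = sum_group UNIV (\<lambda>n. cohomology_group n X A)"

definition cohomology_map ::
    "'a topology \<Rightarrow> ('c, 'm) monoid_scheme \<Rightarrow> ('a \<Rightarrow> 'b) \<Rightarrow>
     (nat \<Rightarrow> ('b chain \<Rightarrow> 'c) set) \<Rightarrow> nat \<Rightarrow> ('a chain \<Rightarrow> 'c) set" where
  "cohomology_map X A f c = (\<lambda>n. cohomology_induced n X A f (c n))"

definition cohomology_ge ::
    "nat \<Rightarrow> 'a topology \<Rightarrow> ('c, 'm) monoid_scheme \<Rightarrow> (nat \<Rightarrow> ('a chain \<Rightarrow> 'c) set) set" where
  "cohomology_ge m X A =
     {c \<in> carrier (cohomology X A). \<forall>n<m. c n = \<one>\<^bsub>cohomology_group n X A\<^esub>}"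


section \<open>Orbit spaces\<close>

definition orbit_space ::
    "('g, 'm) monoid_scheme \<Rightarrow> 'a topology \<Rightarrow> ('g \<Rightarrow> 'a \<Rightarrow> 'a) \<Rightarrow> 'a set topology" where
  "orbit_space G X \<phi> =
     topology (\<lambda>U. U \<subseteq> orbits G (topspace X) \<phi> \<and> openin X {x \<in> topspace X. orbit G \<phi> x \<in> U})"

lemma openin_orbit_space:
  "openin (orbit_space G X \<phi>) U \<longleftrightarrow>
     U \<subseteq> orbits G (topspace X) \<phi> \<and> openin X {x \<in> topspace X. orbit G \<phi> x \<in> U}"
proof -
  let ?P = "\<lambda>U. U \<subseteq> orbits G (topspace X) \<phi> \<and> openin X {x \<in> topspace X. orbit G \<phi> x \<in> U}"
  have "istopology ?P"
    unfolding istopology_def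
  proof (intro conjI allI impI)
    fix S T assume "?P S" "?P T"
    moreover have "{x \<in> topspace X. orbit G \<phi> x \<in> S \<inter> T} =
        {x \<in> topspace X. orbit G \<phi> x \<in> S} \<inter> {x \<in> topspace X. orbit G \<phi> x \<in> T}"
      by auto
    ultimately show "S \<inter> T \<subseteq> orbits G (topspace X) \<phi>"
      and "openin X {x \<in> topspace X. orbit G \<phi> x \<in> S \<inter> T}"
      by auto
  next
    fix \<K> assume K: "\<forall>K\<in>\<K>. ?P K"
    then show "\<Union>\<K> \<subseteq> orbits G (topspace X) \<phi>" by auto
    have "{x \<in> topspace X. orbit G \<phi> x \<in> \<Union>\<K>} =
        (\<Union>K\<in>\<K>. {x \<in> topspace X. orbit G \<phi> x \<in> K})"
      by auto
    with K show "openin X {x \<in> topspace X. orbit G \<phi> x \<in> \<Union>\<K>}" by auto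
  qed
  then show ?thesis unfolding orbit_space_def by (simp add: topology_inverse')
qed

lemma topspace_orbit_space [simp]: "topspace (orbit_space G X \<phi>) = orbits G (topspace X) \<phi>"
proof -
  have "{x \<in> topspace X. orbit G \<phi> x \<in> orbits G (topspace X) \<phi>} = topspace X"
    by (auto simp: orbits_def)
  then have "openin (orbit_space G X \<phi>) (orbits G (topspace X) \<phi>)"
    by (simp add: openin_orbit_space)
  moreover have "topspace (orbit_space G X \<phi>) \<subseteq> orbits G (topspace X) \<phi>"
    using openin_orbit_space by blast
  ultimately show ?thesis using openin_subset by blast
qed

lemma quotient_map_orbit: "quotient_map X (orbit_space G X \<phi>) (orbit G \<phi>)"
  unfolding quotient_map_def by (auto simp: openin_orbit_space orbits_def)


section \<open>Geometric realizations\<close>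

text \<open>Points are given by their barycentric coordinates and the topology is that of
  coordinatewise convergence, which is the usual one for a finite complex.\<close>

definition realization :: "'v set set \<Rightarrow> ('v \<Rightarrow> real) topology" where
  "realization K = subtopology (powertop_real UNIV)
     {x. (\<forall>v. 0 \<le> x v) \<and> {v. x v \<noteq> 0} \<in> K \<and> (\<Sum>v | x v \<noteq> 0. x v) = 1}"

text \<open>The action on the realization induced by an action \<open>a\<close> of \<open>G\<close> on the vertices:
  \<open>g\<close> moves the coordinate at \<open>v\<close> to the vertex \<open>a g v\<close>.\<close>

definition realization_action ::
    "('g, 'm) monoid_scheme \<Rightarrow> 'v set set \<Rightarrow> ('g \<Rightarrow> 'v \<Rightarrow> 'v) \<Rightarrow> 'g \<Rightarrow> ('v \<Rightarrow> real) \<Rightarrow> ('v \<Rightarrow> real)" where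
  "realization_action G K a g =
     (\<lambda>x\<in>topspace (realization K). \<lambda>v. if v \<in> \<Union>K then x (a (inv\<^bsub>G\<^esub> g) v) else 0)"


section \<open>The Borel construction and the Fadell--Husseini index\<close>

text \<open>Milnor's model of $\mathrm{E}G$ for a finite group \<open>G\<close>: the infinite join $G * G * \cdots$
  with \<open>G\<close> acting by left translation. As \<open>G\<close> is finite and discrete, the topology of
  coordinatewise convergence is Milnor's topology, the coarsest one making the join parameters
  and the (partially defined) \<open>G\<close>-coordinates continuous.\<close>

definition join_complex :: "('g, 'm) monoid_scheme \<Rightarrow> (nat \<times> 'g) set set" where
  "join_complex G = {S. finite S \<and> S \<subseteq> UNIV \<times> carrier G \<and> inj_on fst S}"

definition EG :: "('g, 'm) monoid_scheme \<Rightarrow> (nat \<times> 'g \<Rightarrow> real) topology" where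
  "EG G = realization (join_complex G)"

definition EG_action ::
    "('g, 'm) monoid_scheme \<Rightarrow> 'g \<Rightarrow> (nat \<times> 'g \<Rightarrow> real) \<Rightarrow> (nat \<times> 'g \<Rightarrow> real)" where
  "EG_action G = realization_action G (join_complex G) (\<lambda>g (i, h). (i, g \<otimes>\<^bsub>G\<^esub> h))"

definition BG :: "('g, 'm) monoid_scheme \<Rightarrow> (nat \<times> 'g \<Rightarrow> real) set topology" where
  "BG G = orbit_space G (EG G) (EG_action G)"

definition borel_construction ::
    "('g, 'm) monoid_scheme \<Rightarrow> 'a topology \<Rightarrow> ('g \<Rightarrow> 'a \<Rightarrow> 'a) \<Rightarrow>
     ((nat \<times> 'g \<Rightarrow> real) \<times> 'a) set topology" where
  "borel_construction G X \<phi> = orbit_space G (prod_topology (EG G) X)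
     (\<lambda>g. \<lambda>(e, x)\<in>topspace (EG G) \<times> topspace X. (EG_action G g e, \<phi> g x))"

text \<open>\<open>(`) fst\<close> maps the orbit of \<open>(e, x)\<close> to the orbit of \<open>e\<close>, i.e. it is the projection
  $\mathrm{E}G \times_G X \to \mathrm{B}G$. The index is an ideal for the cup product, but as the
  kernel of a homomorphism it only depends on the additive structure, so that for $\mathbb{F}_p$
  coefficients \<open>A\<close> is the additive group of $\mathbb{F}_p$.\<close>

definition fadell_husseini_index ::
    "('c, 'n) monoid_scheme \<Rightarrow> ('g, 'm) monoid_scheme \<Rightarrow> 'a topology \<Rightarrow> ('g \<Rightarrow> 'a \<Rightarrow> 'a) \<Rightarrow>
     (nat \<Rightarrow> ((nat \<times> 'g \<Rightarrow> real) set chain \<Rightarrow> 'c) set) set" where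
  "fadell_husseini_index A G X \<phi> =
     kernel (cohomology (BG G) A) (cohomology (borel_construction G X \<phi>) A)
       (cohomology_map (borel_construction G X \<phi>) A ((`) fst))"


section \<open>The cyclic group, the chessboard complex and the sphere\<close>

definition cyclic_perm_group :: "nat \<Rightarrow> (nat \<Rightarrow> nat) monoid" where
  "cyclic_perm_group p = subgroup_generated (sym_group p) {cycle_of_list [1..<Suc p]}"

definition chessboard_complex :: "nat \<Rightarrow> nat \<Rightarrow> (nat \<times> nat) set set" where
  "chessboard_complex m n = {S. S \<subseteq> {1..m} \<times> {1..n} \<and> inj_on fst S \<and> inj_on snd S}"

definition chessboard_action ::
    "nat \<Rightarrow> nat \<Rightarrow> (nat \<Rightarrow> nat) \<Rightarrow> (nat \<times> nat \<Rightarrow> real) \<Rightarrow> (nat \<times> nat \<Rightarrow> real)" where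
  "chessboard_action m n =
     realization_action (cyclic_perm_group n) (chessboard_complex m n) (\<lambda>g (i, j). (i, g j))"

text \<open>The unit sphere of $W_p$; vectors of $\mathbb{R}^p$ are indexed by \<open>{1..p}\<close> and extended
  by zero.\<close>

definition W_sphere :: "nat \<Rightarrow> (nat \<Rightarrow> real) topology" where
  "W_sphere p = subtopology (powertop_real UNIV)
     {t. (\<forall>i. i \<notin> {1..p} \<longrightarrow> t i = 0) \<and> (\<Sum>i=1..p. t i) = 0 \<and> (\<Sum>i=1..p. (t i)\<^sup>2) = 1}"

definition W_sphere_action :: "nat \<Rightarrow> (nat \<Rightarrow> nat) \<Rightarrow> (nat \<Rightarrow> real) \<Rightarrow> (nat \<Rightarrow> real)" where
  "W_sphere_action p g = (\<lambda>t\<in>topspace (W_sphere p). \<lambda>i. t ((inv\<^bsub>cyclic_perm_group p\<^esub> g) i))"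

end

theory Submission
  imports Defs "HOL-Number_Theory.Cong" "HOL-Analysis.Abstract_Topological_Spaces"
begin

text \<open>Let \<open>X\<close> be either space. A cycle modulo \<open>p\<close> in the orbit space of a free
  action lifts, after subdivision, to a chain \<open>y\<close> upstairs with \<open>d y \<equiv> (S - 1) y\<^sub>1\<close>,
  \<open>d y\<^sub>1 \<equiv> N y\<^sub>2\<close>, \<open>d y\<^sub>2 \<equiv> (S - 1) y\<^sub>3\<close> and so on, where \<open>S\<close> is the generator and \<open>N\<close> the norm;
  the augmentation \<open>l\<close> of the last chain does not depend on the choices. As \<open>EG\<close> is
  acyclic, the image of the cycle in \<open>BG\<close> is a boundary modulo \<open>p\<close> if \<open>l \<equiv> 0\<close>; and a class in
  $H^n(BG; \mathbb{F}_p)$ is determined by its values on cycles modulo \<open>p\<close>.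

  Degrees at least \<open>p - 1\<close>: a nonconstant vector in $\mathbb{R}^p$ determines a proper nonempty
  subset of \<open>{1..p}\<close>, the one that lies above its complement with the largest gap. This gives
  an equivariant map to lists of subsets, and sorting these by cardinality, with signs, gives one to the
  strictly increasing lists. These have at most \<open>p - 1\<close> members, so that chains of degree at least
  \<open>p - 1\<close> are killed and \<open>l \<equiv> 0\<close>.

  Degrees below \<open>p - 1\<close>: the fundamental cycle of the chessboard complex maps to the
  boundary of the simplex on \<open>{1..p}\<close> with degree \<open>(p - 1)!\<close>, which is prime to \<open>p\<close>. Hence it has
  \<open>l \<noteq> 0\<close>, and so have the lower terms of its sequence; their images in the Borel
  construction of \<open>X\<close> detect all of $H^n(BG; \mathbb{F}_p)$.\<close>

section \<open>Free abelian groups modulo p\<close>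

text \<open>Chains stay integral and are compared up to multiples of \<open>p\<close>, so that
  cochains with values in \<open>Z/p\<close> can be evaluated on them directly. The alternation of
  \<open>S - 1\<close> and the norm is the periodic resolution of the cyclic group; a tower is a
  zigzag through the resulting double complex. The obstacle in high degrees is that the set with the
  largest gap jumps. Near a given point, however, all sets that occur have a positive gap at that
  point, so that there is at most one of each size; on simplices that see only such sets, sorting is
  a chain map. In low degrees the fundamental cycle \<open>z\<close> is not itself the start of the
  tower. Being invariant, it is congruent to the norm of some chain \<open>y\<close>, and
  \<open>y\<close> is the start. If the value \<open>l\<close> of \<open>y\<close> were 0,
  comparison with the full simplex on \<open>{1..p}\<close> would make the image of \<open>z\<close>
  the boundary of a norm, and its degree would be divisible by \<open>p\<close>. Oddness of
  \<open>p\<close> enters through the sign of the rotation, which is 1 and makes \<open>z\<close>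
  invariant, and through the parity of \<open>p - 2\<close>: a truncated tower that begins with the
  wrong operator then has even degree, where it can be converted.\<close>

definition fcong :: "nat \<Rightarrow> ('x \<Rightarrow>\<^sub>0 int) \<Rightarrow> ('x \<Rightarrow>\<^sub>0 int) \<Rightarrow> bool" where
  "fcong p a b \<longleftrightarrow> (\<exists>w. a - b = frag_cmul (int p) w)"

lemma frag_cmul_diff2: "frag_cmul k (a - b) = frag_cmul k a - frag_cmul k b"
  by (metis (no_types, lifting) diff_add_cancel frag_cmul_distrib2 add_diff_cancel_right')

lemma fcong_refl [simp]: "fcong p a a"
  unfolding fcong_def by (rule exI [of _ 0]) simp

lemma fcong_add: "fcong p a b \<Longrightarrow> fcong p c e \<Longrightarrow> fcong p (a + c) (b + e)"
  unfolding fcong_def by (metis add_diff_add frag_cmul_distrib2)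

lemma fcong_diff: "fcong p a b \<Longrightarrow> fcong p c e \<Longrightarrow> fcong p (a - c) (b - e)"
  unfolding fcong_def by (metis (no_types, opaque_lifting) diff_diff_eq2 diff_diff_add diff_add_eq add.commute frag_cmul_diff2)

lemma fcong_diff_iff: "fcong p a b \<longleftrightarrow> fcong p (a - b) 0"
  unfolding fcong_def by simp

lemma fcong_cmul: "fcong p a b \<Longrightarrow> fcong p (frag_cmul k a) (frag_cmul k b)"
  unfolding fcong_def by (metis frag_cmul_diff2 frag_cmul_cmul mult.commute)

lemma fcong_sym: "fcong p a b \<Longrightarrow> fcong p b a"
  unfolding fcong_def by (metis minus_diff_eq minus_frag_cmul frag_cmul_cmul mult_minus_left mult.commute frag_cmul_minus_one)

lemma fcong_trans [trans]: "fcong p a b \<Longrightarrow> fcong p b c \<Longrightarrow> fcong p a c"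
  using fcong_add [of p a b "-b" "-c"] fcong_diff [of p a b b c]
  by (metis (no_types, lifting) add_diff_cancel_right' diff_add_cancel fcong_add fcong_diff_iff fcong_refl diff_self)

lemma fcong_multiple [simp]: "fcong p (frag_cmul (int p) w) 0"
  unfolding fcong_def by auto

lemma fcong_extend: "fcong p a b \<Longrightarrow> fcong p (frag_extend f a) (frag_extend f b)"
  unfolding fcong_def by (metis frag_extend_diff frag_extend_cmul)

text \<open>Additivity is phrased with differences because chains are generated from 0 and basis
  elements by differences. Most identities between chain operators below are checked on generators
  through this rule.\<close>

lemma frag_additive_eq:
  assumes "Poly_Mapping.keys c \<subseteq> S"
    and "\<And>x. x \<in> S \<Longrightarrow> F (frag_of x) = G (frag_of x)"
    and "\<And>a b. F (a - b) = F a - F b" and "\<And>a b. G (a - b) = G a - (G b :: 'b::ab_group_add)"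
  shows "F c = G c"
  using assms(1)
proof (induction c rule: frag_induction)
  case zero
  have "F (0 - 0) = F 0 - F 0" "G (0 - 0) = G 0 - G 0" by (rule assms)+
  then show ?case by simp
qed (use assms in auto)

lemma frag_extend_frag_extend:
  "frag_extend f (frag_extend g c) = frag_extend (\<lambda>x. frag_extend f (g x)) c"
  by (rule frag_additive_eq [of c UNIV]) (auto simp: frag_extend_diff)

text \<open>A nonzero factor does not change the support of an integral chain, so a witness of a
  congruence lies in the same chain group as the two sides.\<close>

lemma keys_fcong_witness:
  assumes "a - b = frag_cmul (int p) w" "p > 0" "Poly_Mapping.keys a \<subseteq> S" "Poly_Mapping.keys b \<subseteq> S"
  shows "Poly_Mapping.keys w \<subseteq> S"
proof
  fix x assume "x \<in> Poly_Mapping.keys w"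
  then have "x \<in> Poly_Mapping.keys (a - b)" using assms by simp
  then show "x \<in> S" using keys_diff [of a b] assms by auto
qed

lemma keys_frag_extend_subset:
  assumes "Poly_Mapping.keys c \<subseteq> A" "\<And>x. x \<in> A \<Longrightarrow> Poly_Mapping.keys (f x) \<subseteq> S"
  shows "Poly_Mapping.keys (frag_extend f c) \<subseteq> S"
  using keys_frag_extend [of f c] assms by blast

lemma keys_diff_subset:
  "Poly_Mapping.keys a \<subseteq> S \<Longrightarrow> Poly_Mapping.keys b \<subseteq> S \<Longrightarrow> Poly_Mapping.keys (a - b) \<subseteq> S"
  using keys_diff [of a b] by blast

lemma keys_add_subset:
  "Poly_Mapping.keys a \<subseteq> S \<Longrightarrow> Poly_Mapping.keys b \<subseteq> S \<Longrightarrow> Poly_Mapping.keys (a + b) \<subseteq> S"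
  using keys_add [of a b] by blast

lemma keys_sum_subset:
  assumes "\<And>i. i \<in> I \<Longrightarrow> Poly_Mapping.keys (f i) \<subseteq> S"
  shows "Poly_Mapping.keys (sum f I) \<subseteq> S"
  using keys_sum [of f I] assms by blast

lemma keys_cmul_subset: "Poly_Mapping.keys a \<subseteq> S \<Longrightarrow> Poly_Mapping.keys (frag_cmul k a) \<subseteq> S"
  using keys_cmul [of k a] by blast

lemmas keys_subset = keys_diff_subset keys_add_subset keys_sum_subset keys_cmul_subset

section \<open>Augmentation of chains\<close>

definition aug :: "('x \<Rightarrow>\<^sub>0 int) \<Rightarrow> int" where
  "aug c = Poly_Mapping.lookup (frag_extend (\<lambda>_. frag_of ()) c) ()"

lemma aug_of [simp]: "aug (frag_of x) = 1"
  and aug_0 [simp]: "aug 0 = 0"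
  and aug_diff: "aug (a - b) = aug a - aug b"
  and aug_add: "aug (a + b) = aug a + aug b"
  and aug_cmul: "aug (frag_cmul k a) = k * aug a"
  by (simp_all add: aug_def frag_extend_diff frag_extend_add frag_extend_cmul lookup_add lookup_minus)

lemma aug_extend:
  assumes "Poly_Mapping.keys c \<subseteq> S" "\<And>x. x \<in> S \<Longrightarrow> aug (f x) = 1"
  shows "aug (frag_extend f c) = aug c"
  by (rule frag_additive_eq [OF assms(1)]) (auto simp: assms frag_extend_diff aug_diff)

lemma aug_extend_0:
  assumes "Poly_Mapping.keys c \<subseteq> S" "\<And>x. x \<in> S \<Longrightarrow> aug (f x) = 0"
  shows "aug (frag_extend f c) = 0"
  by (rule frag_additive_eq [OF assms(1), where G = "\<lambda>_. 0"]) (auto simp: assms frag_extend_diff aug_diff)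

lemma fcong_aug: "fcong p a b \<Longrightarrow> [aug a = aug b] (mod int p)"
  unfolding fcong_def cong_iff_dvd_diff
  by (metis aug_diff aug_cmul dvd_triv_left)

section \<open>Chain complexes with a free action of a cyclic group of prime order\<close>

text \<open>An augmented complex of free modules over the group ring of \<open>Z/p\<close>, given by
  \<open>Z\<close>-bases that the generator permutes freely. \<open>D 0\<close> is unconstrained, as
  the augmentation takes its place; this admits both singular chains, with zero boundary in degree
  0, and lists, where a vertex has the empty list as boundary.\<close>

locale Zp_complex =
  fixes p :: nat and B :: "nat \<Rightarrow> 'x set" and D :: "nat \<Rightarrow> 'x \<Rightarrow> ('x \<Rightarrow>\<^sub>0 int)" and s :: "nat \<Rightarrow> 'x \<Rightarrow> 'x"
  assumes prime_p: "prime p"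
    and s_in: "x \<in> B n \<Longrightarrow> s n x \<in> B n"
    and s_order: "x \<in> B n \<Longrightarrow> (s n ^^ p) x = x"
    and s_free: "x \<in> B n \<Longrightarrow> s n x \<noteq> x"
    and D_in: "x \<in> B (Suc n) \<Longrightarrow> Poly_Mapping.keys (D (Suc n) x) \<subseteq> B n"
    and D_s: "x \<in> B (Suc n) \<Longrightarrow> D (Suc n) (s (Suc n) x) = frag_extend (frag_of \<circ> s n) (D (Suc n) x)"
    and D_D: "x \<in> B (Suc (Suc n)) \<Longrightarrow> frag_extend (D (Suc n)) (D (Suc (Suc n)) x) = 0"
    and aug_D: "x \<in> B (Suc 0) \<Longrightarrow> aug (D (Suc 0) x) = 0"
begin

lemma p_pos: "p > 0" using prime_p prime_gt_0_nat by blast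

abbreviation chains :: "nat \<Rightarrow> ('x \<Rightarrow>\<^sub>0 int) set" where
  "chains n \<equiv> {c. Poly_Mapping.keys c \<subseteq> B n}"

definition d :: "nat \<Rightarrow> ('x \<Rightarrow>\<^sub>0 int) \<Rightarrow> ('x \<Rightarrow>\<^sub>0 int)" where
  "d n = frag_extend (D n)"

definition S :: "nat \<Rightarrow> ('x \<Rightarrow>\<^sub>0 int) \<Rightarrow> ('x \<Rightarrow>\<^sub>0 int)" where
  "S n = frag_extend (frag_of \<circ> s n)"

text \<open>The flag selects one of the two differentials of the periodic resolution:
  \<open>S - 1\<close> for \<open>True\<close>, the norm for \<open>False\<close>. Passing to the
  other one is negation, so that one induction treats both parities.\<close>

definition T :: "bool \<Rightarrow> nat \<Rightarrow> ('x \<Rightarrow>\<^sub>0 int) \<Rightarrow> ('x \<Rightarrow>\<^sub>0 int)" where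
  "T b n c = (if b then S n c - c else (\<Sum>i<p. (S n ^^ i) c))"

lemma d_diff: "d n (a - b) = d n a - d n b" and d_add: "d n (a + b) = d n a + d n b"
  and d_cmul: "d n (frag_cmul k a) = frag_cmul k (d n a)" and d_0 [simp]: "d n 0 = 0"
  and d_sum: "finite I \<Longrightarrow> d n (\<Sum>i\<in>I. f i) = (\<Sum>i\<in>I. d n (f i))"
  by (simp_all add: d_def frag_extend_diff frag_extend_add frag_extend_cmul frag_extend_sum o_def)

lemma S_diff: "S n (a - b) = S n a - S n b" and S_add: "S n (a + b) = S n a + S n b"
  and S_cmul: "S n (frag_cmul k a) = frag_cmul k (S n a)" and S_0 [simp]: "S n 0 = 0"
  and S_sum: "finite I \<Longrightarrow> S n (\<Sum>i\<in>I. f i) = (\<Sum>i\<in>I. S n (f i))"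
  by (simp_all add: S_def frag_extend_diff frag_extend_add frag_extend_cmul frag_extend_sum o_def)

lemma S_of [simp]: "S n (frag_of x) = frag_of (s n x)" by (simp add: S_def)

lemma S_pow_of [simp]: "(S n ^^ i) (frag_of x) = frag_of ((s n ^^ i) x)"
  by (induction i) auto

lemma S_pow_diff: "(S n ^^ i) (a - b) = (S n ^^ i) a - (S n ^^ i) b"
  by (induction i) (auto simp: S_diff)

lemma S_pow_add: "(S n ^^ i) (a + b) = (S n ^^ i) a + (S n ^^ i) b"
  by (induction i) (auto simp: S_add)

lemma S_pow_cmul: "(S n ^^ i) (frag_cmul k a) = frag_cmul k ((S n ^^ i) a)"
  by (induction i) (auto simp: S_cmul)

lemma T_diff: "T b n (x - y) = T b n x - T b n y"
  by (auto simp: T_def S_diff S_pow_diff sum_subtractf)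

lemma T_add: "T b n (x + y) = T b n x + T b n y"
  by (auto simp: T_def S_add S_pow_add sum.distrib)

lemma T_cmul: "T b n (frag_cmul k x) = frag_cmul k (T b n x)"
  by (auto simp: T_def S_cmul S_pow_cmul frag_cmul_sum frag_cmul_diff2)

lemma T_0 [simp]: "T b n 0 = 0"
  using T_diff [of b n 0 0] by simp

lemma chains_diff: "a \<in> chains n \<Longrightarrow> b \<in> chains n \<Longrightarrow> a - b \<in> chains n"
  and chains_add: "a \<in> chains n \<Longrightarrow> b \<in> chains n \<Longrightarrow> a + b \<in> chains n"
  and chains_cmul: "a \<in> chains n \<Longrightarrow> frag_cmul k a \<in> chains n"
  unfolding mem_Collect_eq by (simp_all only: keys_subset)

lemma d_chains: "c \<in> chains (Suc n) \<Longrightarrow> d (Suc n) c \<in> chains n"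
  unfolding d_def mem_Collect_eq by (rule keys_frag_extend_subset [of c "B (Suc n)"]) (simp_all add: D_in)

lemma S_chains: "c \<in> chains n \<Longrightarrow> S n c \<in> chains n"
  using keys_frag_extend_subset [of c "B n" "frag_of \<circ> s n" "B n"] s_in by (auto simp: S_def)

lemma S_pow_chains: "c \<in> chains n \<Longrightarrow> (S n ^^ i) c \<in> chains n"
proof (induction i)
  case (Suc i) then show ?case using S_chains by simp
qed simp

lemma T_chains: "c \<in> chains n \<Longrightarrow> T b n c \<in> chains n"
  using S_chains [of c n] S_pow_chains [of c n]
  unfolding mem_Collect_eq T_def by (cases b) (simp_all add: keys_diff_subset keys_sum_subset)

lemma d_S: "c \<in> chains (Suc n) \<Longrightarrow> d (Suc n) (S (Suc n) c) = S n (d (Suc n) c)"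
  by (rule frag_additive_eq [of c "B (Suc n)"]) (auto simp: d_diff S_diff D_s d_def S_def frag_extend_diff)

lemma d_S_pow: "c \<in> chains (Suc n) \<Longrightarrow> d (Suc n) ((S (Suc n) ^^ i) c) = (S n ^^ i) (d (Suc n) c)"
proof (induction i)
  case (Suc i) then show ?case using S_pow_chains [of c "Suc n" i] by (simp add: d_S)
qed simp

lemma d_T: "c \<in> chains (Suc n) \<Longrightarrow> d (Suc n) (T b (Suc n) c) = T b n (d (Suc n) c)"
  by (simp add: T_def d_diff d_S d_sum d_S_pow)

lemma d_d: "c \<in> chains (Suc (Suc n)) \<Longrightarrow> d (Suc n) (d (Suc (Suc n)) c) = 0"
  by (rule frag_additive_eq [of c "B (Suc (Suc n))" _ "\<lambda>_. 0"]) (auto simp: d_diff D_D d_def frag_extend_diff)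

lemma aug_d: "c \<in> chains (Suc 0) \<Longrightarrow> aug (d (Suc 0) c) = 0"
  unfolding d_def by (rule aug_extend_0) (auto simp: aug_D)

lemma aug_S: "aug (S n c) = aug c"
  unfolding S_def by (rule aug_extend [of _ UNIV]) auto

lemma aug_S_pow: "aug ((S n ^^ i) c) = aug c"
  by (induction i) (auto simp: aug_S)

lemma aug_sum: "aug (sum f I) = (\<Sum>i\<in>I. aug (f i))"
  by (induction I rule: infinite_finite_induct) (auto simp: aug_add)

lemma aug_T: "[aug (T b n c) = 0] (mod int p)"
  by (auto simp: T_def aug_diff aug_S aug_S_pow aug_sum cong_def)

lemma fcong_d: "fcong p a b \<Longrightarrow> fcong p (d n a) (d n b)"
  unfolding d_def by (rule fcong_extend)

lemma fcong_T: "fcong p x y \<Longrightarrow> fcong p (T b n x) (T b n y)"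
  unfolding fcong_def by (metis T_diff T_cmul)

lemma S_pow_p: "c \<in> chains n \<Longrightarrow> (S n ^^ p) c = c"
  by (rule frag_additive_eq [of c "B n"]) (auto simp: s_order S_pow_diff)

lemma S_norm:
  assumes "c \<in> chains n" shows "S n (T False n c) = T False n c"
proof -
  have "S n (T False n c) = (\<Sum>i<p. (S n ^^ Suc i) c)"
    by (simp add: T_def S_sum)
  also have "\<dots> + c = (\<Sum>i<Suc p. (S n ^^ i) c)"
    by (simp add: sum.lessThan_Suc_shift del: sum.lessThan_Suc funpow.simps(2))
  also have "\<dots> = T False n c + c"
    using S_pow_p [OF assms] by (simp add: T_def)
  finally show ?thesis by simp
qed

lemma T_T: "c \<in> chains n \<Longrightarrow> T b n (T (\<not> b) n c) = 0"
proof (cases b)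
  case True
  assume "c \<in> chains n" with True show ?thesis using S_norm [of c n] by (simp add: T_def)
next
  case False
  assume c: "c \<in> chains n"
  \<comment> \<open>Telescoping; at \<open>k = p\<close> the right side vanishes because
    \<open>S\<close> has order \<open>p\<close>.\<close>
  have "(\<Sum>i<k. (S n ^^ i) (S n c - c)) = (S n ^^ k) c - c" for k
    by (induction k) (auto simp: S_pow_diff funpow_swap1)
  then show ?thesis using c False S_pow_p by (simp add: T_def)
qed

text \<open>\<open>M\<close> is the derivative \<open>- (\<Sum>i<p. i S ^ i)\<close> of the norm; it satisfies
  \<open>(S - 1) M = N - p\<close>.\<close>

definition M :: "nat \<Rightarrow> ('x \<Rightarrow>\<^sub>0 int) \<Rightarrow> ('x \<Rightarrow>\<^sub>0 int)" where
  "M n c = - (\<Sum>i<p. frag_cmul (int i) ((S n ^^ i) c))"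

lemma M_chains: "c \<in> chains n \<Longrightarrow> M n c \<in> chains n"
  using S_pow_chains [of c n] unfolding mem_Collect_eq M_def keys_minus
  by (intro keys_sum_subset keys_cmul_subset)

lemma M_diff: "M n (a - b) = M n a - M n b"
  by (simp add: M_def S_pow_diff frag_cmul_diff2 sum_subtractf)

lemma M_cmul: "M n (frag_cmul k a) = frag_cmul k (M n a)"
proof -
  have "M n (frag_cmul k a) = frag_cmul (-1) (\<Sum>i<p. frag_cmul k (frag_cmul (int i) ((S n ^^ i) a)))"
    by (simp add: M_def S_pow_cmul mult.commute)
  also have "\<dots> = frag_cmul k (M n a)"
    unfolding frag_cmul_sum [symmetric] by (simp add: M_def mult.commute flip: frag_cmul_minus_one)
  finally show ?thesis .
qed

lemma d_M: "c \<in> chains (Suc n) \<Longrightarrow> d (Suc n) (M (Suc n) c) = M n (d (Suc n) c)"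
proof -
  assume c: "c \<in> chains (Suc n)"
  have "d (Suc n) (- x) = - d (Suc n) x" for x using d_diff [of "Suc n" 0 x] by simp
  then show ?thesis using c by (simp add: M_def d_sum d_cmul d_S_pow)
qed

text \<open>Summation by parts, with a general upper bound so that it can be proved by
  induction.\<close>

lemma T_M_aux:
  "S n (\<Sum>i<k. frag_cmul (int i) ((S n ^^ i) c)) - (\<Sum>i<k. frag_cmul (int i) ((S n ^^ i) c))
    = frag_cmul (int k) ((S n ^^ k) c) - (\<Sum>i<k. (S n ^^ Suc i) c)"
proof (induction k)
  case (Suc k)
  have "frag_cmul (int (Suc k)) x = frag_cmul (int k) x + x" for x :: "'x \<Rightarrow>\<^sub>0 int"
    by (metis frag_cmul_distrib frag_cmul_one of_nat_Suc add.commute)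
  with Suc show ?case by (simp add: S_add S_cmul algebra_simps)
qed simp

lemma T_M: assumes "c \<in> chains n" shows "fcong p (T True n (M n c)) (T False n c)"
proof -
  have "(\<Sum>i<p. (S n ^^ Suc i) c) = T False n c"
    using S_norm [OF assms] by (simp add: T_def S_sum)
  moreover have "S n (- x) = - S n x" for x using S_diff [of n 0 x] by simp
  ultimately have "T True n (M n c) - T False n c = - frag_cmul (int p) c"
    using T_M_aux [where n = n and k = p and c = c] S_pow_p [OF assms] by (simp add: T_def M_def algebra_simps)
  also have "\<dots> = frag_cmul (int p) (- c)" by (metis frag_cmul_minus_one frag_cmul_cmul mult.commute mult_minus1 minus_frag_cmul)
  finally show ?thesis unfolding fcong_def by blast
qed

text \<open>Together with \<open>T_M\<close> this gives that \<open>M\<close> composed with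
  \<open>S - 1\<close>, in either order, is congruent to the norm.\<close>

lemma M_T: assumes "c \<in> chains n" shows "M n (T True n c) = T True n (M n c)"
proof -
  have "M n (S n c) = S n (M n c)"
  proof -
    have "S n (- x) = - S n x" for x using S_diff [of n 0 x] by simp
    then show ?thesis by (simp add: M_def S_sum S_cmul funpow_swap1)
  qed
  then show ?thesis by (simp add: T_def M_diff)
qed

lemma fcong_M: "fcong p x y \<Longrightarrow> fcong p (M n x) (M n y)"
  unfolding fcong_def by (metis M_diff M_cmul)

subsection \<open>Exactness of the periodic sequence\<close>

lemma s_pow_in: "x \<in> B n \<Longrightarrow> (s n ^^ i) x \<in> B n"
  by (induction i) (auto simp: s_in)

lemma s_pow_mult: "x \<in> B n \<Longrightarrow> (s n ^^ k) x = x \<Longrightarrow> (s n ^^ (k * a)) x = x"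
  by (induction a) (auto simp: funpow_add)

lemma s_pow_free:
  assumes "x \<in> B n" "0 < k" "k < p" shows "(s n ^^ k) x \<noteq> x"
proof
  assume eq: "(s n ^^ k) x = x"
  have "coprime k p" using assms prime_p prime_imp_coprime [of p k] nat_dvd_not_less
    by (auto simp: coprime_commute)
  \<comment> \<open>Primality makes \<open>k\<close> invertible modulo \<open>p\<close>, so
    \<open>s\<close> acts on the orbit as a power of \<open>s ^^ k\<close> and would fix
    \<open>x\<close>.\<close>
  then obtain a b where "k * a = p * b + 1"
    using bezout_nat [of k p] assms by auto
  then have "(s n ^^ (k * a)) x = s n ((s n ^^ (p * b)) x)" by simp
  also have "(s n ^^ (p * b)) x = x" using s_pow_mult s_order assms by blast
  finally show False using s_pow_mult [OF assms(1) eq, of a] s_free [OF assms(1)] by simp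
qed

lemma s_pow_eqD:
  assumes "x \<in> B n" "(s n ^^ i) x = (s n ^^ j) x" "i < p" "j < p" shows "i = j"
proof -
  have False if "(s n ^^ i) x = (s n ^^ j) x" "i < j" "j < p" for i j
  proof -
    have "(s n ^^ j) x = (s n ^^ (j - i)) ((s n ^^ i) x)"
      using that by (metis funpow_add comp_apply le_add_diff_inverse2 less_imp_le)
    then have "(s n ^^ (j - i)) ((s n ^^ i) x) = (s n ^^ i) x" using that by metis
    then show False using s_pow_free [OF s_pow_in [OF assms(1)], of "j - i" i] that
      by (metis less_imp_diff_less zero_less_diff)
  qed
  then show ?thesis using assms by (metis nat_neq_iff)
qed

lemma s_pow_mod: "x \<in> B n \<Longrightarrow> (s n ^^ i) x = (s n ^^ (i mod p)) x"
proof -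
  assume x: "x \<in> B n"
  have "(s n ^^ i) x = (s n ^^ (i mod p)) ((s n ^^ (p * (i div p))) x)"
    by (metis comp_apply funpow_add mod_mult_div_eq)
  then show ?thesis using s_pow_mult [OF x] s_order [OF x] by simp
qed

definition orb :: "nat \<Rightarrow> 'x \<Rightarrow> 'x set" where "orb n x = range (\<lambda>i. (s n ^^ i) x)"

text \<open>The choice is made from the orbit as a set, hence it is the same for all points of an
  orbit.\<close>

definition rep :: "nat \<Rightarrow> 'x \<Rightarrow> 'x" where "rep n x = (SOME y. y \<in> orb n x)"

definition idx :: "nat \<Rightarrow> 'x \<Rightarrow> nat" where "idx n x = (SOME i. i < p \<and> x = (s n ^^ i) (rep n x))"

lemma orb_s_pow: "x \<in> B n \<Longrightarrow> orb n ((s n ^^ i) x) = orb n x"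
proof -
  assume x: "x \<in> B n"
  have "(s n ^^ j) x = (s n ^^ (j + (p - i mod p))) ((s n ^^ i) x)" for j
  proof -
    have "(s n ^^ (j + (p - i mod p))) ((s n ^^ i) x) = (s n ^^ (j + (p - i mod p))) ((s n ^^ (i mod p)) x)"
      using s_pow_mod [OF x] by metis
    also have "\<dots> = (s n ^^ (j + (p - i mod p) + i mod p)) x" by (simp add: funpow_add)
    also have "j + (p - i mod p) + i mod p = j + p" using mod_less_divisor [OF p_pos, of i] by linarith
    finally show ?thesis using s_order [OF x] by (simp add: funpow_add)
  qed
  moreover have "(s n ^^ j) ((s n ^^ i) x) = (s n ^^ (j + i)) x" for j by (simp add: funpow_add)
  ultimately show ?thesis unfolding orb_def by (auto simp: image_iff)
qed

lemma rep_orb: "rep n x \<in> orb n x"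
  unfolding rep_def by (rule someI [of _ x]) (auto simp: orb_def intro: range_eqI [of _ _ 0])

lemma rep_in: "x \<in> B n \<Longrightarrow> rep n x \<in> B n"
  using rep_orb [of n x] by (auto simp: orb_def s_pow_in)

lemma rep_s_pow: "x \<in> B n \<Longrightarrow> rep n ((s n ^^ i) x) = rep n x"
  unfolding rep_def by (simp add: orb_s_pow)

lemma idx: assumes "x \<in> B n" shows "idx n x < p" "(s n ^^ idx n x) (rep n x) = x"
proof -
  obtain i where i: "rep n x = (s n ^^ i) x" using rep_orb [of n x] by (auto simp: orb_def)
  have "x \<in> orb n (rep n x)"
    unfolding i orb_s_pow [OF assms] by (auto simp: orb_def intro: range_eqI [of _ _ 0])
  then obtain j where "x = (s n ^^ j) (rep n x)" by (auto simp: orb_def)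
  then have "j mod p < p \<and> x = (s n ^^ (j mod p)) (rep n x)"
    using s_pow_mod [OF rep_in [OF assms]] p_pos by simp
  then have "idx n x < p \<and> x = (s n ^^ idx n x) (rep n x)" unfolding idx_def by (rule someI)
  then show "idx n x < p" "(s n ^^ idx n x) (rep n x) = x" by auto
qed

lemma idx_eqI: "x \<in> B n \<Longrightarrow> i < p \<Longrightarrow> x = (s n ^^ i) (rep n x) \<Longrightarrow> idx n x = i"
  using idx [of x n] s_pow_eqD [of "rep n x" n "idx n x" i] rep_in by simp

lemma idx_s:
  assumes "x \<in> B n" shows "idx n (s n x) = (if idx n x = p - 1 then 0 else Suc (idx n x))"
proof -
  have r: "rep n (s n x) = rep n x" using rep_s_pow [OF assms, of 1] by simp
  have e: "s n x = (s n ^^ Suc (idx n x)) (rep n (s n x))"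
    using idx(2) [OF assms] r by simp
  show ?thesis
  proof (cases "idx n x = p - 1")
    case True
    then have "s n x = (s n ^^ 0) (rep n (s n x))"
      using e p_pos s_order [OF rep_in [OF s_in [OF assms]]] by simp
    then show ?thesis using idx_eqI [OF s_in [OF assms], of 0] True p_pos by simp
  next
    case False
    then have "Suc (idx n x) < p" using idx(1) [OF assms] by simp
    then show ?thesis using idx_eqI [OF s_in [OF assms] _ e] False by simp
  qed
qed

definition rho :: "nat \<Rightarrow> ('x \<Rightarrow>\<^sub>0 int) \<Rightarrow> ('x \<Rightarrow>\<^sub>0 int)" where
  "rho n = frag_extend (frag_of \<circ> rep n)"

text \<open>The quotient \<open>(S ^ i - 1) / (S - 1)\<close> applied to the representative, where
  \<open>i\<close> is the position in the orbit: a contracting homotopy for the periodic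
  sequence.\<close>

definition hom_op :: "nat \<Rightarrow> ('x \<Rightarrow>\<^sub>0 int) \<Rightarrow> ('x \<Rightarrow>\<^sub>0 int)" where
  "hom_op n = frag_extend (\<lambda>x. \<Sum>j<idx n x. frag_of ((s n ^^ j) (rep n x)))"

text \<open>Reads off, orbit by orbit, the coefficient of the last point \<open>s ^ (p - 1)\<close>
  of the representative.\<close>

definition eta :: "nat \<Rightarrow> ('x \<Rightarrow>\<^sub>0 int) \<Rightarrow> ('x \<Rightarrow>\<^sub>0 int)" where
  "eta n = frag_extend (\<lambda>x. if idx n x = p - 1 then frag_of (rep n x) else 0)"

lemma hom_op_chains: "c \<in> chains n \<Longrightarrow> hom_op n c \<in> chains n"
  unfolding hom_op_def mem_Collect_eq
  by (rule keys_frag_extend_subset [of c "B n"], assumption, rule keys_sum_subset) (simp add: s_pow_in rep_in)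

lemma eta_chains: "c \<in> chains n \<Longrightarrow> eta n c \<in> chains n"
  unfolding eta_def mem_Collect_eq
  by (rule keys_frag_extend_subset [of c "B n"]) (simp_all add: rep_in)

lemma T_hom_op:
  assumes "c \<in> chains n" shows "T True n (hom_op n c) = c - rho n c"
proof (rule frag_additive_eq [of c "B n"])
  fix x assume x: "x \<in> B n"
  have "S n (\<Sum>j<k. frag_of ((s n ^^ j) y)) - (\<Sum>j<k. frag_of ((s n ^^ j) y)) = frag_of ((s n ^^ k) y) - frag_of y" for k y
    by (induction k) (auto simp: S_add algebra_simps)
  then show "T True n (hom_op n (frag_of x)) = frag_of x - rho n (frag_of x)"
    using idx(2) [OF x] by (simp add: T_def hom_op_def rho_def)
qed (use assms in \<open>auto simp: T_diff hom_op_def rho_def frag_extend_diff\<close>)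

text \<open>\<open>S\<close> raises the position by one and adds one summand, namely
  \<open>x\<close>. The exception is the last position, where the partial sum drops to 0; the
  missing terms make up a full norm, which \<open>eta\<close> records.\<close>

lemma hom_op_S:
  assumes "c \<in> chains n" shows "hom_op n (S n c) - hom_op n c = c - T False n (eta n c)"
proof (rule frag_additive_eq [of c "B n"])
  fix x assume x: "x \<in> B n"
  let ?r = "rep n x"
  have r: "rep n (s n x) = ?r" using rep_s_pow [OF x, of 1] by simp
  have sp: "(\<Sum>j<p. frag_of ((s n ^^ j) ?r)) = (\<Sum>j<p - 1. frag_of ((s n ^^ j) ?r)) + frag_of ((s n ^^ (p - 1)) ?r)"
    using p_pos sum.lessThan_Suc [of "\<lambda>j. frag_of ((s n ^^ j) ?r)" "p - 1"] by simp
  show "hom_op n (S n (frag_of x)) - hom_op n (frag_of x) = frag_of x - T False n (eta n (frag_of x))"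
  proof (cases "idx n x = p - 1")
    case True
    then have "(s n ^^ (p - 1)) ?r = x" using idx(2) [OF x] by simp
    then show ?thesis using True sp by (simp add: hom_op_def eta_def T_def idx_s x r)
  next
    case False
    have "T False n 0 = 0" by simp
    with False show ?thesis using idx(2) [OF x] by (simp add: hom_op_def eta_def idx_s x r)
  qed
qed (use assms in \<open>auto simp: T_diff S_diff hom_op_def eta_def frag_extend_diff algebra_simps\<close>)

text \<open>Among the \<open>p\<close> translates of a point exactly one has the last
  position.\<close>

lemma eta_norm:
  assumes "c \<in> chains n" shows "eta n (T False n c) = rho n c"
proof (rule frag_additive_eq [of c "B n"])
  fix x assume x: "x \<in> B n"
  let ?f = "\<lambda>i. if idx n ((s n ^^ i) x) = p - 1 then frag_of (rep n x) else 0"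
  have "eta n (T False n (frag_of x)) = (\<Sum>i<p. ?f i)"
    by (simp add: T_def eta_def frag_extend_sum rep_s_pow x o_def cong: if_cong)
  also have "\<dots> = (\<Sum>i\<in>{p - 1 - idx n x}. ?f i)"
  proof (rule sum.mono_neutral_right)
    show "\<forall>i\<in>{..<p} - {p - 1 - idx n x}. ?f i = 0"
    proof
      fix i assume i: "i \<in> {..<p} - {p - 1 - idx n x}"
      have "idx n ((s n ^^ i) x) \<noteq> p - 1"
      proof
        assume "idx n ((s n ^^ i) x) = p - 1"
        then have "(s n ^^ (p - 1)) (rep n x) = (s n ^^ i) x"
          using idx(2) [OF s_pow_in [OF x], of i] by (simp add: rep_s_pow x)
        have e: "(s n ^^ (p - 1)) (rep n x) = (s n ^^ (i + idx n x)) (rep n x)"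
          using \<open>(s n ^^ (p - 1)) (rep n x) = (s n ^^ i) x\<close> idx(2) [OF x] by (simp add: funpow_add)
        have "p - 1 = (i + idx n x) mod p"
          using e s_pow_eqD [OF rep_in [OF x], of "p - 1" "(i + idx n x) mod p"]
            s_pow_mod [OF rep_in [OF x], of "i + idx n x"] p_pos by simp
        moreover have "i + idx n x < 2 * p" "i < p" "idx n x < p" using i idx(1) [OF x] by auto
        \<comment> \<open>A wrap-around would force the sum to be \<open>2 * p - 1\<close>, which
          two numbers below \<open>p\<close> cannot reach.\<close>
        ultimately have "i + idx n x = p - 1"
        proof (cases "i + idx n x < p")
          case False
          then have "(i + idx n x) mod p = i + idx n x - p"
            using \<open>i + idx n x < 2 * p\<close> by (simp add: mod_if)
          then show ?thesis using \<open>p - 1 = _\<close> \<open>i < p\<close> \<open>idx n x < p\<close> False by linarith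
        qed simp
        then show False using i by auto
      qed
      then show "?f i = 0" by simp
    qed
  qed (use p_pos in auto)
  also have "\<dots> = frag_of (rep n x)"
  proof -
    let ?i = "p - 1 - idx n x"
    have "(s n ^^ ?i) x = (s n ^^ (?i + idx n x)) (rep n x)"
      using idx(2) [OF x] by (simp add: funpow_add)
    also have "?i + idx n x = p - 1" using idx(1) [OF x] by simp
    finally have "idx n ((s n ^^ ?i) x) = p - 1"
      using idx_eqI [OF s_pow_in [OF x], of "p - 1" ?i] p_pos rep_s_pow [OF x, of ?i] by (metis diff_less zero_less_one)
    then show ?thesis by simp
  qed
  finally show "eta n (T False n (frag_of x)) = rho n (frag_of x)" by (simp add: rho_def)
qed (use assms in \<open>auto simp: T_diff eta_def rho_def frag_extend_diff\<close>)

text \<open>If the norm of \<open>c\<close> vanishes, then \<open>eta\<close> shows that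
  \<open>rho n c\<close> vanishes, and \<open>hom_op\<close> supplies the primitive for
  \<open>S - 1\<close>. If \<open>S - 1\<close> kills \<open>c\<close>, then \<open>hom_op_S\<close>
  leaves \<open>c\<close> congruent to the norm of \<open>eta n c\<close>.\<close>

lemma exact:
  assumes c: "c \<in> chains n" and 0: "fcong p (T (\<not> b) n c) 0"
  obtains x where "x \<in> chains n" "fcong p c (T b n x)"
proof (cases b)
  case True
  have "fcong p (rho n c) 0"
    using fcong_extend [OF 0, of "\<lambda>x. if idx n x = p - 1 then frag_of (rep n x) else 0"] True eta_norm [OF c]
    by (simp add: eta_def)
  then have "fcong p (c - rho n c) (c - 0)"
    by (intro fcong_diff fcong_refl)
  then show ?thesis
    using that [of "hom_op n c"] T_hom_op [OF c] hom_op_chains [OF c] True by (metis diff_zero fcong_sym)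
next
  case False
  have "hom_op n (S n c) - hom_op n c = hom_op n (T True n c)" by (simp add: T_def hom_op_def frag_extend_diff)
  moreover have "fcong p (hom_op n (T True n c)) 0"
    using fcong_extend [OF 0, of "\<lambda>x. \<Sum>j<idx n x. frag_of ((s n ^^ j) (rep n x))"] False by (simp add: hom_op_def)
  ultimately have "fcong p (c - T False n (eta n c)) 0" using hom_op_S [OF c] by simp
  then show ?thesis using that [of "eta n c"] eta_chains [OF c] False fcong_diff_iff by auto
qed

text \<open>\<open>rho\<close> factors through \<open>q\<close>, by choosing a preimage of each
  point of the quotient. So a chain that dies in the quotient has \<open>rho n c\<close> congruent
  to 0, and \<open>T_hom_op\<close> applies.\<close>

lemma quotient_kernel:
  assumes c: "c \<in> chains n"
    and q: "fcong p (frag_extend (frag_of \<circ> q) c) 0"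
    and inj: "\<And>x y. x \<in> B n \<Longrightarrow> y \<in> B n \<Longrightarrow> q x = q y \<Longrightarrow> \<exists>i. y = (s n ^^ i) x"
  obtains x where "x \<in> chains n" "fcong p c (T True n x)"
proof -
  define k where "k t = frag_of (rep n (SOME x. x \<in> B n \<and> q x = t))" for t
  have "frag_extend k (frag_extend (frag_of \<circ> q) c) = rho n c"
  proof (rule frag_additive_eq [of c "B n"])
    fix x assume x: "x \<in> B n"
    let ?y = "SOME y. y \<in> B n \<and> q y = q x"
    have "?y \<in> B n \<and> q ?y = q x" by (rule someI [of _ x]) (simp add: x)
    then obtain i where "?y = (s n ^^ i) x" using inj [OF x] by metis
    then show "frag_extend k (frag_extend (frag_of \<circ> q) (frag_of x)) = rho n (frag_of x)"
      using rep_s_pow [OF x, of i] by (simp add: rho_def k_def)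
  qed (use c in \<open>auto simp: rho_def frag_extend_diff\<close>)
  then have "fcong p (rho n c) 0"
    using fcong_extend [OF q, of k] by simp
  then have "fcong p (c - rho n c) (c - 0)"
    by (intro fcong_diff fcong_refl)
  then show ?thesis
    using that [of "hom_op n c"] T_hom_op [OF c] hom_op_chains [OF c] by (metis diff_zero fcong_sym)
qed

subsection \<open>Towers\<close>

text \<open>The number \<open>l\<close> is the value of a generator of $H^n(B(\mathbb{Z}/p); \mathbb{F}_p)$ on the image
  of \<open>y\<close> in the quotient, which is a cycle modulo \<open>p\<close> if \<open>b\<close> is true.\<close>

primrec tower :: "nat \<Rightarrow> bool \<Rightarrow> ('x \<Rightarrow>\<^sub>0 int) \<Rightarrow> int \<Rightarrow> bool" where
  "tower 0 b y l \<longleftrightarrow> y \<in> chains 0 \<and> [aug y = l] (mod int p)"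
| "tower (Suc n) b y l \<longleftrightarrow> y \<in> chains (Suc n) \<and>
     (\<exists>y'. fcong p (d (Suc n) y) (T b n y') \<and> tower n (\<not> b) y' l)"

lemma tower_chains: "tower n b y l \<Longrightarrow> y \<in> chains n"
  by (cases n) auto

text \<open>The hypothesis is what exactness needs to write \<open>d y\<close> as
  \<open>T b x\<close>; from \<open>d d y = 0\<close> the chain \<open>d x\<close> is again killed
  by \<open>T b\<close>, so the construction continues downwards.\<close>

lemma tower_exists:
  "y \<in> chains n \<Longrightarrow> (\<And>m. n = Suc m \<Longrightarrow> fcong p (T (\<not> b) m (d n y)) 0) \<Longrightarrow> \<exists>l. tower n b y l"
proof (induction n arbitrary: b y)
  case 0
  then show ?case by (auto intro: cong_refl)
next
  case (Suc n)
  obtain x where x: "x \<in> chains n" "fcong p (d (Suc n) y) (T b n x)"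
    using exact [OF d_chains [OF Suc.prems(1)] Suc.prems(2) [OF refl]] by blast
  have "\<exists>l. tower n (\<not> b) x l"
  proof (rule Suc.IH [OF x(1)])
    fix m assume m: "n = Suc m"
    have "T b m (d n x) = d n (T b n x)" using x(1) m d_T by simp
    moreover have "fcong p (d n (T b n x)) (d n (d (Suc n) y))"
      using fcong_d [OF fcong_sym [OF x(2)]] .
    ultimately show "fcong p (T (\<not> \<not> b) m (d n x)) 0"
      using d_d Suc.prems(1) m by simp
  qed
  then show ?case using Suc.prems(1) x by auto
qed

text \<open>Independence of choices. If \<open>y\<close> is a boundary plus \<open>T b x\<close>,
  then \<open>y' - d x\<close> is killed by \<open>T b\<close>, hence is congruent to
  \<open>T (\<not> b) z\<close>, so that \<open>y'\<close> has the same shape one degree lower. In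
  degree 0 the augmentation kills boundaries, and \<open>T\<close> modulo \<open>p\<close>.\<close>

lemma tower_boundary:
  "tower n b y l \<Longrightarrow> x \<in> chains n \<Longrightarrow> x' \<in> chains (Suc n) \<Longrightarrow> fcong p y (d (Suc n) x' + T b n x)
    \<Longrightarrow> [l = 0] (mod int p)"
proof (induction n arbitrary: b y x x')
  case 0
  have "[aug y = aug (d (Suc 0) x' + T b 0 x)] (mod int p)" using fcong_aug 0 by blast
  also have "aug (d (Suc 0) x' + T b 0 x) = aug (T b 0 x)" using aug_d 0 by (simp add: aug_add)
  also have "[\<dots> = 0] (mod int p)" by (rule aug_T)
  finally show ?case using 0 by (auto simp: cong_def)
next
  case (Suc n)
  obtain y' where y': "fcong p (d (Suc n) y) (T b n y')" "tower n (\<not> b) y' l" using Suc.prems by auto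
  have "fcong p (d (Suc n) y) (d (Suc n) (d (Suc (Suc n)) x' + T b (Suc n) x))"
    using fcong_d Suc.prems by blast
  also have "d (Suc n) (d (Suc (Suc n)) x' + T b (Suc n) x) = T b n (d (Suc n) x)"
    using d_d d_T Suc.prems by (simp add: d_add)
  finally have "fcong p (T b n (y' - d (Suc n) x)) 0"
    using y'(1) by (metis T_diff fcong_diff_iff fcong_sym fcong_trans)
  moreover have c: "y' - d (Suc n) x \<in> chains n"
    by (intro chains_diff d_chains tower_chains [OF y'(2)] Suc.prems)
  ultimately obtain z where z: "z \<in> chains n" "fcong p (y' - d (Suc n) x) (T (\<not> b) n z)"
    using exact [of "y' - d (Suc n) x" n "\<not> b"] by auto
  from fcong_add [OF fcong_refl z(2), of "d (Suc n) x"]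
  have "fcong p y' (d (Suc n) x + T (\<not> b) n z)" by simp
  then show ?case using Suc.IH [OF y'(2) z(1)] Suc.prems by blast
qed

text \<open>The converse in an acyclic complex: once \<open>y'\<close> is a boundary of
  \<open>x'\<close> plus \<open>T (\<not> b) x\<close>, applying \<open>T b\<close> removes the
  second term, so \<open>y - T b x'\<close> is a cycle modulo \<open>p\<close> and can be
  filled.\<close>

lemma tower_acyclic:
  assumes "\<And>n y. n \<le> N \<Longrightarrow> y \<in> chains n \<Longrightarrow> (n \<noteq> 0 \<Longrightarrow> fcong p (d n y) 0) \<Longrightarrow> (n = 0 \<Longrightarrow> [aug y = 0] (mod int p)) \<Longrightarrow>
      \<exists>x\<in>chains (Suc n). fcong p y (d (Suc n) x)"
  shows "n \<le> N \<Longrightarrow> tower n b y l \<Longrightarrow> [l = 0] (mod int p) \<Longrightarrow>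
    \<exists>x\<in>chains n. \<exists>x'\<in>chains (Suc n). fcong p y (d (Suc n) x' + T b n x)"
proof (induction n arbitrary: b y)
  case 0
  then have "[aug y = 0] (mod int p)" by (auto simp: cong_def)
  then obtain x where "x \<in> chains (Suc 0)" "fcong p y (d (Suc 0) x)"
    using assms [of 0 y] 0 by auto
  then show ?case by (intro bexI [of _ 0] bexI [of _ x]) auto
next
  case (Suc n)
  obtain y' where y': "fcong p (d (Suc n) y) (T b n y')" "tower n (\<not> b) y' l" using Suc.prems by auto
  obtain x x' where x: "x \<in> chains n" "x' \<in> chains (Suc n)" "fcong p y' (d (Suc n) x' + T (\<not> b) n x)"
    using Suc.IH [OF _ y'(2)] Suc.prems by auto
  have "fcong p (T b n y') (T b n (d (Suc n) x' + T (\<not> b) n x))" using fcong_T x(3) .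
  also have "\<dots> = d (Suc n) (T b (Suc n) x')"
    using T_T x by (simp add: T_add d_T)
  finally have "fcong p (d (Suc n) (y - T b (Suc n) x')) 0"
    using y'(1) by (metis d_diff fcong_diff_iff fcong_trans)
  moreover have "y - T b (Suc n) x' \<in> chains (Suc n)"
    by (intro chains_diff T_chains x tower_chains [OF Suc.prems(2)])
  ultimately obtain z where z: "z \<in> chains (Suc (Suc n))" "fcong p (y - T b (Suc n) x') (d (Suc (Suc n)) z)"
    using assms [of "Suc n" "y - T b (Suc n) x'"] Suc.prems(1) by auto
  from fcong_add [OF z(2) fcong_refl, of "T b (Suc n) x'"]
  have "fcong p y (d (Suc (Suc n)) z + T b (Suc n) x')" by simp
  then show ?case using x z by blast
qed

text \<open>Lets a multiple of a tower with invertible value be subtracted to reach the value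
  0.\<close>

lemma tower_lincomb:
  "tower n b y l \<Longrightarrow> tower n b z k \<Longrightarrow> tower n b (y - frag_cmul m z) (l - m * k)"
proof (induction n arbitrary: b y z)
  case 0
  then have "y - frag_cmul m z \<in> chains 0" by (intro chains_diff chains_cmul) auto
  with 0 show ?case
    by (auto simp: aug_diff aug_cmul intro!: cong_diff cong_scalar_left)
next
  case (Suc n)
  obtain y' where y': "fcong p (d (Suc n) y) (T b n y')" "tower n (\<not> b) y' l" using Suc.prems by auto
  obtain z' where z': "fcong p (d (Suc n) z) (T b n z')" "tower n (\<not> b) z' k" using Suc.prems by auto
  have "fcong p (d (Suc n) (y - frag_cmul m z)) (T b n (y' - frag_cmul m z'))"
    by (simp add: d_diff d_cmul T_diff T_cmul fcong_diff fcong_cmul y' z')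
  moreover have "y - frag_cmul m z \<in> chains (Suc n)"
    using Suc.prems by (intro chains_diff chains_cmul tower_chains)
  ultimately show ?case using Suc.IH [OF y'(2) z'(2)] by auto
qed

text \<open>Two layers at a time: the norm, then \<open>S - 1\<close>, become \<open>S - 1\<close>,
  then the norm, when \<open>M\<close> is applied to the chain in between. The chain two degrees
  lower is kept, so in even degree the conversion ends at the unchanged bottom chain and at the same
  \<open>l\<close>.\<close>

lemma tower_convert:
  "tower n False y l \<Longrightarrow> even n \<Longrightarrow> tower n True y l"
proof (induction n arbitrary: y rule: less_induct)
  case (less n)
  consider "n = 0" | m where "n = Suc (Suc m)" using less.prems(2)
    by (metis even_Suc even_zero not0_implies_Suc)
  then show ?case
  proof cases
    case 1 with less.prems show ?thesis by simp
  next
    case (2 m)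
    obtain y' y'' where y: "y \<in> chains n" "fcong p (d n y) (T False (Suc m) y')" "y' \<in> chains (Suc m)"
      "fcong p (d (Suc m) y') (T True m y'')" "tower m False y'' l"
      using less.prems(1) 2 by auto
    have y'': "y'' \<in> chains m" using y(5) tower_chains by blast
    have "fcong p (d n y) (T True (Suc m) (M (Suc m) y'))"
      using y(2) T_M [OF y(3)] by (meson fcong_sym fcong_trans)
    moreover have "fcong p (d (Suc m) (M (Suc m) y')) (T False m y'')"
    proof -
      have "d (Suc m) (M (Suc m) y') = M m (d (Suc m) y')" using d_M y(3) .
      moreover have "fcong p (M m (d (Suc m) y')) (M m (T True m y''))" using fcong_M y(4) .
      ultimately show ?thesis using M_T [OF y''] T_M [OF y''] by (metis fcong_trans)
    qed
    moreover have "tower m True y'' l" using less.IH [of m] y(5) less.prems(2) 2 by auto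
    ultimately show ?thesis using y M_chains [OF y(3)] 2 by auto
  qed
qed

text \<open>Each discarded top layer negates the flag.\<close>

lemma tower_truncate:
  "tower n b y l \<Longrightarrow> m \<le> n \<Longrightarrow> \<exists>z. tower m (if even (n - m) then b else \<not> b) z l"
proof (induction n arbitrary: b y)
  case 0 then show ?case by auto
next
  case (Suc n)
  show ?case
  proof (cases "m = Suc n")
    case True then show ?thesis using Suc.prems by auto
  next
    case False
    obtain y' where "tower n (\<not> b) y' l" using Suc.prems by auto
    moreover have le: "m \<le> n" using False Suc.prems by auto
    ultimately obtain z where "tower m (if even (n - m) then \<not> b else \<not> \<not> b) z l"
      using Suc.IH by blast
    moreover have "even (Suc n - m) = (\<not> even (n - m))" using le by (simp add: Suc_diff_le)
    ultimately show ?thesis by (auto simp del: even_diff_nat split: if_splits)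
  qed
qed

end

section \<open>Equivariant augmented chain maps\<close>

locale Zp_map = src: Zp_complex p B D s + tgt: Zp_complex p B' D' s'
  for p :: nat and B :: "nat \<Rightarrow> 'x set" and D s
    and B' :: "nat \<Rightarrow> 'y set" and D' s' +
  fixes h :: "nat \<Rightarrow> 'x \<Rightarrow> ('y \<Rightarrow>\<^sub>0 int)"
  assumes h_in: "x \<in> B n \<Longrightarrow> Poly_Mapping.keys (h n x) \<subseteq> B' n"
    and h_D: "x \<in> B (Suc n) \<Longrightarrow> frag_extend (D' (Suc n)) (h (Suc n) x) = frag_extend (h n) (D (Suc n) x)"
    and h_s: "x \<in> B n \<Longrightarrow> h n (s n x) = frag_extend (frag_of \<circ> s' n) (h n x)"
    and h_aug: "x \<in> B 0 \<Longrightarrow> aug (h 0 x) = 1"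
begin

lemma h_chains: "c \<in> src.chains n \<Longrightarrow> frag_extend (h n) c \<in> tgt.chains n"
  unfolding mem_Collect_eq by (rule keys_frag_extend_subset [of c "B n"]) (simp_all add: h_in)

lemma h_d: "c \<in> src.chains (Suc n) \<Longrightarrow>
    tgt.d (Suc n) (frag_extend (h (Suc n)) c) = frag_extend (h n) (src.d (Suc n) c)"
  by (rule frag_additive_eq [of c "B (Suc n)"]) (auto simp: h_D src.d_def tgt.d_def frag_extend_diff)

lemma h_S: "c \<in> src.chains n \<Longrightarrow> tgt.S n (frag_extend (h n) c) = frag_extend (h n) (src.S n c)"
  by (rule frag_additive_eq [of c "B n"]) (auto simp: h_s src.S_def tgt.S_def frag_extend_diff)

lemma h_S_pow: "c \<in> src.chains n \<Longrightarrow> (tgt.S n ^^ i) (frag_extend (h n) c) = frag_extend (h n) ((src.S n ^^ i) c)"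
proof (induction i)
  case (Suc i) then show ?case using h_S [OF src.S_pow_chains] by simp
qed simp

lemma h_T: "c \<in> src.chains n \<Longrightarrow> tgt.T b n (frag_extend (h n) c) = frag_extend (h n) (src.T b n c)"
  by (simp add: src.T_def tgt.T_def h_S h_S_pow frag_extend_diff frag_extend_sum o_def)

text \<open>The image of every layer is a layer, and in degree 0 the augmentation is preserved; so
  the value is a natural invariant and can be computed in any complex that receives a map.\<close>

lemma h_tower: "src.tower n b y l \<Longrightarrow> tgt.tower n b (frag_extend (h n) y) l"
proof (induction n arbitrary: b y)
  case 0
  then have "aug (frag_extend (h 0) y) = aug y" by (intro aug_extend [of _ "B 0"]) (auto simp: h_aug)
  with 0 show ?case using h_chains [of y 0] by auto
next
  case (Suc n)
  obtain y' where y': "fcong p (src.d (Suc n) y) (src.T b n y')" "src.tower n (\<not> b) y' l" using Suc.prems by auto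
  have "fcong p (tgt.d (Suc n) (frag_extend (h (Suc n)) y)) (tgt.T b n (frag_extend (h n) y'))"
    using fcong_extend [OF y'(1), of "h n"] h_d h_T src.tower_chains [OF y'(2)] src.tower_chains [OF Suc.prems] by simp
  then show ?case using Suc.IH [OF y'(2)] h_chains src.tower_chains [OF Suc.prems] by auto
qed

end

section \<open>Complexes of lists of vertices\<close>

text \<open>The cone with apex \<open>v\<close>; by \<open>ld_consf\<close> it is a contracting
  homotopy for the augmented boundary.\<close>

definition consf :: "'v \<Rightarrow> ('v list \<Rightarrow>\<^sub>0 int) \<Rightarrow> ('v list \<Rightarrow>\<^sub>0 int)" where
  "consf v = frag_extend (\<lambda>l. frag_of (v # l))"

text \<open>The boundary is augmented: the boundary of a vertex is the empty list.\<close>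

primrec list_boundary :: "'v list \<Rightarrow> ('v list \<Rightarrow>\<^sub>0 int)" where
  "list_boundary [] = 0"
| "list_boundary (v # l) = frag_of l - consf v (list_boundary l)"

abbreviation ld :: "('v list \<Rightarrow>\<^sub>0 int) \<Rightarrow> ('v list \<Rightarrow>\<^sub>0 int)" where
  "ld \<equiv> frag_extend list_boundary"

abbreviation lmap :: "('v \<Rightarrow> 'w) \<Rightarrow> ('v list \<Rightarrow>\<^sub>0 int) \<Rightarrow> ('w list \<Rightarrow>\<^sub>0 int)" where
  "lmap f \<equiv> frag_extend (frag_of \<circ> map f)"

lemma consf_of [simp]: "consf v (frag_of l) = frag_of (v # l)"
  and consf_diff: "consf v (a - b) = consf v a - consf v b"
  and consf_0 [simp]: "consf v 0 = 0"
  and consf_cmul: "consf v (frag_cmul k a) = frag_cmul k (consf v a)"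
  and consf_sum: "finite I \<Longrightarrow> consf v (\<Sum>i\<in>I. f i) = (\<Sum>i\<in>I. consf v (f i))"
  by (simp_all add: consf_def frag_extend_diff frag_extend_cmul frag_extend_sum o_def)

lemma ld_consf: "ld (consf v c) = c - consf v (ld c)"
  by (rule frag_additive_eq [of c UNIV]) (auto simp: consf_diff frag_extend_diff)

lemma ld_list_boundary: "ld (list_boundary l) = 0"
  by (induction l) (simp_all add: frag_extend_diff ld_consf)

lemma lmap_consf: "lmap f (consf v c) = consf (f v) (lmap f c)"
  by (rule frag_additive_eq [of c UNIV]) (auto simp: consf_diff frag_extend_diff)

lemma list_boundary_map: "list_boundary (map f l) = lmap f (list_boundary l)"
  by (induction l) (simp_all add: frag_extend_diff lmap_consf lmap_consf [unfolded o_def])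

lemma list_boundary_sum:
  "list_boundary l = (\<Sum>k<length l. frag_cmul ((-1) ^ k) (frag_of (take k l @ drop (Suc k) l)))"
proof (induction l)
  case (Cons v l)
  have "frag_cmul (-1 * c) x = - frag_cmul c x" for c and x :: "'a list \<Rightarrow>\<^sub>0 int" by simp
  then show ?case
    by (simp add: Cons sum.lessThan_Suc_shift consf_sum consf_cmul sum_negf del: sum.lessThan_Suc minus_frag_cmul)
qed simp

lemma keys_list_boundary:
  assumes "m \<in> Poly_Mapping.keys (list_boundary l)"
  obtains k where "k < length l" "m = take k l @ drop (Suc k) l"
proof -
  have "Poly_Mapping.keys (list_boundary l) \<subseteq> {take k l @ drop (Suc k) l | k. k < length l}"
    unfolding list_boundary_sum by (rule keys_sum_subset) auto
  then show ?thesis using assms that by blast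
qed

lemma aug_list_boundary: "length l = Suc (Suc 0) \<Longrightarrow> aug (list_boundary l) = 0"
  by (auto simp: length_Suc_conv aug_diff)

lemma map_pow: "(map f ^^ n) l = map (f ^^ n) l" for f :: "'a \<Rightarrow> 'a"
  by (induction n) auto

text \<open>The empty list sits in degree -1 and is left out, so degree \<open>n\<close> has the
  lists of length \<open>n + 1\<close>. A list moves as soon as its head does, which reduces
  freeness to vertices.\<close>

lemma Zp_complex_lists:
  assumes "prime p"
    and del: "\<And>l k. l \<in> L \<Longrightarrow> take k l @ drop (Suc k) l \<in> L"
    and map: "\<And>l. l \<in> L \<Longrightarrow> map f l \<in> L"
    and order: "\<And>l v. l \<in> L \<Longrightarrow> v \<in> set l \<Longrightarrow> (f ^^ p) v = v"
    and free: "\<And>l v. l \<in> L \<Longrightarrow> v \<in> set l \<Longrightarrow> f v \<noteq> v"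
  shows "Zp_complex p (\<lambda>n. {l \<in> L. length l = Suc n}) (\<lambda>_. list_boundary) (\<lambda>_. map f)"
proof
  fix x n assume x: "x \<in> {l \<in> L. length l = Suc n}"
  then show "map f x \<in> {l \<in> L. length l = Suc n}" by (simp add: map)
  show "(map f ^^ p) x = x" unfolding map_pow using x order by (auto intro!: map_idI)
  show "map f x \<noteq> x" using x free by (cases x) fastforce+
next
  fix x n assume x: "x \<in> {l \<in> L. length l = Suc (Suc n)}"
  show "Poly_Mapping.keys (list_boundary x) \<subseteq> {l \<in> L. length l = Suc n}"
    using x by (auto elim!: keys_list_boundary intro: del)
  show "list_boundary (map f x) = lmap f (list_boundary x)" by (rule list_boundary_map)
qed (use assms in \<open>auto simp: ld_list_boundary aug_list_boundary\<close>)

subsection \<open>Sorting a list of vertices by a colour\<close>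

context
  fixes \<kappa> :: "'v \<Rightarrow> nat"
begin

text \<open>Sorting is the antisymmetric chain map to the lists of strictly increasing colour: exchanging
  neighbours changes the sign and repeating a colour gives zero.\<close>

primrec insl :: "'v \<Rightarrow> 'v list \<Rightarrow> ('v list \<Rightarrow>\<^sub>0 int)" where
  "insl v [] = frag_of [v]"
| "insl v (w # m) = (if \<kappa> v < \<kappa> w then frag_of (v # w # m)
     else if \<kappa> v = \<kappa> w then 0 else - consf w (insl v m))"

definition insf :: "'v \<Rightarrow> ('v list \<Rightarrow>\<^sub>0 int) \<Rightarrow> ('v list \<Rightarrow>\<^sub>0 int)" where
  "insf v = frag_extend (insl v)"

primrec asort :: "'v list \<Rightarrow> ('v list \<Rightarrow>\<^sub>0 int)" where
  "asort [] = frag_of []"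
| "asort (v # l) = insf v (asort l)"

abbreviation coloured :: "'v list \<Rightarrow> bool" where
  "coloured \<equiv> sorted_wrt (\<lambda>a b. \<kappa> a < \<kappa> b)"

lemma insf_of [simp]: "insf v (frag_of l) = insl v l"
  and insf_diff: "insf v (a - b) = insf v a - insf v b"
  and insf_0 [simp]: "insf v 0 = 0"
  and insf_minus: "insf v (- a) = - insf v a"
  and insf_cmul: "insf v (frag_cmul k a) = frag_cmul k (insf v a)"
  by (simp_all add: insf_def frag_extend_diff frag_extend_minus frag_extend_cmul)

lemma consf_minus: "consf v (- a) = - consf v a"
  by (simp add: consf_def frag_extend_minus)

lemma insf_consf: "insf v (consf w x) = (if \<kappa> v < \<kappa> w then consf v (consf w x)
     else if \<kappa> v = \<kappa> w then 0 else - consf w (insf v x))"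
  by (rule frag_additive_eq [of x UNIV]) (auto simp: consf_diff insf_diff)

lemma insl_less: "(\<And>w. w \<in> set m \<Longrightarrow> \<kappa> v < \<kappa> w) \<Longrightarrow> insl v m = frag_of (v # m)"
  by (cases m) auto

text \<open>Insertions behave like exterior multiplication; all sign rules for sorting come from
  this.\<close>

lemma insf_anticommute: "insf v (insf w x) = - insf w (insf v x)"
proof (rule frag_additive_eq [of x UNIV])
  fix l show "insf v (insf w (frag_of l)) = - insf w (insf v (frag_of l))"
  proof (induction l)
    case (Cons u l)
    then have "consf u (insf v (insl w l)) = - consf u (insf w (insl v l))"
      by (simp add: consf_minus)
    then show ?case by (auto simp: insf_minus insf_consf consf_minus)
  qed auto
qed (auto simp: insf_diff)

lemma frag_eq_minus_self: "x = - x \<Longrightarrow> x = (0 :: 'w \<Rightarrow>\<^sub>0 int)"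
  by (metis add.right_inverse add_cancel_right_left frag_cmul_distrib frag_cmul_eq_0_iff frag_cmul_one one_add_one zero_neq_numeral)

lemma keys_consf: "Poly_Mapping.keys (consf v c) \<subseteq> (#) v ` Poly_Mapping.keys c"
  unfolding consf_def using keys_frag_extend [of "\<lambda>l. frag_of (v # l)" c] by auto

lemma keys_insl:
  assumes "coloured l" "m \<in> Poly_Mapping.keys (insl v l)"
  shows "coloured m \<and> set m = insert v (set l) \<and> length m = Suc (length l)"
  using assms
proof (induction l arbitrary: m)
  case (Cons w l)
  consider "\<kappa> v < \<kappa> w" | "\<kappa> v = \<kappa> w" | "\<kappa> v > \<kappa> w" by linarith
  then show ?case
  proof cases
    case 3
    then obtain m' where "m = w # m'" "m' \<in> Poly_Mapping.keys (insl v l)"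
      using Cons.prems keys_consf [of w "insl v l"] by auto
    then show ?thesis using Cons 3 by auto
  qed (use Cons.prems in auto)
qed auto

lemma keys_asort:
  "m \<in> Poly_Mapping.keys (asort l) \<Longrightarrow> coloured m \<and> set m = set l \<and> length m = length l"
proof (induction l arbitrary: m)
  case (Cons v l)
  then obtain m' where "m' \<in> Poly_Mapping.keys (asort l)" "m \<in> Poly_Mapping.keys (insl v m')"
    using keys_frag_extend [of "insl v" "asort l"] by (auto simp: insf_def)
  then show ?case using Cons.IH [of m'] keys_insl [of m' m v] by auto
qed auto

text \<open>When \<open>v\<close> and the head \<open>w\<close> have the same colour, the insertion
  is 0, while on the right \<open>w\<close> is deleted and \<open>v\<close> put in its place. The
  two sides agree because equal colours mean equal vertices.\<close>

lemma ld_insl: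
  assumes "coloured m" "\<And>w. w \<in> set m \<Longrightarrow> \<kappa> w = \<kappa> v \<Longrightarrow> w = v"
  shows "ld (insl v m) = frag_of m - insf v (list_boundary m)"
  using assms
proof (induction m)
  case (Cons w m)
  consider "\<kappa> v < \<kappa> w" | "\<kappa> v = \<kappa> w" | "\<kappa> v > \<kappa> w" by linarith
  then show ?case
  proof cases
    case 1
    then have "insl v m = frag_of (v # m)"
      using Cons.prems by (intro insl_less) auto
    with 1 show ?thesis
      using Cons.prems by (simp add: insf_diff insf_consf consf_diff)
  next
    case 2
    then have "v = w" using Cons.prems by auto
    then show ?thesis
      using Cons.prems by (simp add: insf_diff insf_consf insl_less)
  next
    case 3
    then have IH: "ld (insl v m) = frag_of m - insf v (list_boundary m)" using Cons by auto
    from 3 show ?thesis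
      by (simp add: insf_diff insf_consf frag_extend_minus ld_consf IH consf_diff)
  qed
qed (simp add: insf_def)

text \<open>The hypothesis is what smallness of a singular simplex will provide for the subsets
  attached to its vertices.\<close>

lemma ld_asort:
  assumes "\<And>a b. a \<in> set l \<Longrightarrow> b \<in> set l \<Longrightarrow> \<kappa> a = \<kappa> b \<Longrightarrow> a = b"
  shows "ld (asort l) = frag_extend asort (list_boundary l)"
  using assms
proof (induction l)
  case (Cons v l)
  have "ld (insf v (asort l)) = asort l - insf v (ld (asort l))"
  proof (rule frag_additive_eq [of "asort l" "Poly_Mapping.keys (asort l)"])
    fix m assume "m \<in> Poly_Mapping.keys (asort l)"
    then show "ld (insf v (frag_of m)) = frag_of m - insf v (ld (frag_of m))"
      using keys_asort [of m l] Cons.prems by (auto intro: ld_insl)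
  qed (auto simp: insf_diff frag_extend_diff)
  also have "ld (asort l) = frag_extend asort (list_boundary l)" using Cons by auto
  also have "insf v (frag_extend asort (list_boundary l)) = frag_extend asort (consf v (list_boundary l))"
    by (rule frag_additive_eq [of "list_boundary l" UNIV]) (auto simp: insf_diff frag_extend_diff consf_diff)
  finally show ?case by (simp add: frag_extend_diff)
qed simp

lemma lmap_insl:
  assumes "\<And>w. \<kappa> (f w) = \<kappa> w" shows "insl (f v) (map f m) = lmap f (insl v m)"
  by (induction m) (auto simp: assms lmap_consf [unfolded o_def] frag_extend_minus)

lemma lmap_insf:
  assumes "\<And>w. \<kappa> (f w) = \<kappa> w" shows "insf (f v) (lmap f x) = lmap f (insf v x)"
  by (rule frag_additive_eq [of x UNIV]) (auto simp: insf_diff frag_extend_diff lmap_insl [OF assms, unfolded o_def])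

lemma lmap_asort:
  assumes "\<And>w. \<kappa> (f w) = \<kappa> w" shows "asort (map f l) = lmap f (asort l)"
  by (induction l) (auto simp: lmap_insf [OF assms, unfolded o_def])

lemma asort_coloured: "coloured l \<Longrightarrow> asort l = frag_of l"
  by (induction l) (auto simp: insl_less)

lemma asort_append: "asort (xs @ l) = foldr insf xs (asort l)"
  by (induction xs) auto

lemma foldr_insf_minus: "foldr insf ys (- x) = - foldr insf ys x"
  by (induction ys) (auto simp: insf_minus)

text \<open>Moving \<open>a\<close> past each entry of \<open>ys\<close> costs one sign. In a swap
  of \<open>a\<close> and \<open>b\<close> across \<open>ys\<close> these signs occur twice and
  cancel, and the exchange of \<open>a\<close> with \<open>b\<close> leaves a single sign.\<close>

lemma insf_foldr: "foldr insf ys (insf a x) = frag_cmul ((-1) ^ length ys) (insf a (foldr insf ys x))"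
proof (induction ys)
  case (Cons y ys)
  have "insf y (frag_cmul c (insf a z)) = frag_cmul (-c) (insf a (insf y z))" for c z
    using insf_anticommute [of y a z] by (simp add: insf_cmul) (metis minus_frag_cmul frag_cmul_cmul frag_cmul_minus_one mult_minus1_right)
  then show ?case by (simp add: Cons)
qed simp

lemma insf_foldr_swap:
  "insf a (foldr insf ys (insf b x)) = - insf b (foldr insf ys (insf a x))"
  unfolding insf_foldr insf_cmul using insf_anticommute [of a b "foldr insf ys x"]
  by (metis frag_cmul_cmul frag_cmul_minus_one minus_frag_cmul mult.commute)

lemma asort_swap: "asort (xs @ a # ys @ b # zs) = - asort (xs @ b # ys @ a # zs)"
  by (simp add: asort_append insf_foldr_swap [of a ys b] foldr_insf_minus)

lemma asort_repeat: "\<not> distinct l \<Longrightarrow> asort l = 0"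
proof -
  assume "\<not> distinct l"
  then obtain xs ys zs a where "l = xs @ [a] @ ys @ [a] @ zs" using not_distinct_decomp by blast
  then show ?thesis using asort_swap [of xs a ys a zs] frag_eq_minus_self [of "asort l"] by simp
qed

lemma asort_transpose:
  assumes "distinct l" "a \<in> set l" "b \<in> set l" "a \<noteq> b"
  shows "asort (map (Transposition.transpose a b) l) = - asort l"
proof -
  have *: "asort (map (Transposition.transpose a b) l) = - asort l"
    if l: "l = xs @ a # l'" "b \<in> set l'" "distinct l" and ab: "a \<noteq> b" for a b xs l'
  proof -
    obtain ys zs where "l' = ys @ b # zs" using l(2) by (meson split_list)
    then have l': "l = xs @ a # ys @ b # zs" using l by simp
    have m: "map (Transposition.transpose a b) xs = xs" "map (Transposition.transpose a b) ys = ys" "map (Transposition.transpose a b) zs = zs"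
      using l(3) unfolding l' by (auto intro!: map_idI transpose_apply_other)
    show ?thesis unfolding l' using m asort_swap [of xs b ys a zs] by simp
  qed
  obtain xs l' where l: "l = xs @ a # l'" using assms(2) by (meson split_list)
  show ?thesis
  proof (cases "b \<in> set l'")
    case True then show ?thesis using * l assms by blast
  next
    case False
    then have "b \<in> set xs" using l assms by auto
    then obtain us vs where "xs = us @ b # vs" by (meson split_list)
    then have "l = us @ b # (vs @ a # l')" using l by simp
    then show ?thesis using * [of us b "vs @ a # l'" a] assms by (simp add: transpose_commute)
  qed
qed

end

subsection \<open>The fundamental cycle of the chessboard complex\<close>

lemma permutes_list: "\<pi> permutes {1..p} \<Longrightarrow> distinct (map \<pi> [1..<Suc p]) \<and> set (map \<pi> [1..<Suc p]) = {1..p}"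
  using permutes_inj_on [of \<pi> "{1..p}" "{1..p}"] permutes_image [of \<pi> "{1..p}"]
  by (auto simp: distinct_map atLeastLessThanSuc_atLeastAtMost simp del: upt_Suc)

lemma asort_permutation:
  fixes p :: nat
  assumes "\<pi> permutes {1..p}"
  shows "asort (\<lambda>x::nat. x) (map \<pi> [1..<Suc p]) = frag_cmul (sign \<pi>) (frag_of [1..<Suc p])"
  using assms finite_atLeastAtMost [of 1 p]
proof (induction \<pi> rule: permutes_induct)
  case id
  have "sorted_wrt (<) [1..<Suc p]" by (rule sorted_wrt_upt)
  then show ?case by (simp add: asort_coloured del: upt_Suc)
next
  case (swap a b q)
  let ?l = "map q [1..<Suc p]"
  have q: "q permutes {1..p}" using swap by simp
  have "asort (\<lambda>x. x) (map (Transposition.transpose a b \<circ> q) [1..<Suc p]) = asort (\<lambda>x. x) (map (Transposition.transpose a b) ?l)"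
    by (simp only: map_map)
  also have "asort (\<lambda>x. x) (map (Transposition.transpose a b) ?l) = - asort (\<lambda>x. x) ?l"
    by (rule asort_transpose) (use permutes_list [OF q] swap in auto)
  also have "asort (\<lambda>x. x) ?l = frag_cmul (sign q) (frag_of [1..<Suc p])" using swap by simp
  moreover have "sign (Transposition.transpose a b \<circ> q) = - sign q"
    using swap by (simp add: sign_compose sign_swap_id permutation_swap_id permutes_imp_permutation [OF _ q])
  ultimately show ?case by (simp only: minus_frag_cmul)
qed

text \<open>Each ordering of \<open>{1..p}\<close> counts with its sign and lists with repetitions
  count 0, as in a determinant: this is the coefficient of the oriented top simplex.\<close>

definition top_coeff :: "nat \<Rightarrow> (nat list \<Rightarrow>\<^sub>0 int) \<Rightarrow> int" where
  "top_coeff p c = Poly_Mapping.lookup (frag_extend (asort (\<lambda>x. x)) c) [1..<Suc p]"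

lemma top_coeff_diff: "top_coeff p (a - b) = top_coeff p a - top_coeff p b"
  and top_coeff_add: "top_coeff p (a + b) = top_coeff p a + top_coeff p b"
  and top_coeff_cmul: "top_coeff p (frag_cmul k a) = k * top_coeff p a"
  and top_coeff_0 [simp]: "top_coeff p 0 = 0"
  by (simp_all add: top_coeff_def frag_extend_diff frag_extend_add frag_extend_cmul lookup_minus lookup_add)

lemma top_coeff_sum: "top_coeff p (sum f I) = (\<Sum>i\<in>I. top_coeff p (f i))"
  by (induction I rule: infinite_finite_induct) (auto simp: top_coeff_add)

lemma top_coeff_permutation:
  "\<pi> permutes {1..p} \<Longrightarrow> top_coeff p (frag_of (map \<pi> [1..<Suc p])) = sign \<pi>"
  unfolding top_coeff_def frag_extend_of asort_permutation by simp

lemma sign_of_odd_order: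
  assumes "c permutes S" "finite S" "c ^^ p = id" "odd p" shows "sign c = 1"
proof -
  have perm: "permutation c" using assms permutes_imp_permutation by blast
  have "permutation (c ^^ n) \<and> sign (c ^^ n) = sign c ^ n" for n
  proof (induction n)
    case (Suc n)
    then show ?case
      unfolding funpow.simps(2) power_Suc using sign_compose [OF perm] permutation_compose [OF perm] by metis
  qed simp
  then have "sign c ^ p = 1" using assms by (metis sign_id)
  then show ?thesis using assms by (cases c rule: sign_cases) auto
qed

text \<open>A permutation of odd order is even, so it preserves the orientation of the top simplex;
  repetitions in \<open>l\<close> are carried along.\<close>

lemma top_coeff_rotate:
  assumes c: "c permutes {1..p}" "c ^^ p = id" "odd p" and l: "length l = p" "set l \<subseteq> {1..p}"
  shows "top_coeff p (frag_of (map c l)) = top_coeff p (frag_of l)"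
proof (cases "distinct l")
  case True
  have set: "set l = {1..p}"
    using True l by (intro card_subset_eq) (auto simp: distinct_card)
  \<comment> \<open>Lists are indexed from 0 and permutations act on \<open>{1..p}\<close>, hence
    the shift by one.\<close>
  define q where "q i = (if i \<in> {1..p} then l ! (i - 1) else i)" for i
  have lq: "l = map q [1..<Suc p]"
    using l(1) by (intro nth_equalityI) (auto simp: q_def simp del: upt_Suc)
  have q: "q permutes {1..p}"
  proof (rule bij_imp_permutes)
    have im: "q ` {1..p} = {1..p}"
      using set arg_cong [OF lq, of set] by (simp add: atLeastLessThanSuc_atLeastAtMost del: upt_Suc)
    then show "bij_betw q {1..p} {1..p}"
      by (simp add: bij_betw_def eq_card_imp_inj_on)
  qed (auto simp: q_def)
  have cq: "c \<circ> q permutes {1..p}" using q c permutes_compose by blast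
  have "sign (c \<circ> q) = sign q"
    using q c sign_of_odd_order [OF c(1) _ c(2,3)] by (simp add: sign_compose permutes_imp_permutation [of "{1..p}"])
  then show ?thesis
    using top_coeff_permutation [OF q] top_coeff_permutation [OF cq] lq by (metis map_map)
next
  case False
  then have "\<not> distinct (map c l)" by (simp add: distinct_map)
  then show ?thesis using False by (simp add: top_coeff_def asort_repeat)
qed

text \<open>\<open>1 # l\<close> has \<open>p + 1\<close> entries from \<open>{1..p}\<close>, so it
  repeats one and sorts to 0; sorting being a chain map, its boundary \<open>l - 1 * d l\<close> has
  top coefficient 0. Coning with apex 1 thus recovers the top coefficient of a chain from its
  boundary.\<close>

lemma top_coeff_boundary:
  assumes "length l = p" "set l \<subseteq> {1..p}" "p > 0"
  shows "top_coeff p (consf 1 (list_boundary l)) = top_coeff p (frag_of l)"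
proof -
  have "asort (\<lambda>x. x) (1 # l) = 0"
  proof (rule asort_repeat, rule notI)
    assume "distinct (1 # l)"
    then have "card (set (1 # l)) = Suc p" using assms distinct_card by fastforce
    moreover have "card (set (1 # l)) \<le> card {1..p}"
      using assms by (intro card_mono) auto
    ultimately show False by simp
  qed
  then have "frag_extend (asort (\<lambda>x. x)) (list_boundary (1 # l)) = 0"
    using ld_asort [of "1 # l" "\<lambda>x. x"] by simp
  then have "top_coeff p (list_boundary (1 # l)) = 0" by (simp only: top_coeff_def lookup_zero)
  then show ?thesis by (simp add: top_coeff_diff)
qed

text \<open>A facet places \<open>p - 1\<close> rooks and leaves one column free. It is encoded by a
  full permutation with the free column as \<open>\<pi> 1\<close>, so that the sign of \<pi> orients
  the facet.\<close>

definition chess_list :: "nat \<Rightarrow> (nat \<Rightarrow> nat) \<Rightarrow> (nat \<times> nat) list" where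
  "chess_list p \<pi> = map (\<lambda>i. (i, \<pi> (Suc i))) [1..<p]"

definition chess_cycle :: "nat \<Rightarrow> ((nat \<times> nat) list \<Rightarrow>\<^sub>0 int)" where
  "chess_cycle p = (\<Sum>\<pi> | \<pi> permutes {1..p}. frag_cmul (sign \<pi>) (frag_of (chess_list p \<pi>)))"

abbreviation chess_lists :: "nat \<Rightarrow> (nat \<times> nat) list set" where
  "chess_lists p \<equiv> {l. set l \<in> chessboard_complex (p - 1) p}"

lemma chess_list_in:
  assumes "\<pi> permutes {1..p}" shows "chess_list p \<pi> \<in> chess_lists p"
proof -
  have "inj \<pi>" using assms permutes_inj by blast
  moreover have "\<pi> (Suc i) \<in> {1..p}" if "i < p" for i
    using permutes_in_image [OF assms, of "Suc i"] that by simp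
  moreover have "set (chess_list p \<pi>) = (\<lambda>i. (i, \<pi> (Suc i))) ` {1..<p}" by (simp add: chess_list_def)
  ultimately show ?thesis
    unfolding chessboard_complex_def inj_on_def by (auto simp: inj_eq)
qed

text \<open>A removed rook leaves two free columns, so each ridge lies in exactly two facets. They
  differ by a transposition and therefore carry opposite signs.\<close>

lemma chess_cycle_boundary: "ld (chess_cycle p) = 0"
proof -
  let ?P = "{\<pi>. \<pi> permutes {1..p}}"
  have fin: "finite ?P" by (simp add: finite_permutations)
  let ?del = "\<lambda>k \<pi>. frag_of (take k (chess_list p \<pi>) @ drop (Suc k) (chess_list p \<pi>))"
  have zero: "(\<Sum>\<pi>\<in>?P. frag_cmul (sign \<pi>) (?del k \<pi>)) = 0" if k: "k < p - 1" for k
  proof -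
    \<comment> \<open>Entry \<open>k\<close>, counted from 0, is the rook in row
      \<open>k + 1\<close>, whose column is \<open>\<pi> (k + 2)\<close>; it is exchanged with the
      free column \<open>\<pi> 1\<close>.\<close>
    define t where "t = Transposition.transpose 1 (k + 2)"
    have t: "t permutes {1..p}" unfolding t_def using k by (intro permutes_swap_id) auto
    have nth: "chess_list p (\<pi> \<circ> t) ! i = chess_list p \<pi> ! i" if "i < p - 1" "i \<noteq> k" for i \<pi>
      using that by (simp add: chess_list_def t_def transpose_apply_other)
    have len: "length (chess_list p \<pi>) = p - 1" for \<pi> by (simp add: chess_list_def)
    have "take k (chess_list p (\<pi> \<circ> t)) = take k (chess_list p \<pi>)"
      "drop (Suc k) (chess_list p (\<pi> \<circ> t)) = drop (Suc k) (chess_list p \<pi>)" for \<pi>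
      using k by (auto intro!: nth_equalityI simp: len nth)
    then have del: "?del k (\<pi> \<circ> t) = ?del k \<pi>" for \<pi> by simp
    have sign: "sign (\<pi> \<circ> t) = - sign \<pi>" if "\<pi> permutes {1..p}" for \<pi>
      using that by (simp add: t_def sign_compose sign_swap_id permutation_swap_id permutes_imp_permutation [of "{1..p}"])
    have "(\<Sum>\<pi>\<in>?P. frag_cmul (sign \<pi>) (?del k \<pi>)) = (\<Sum>\<pi>\<in>?P. frag_cmul (sign (\<pi> \<circ> t)) (?del k (\<pi> \<circ> t)))"
      by (rule sum_permutations_compose_right [OF t])
    also have "\<dots> = - (\<Sum>\<pi>\<in>?P. frag_cmul (sign \<pi>) (?del k \<pi>))"
      unfolding sum_negf [symmetric] del by (intro sum.cong) (auto simp: sign)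
    finally show ?thesis by (rule frag_eq_minus_self)
  qed
  have "ld (chess_cycle p) = (\<Sum>\<pi>\<in>?P. \<Sum>k<p - 1. frag_cmul ((-1) ^ k) (frag_cmul (sign \<pi>) (?del k \<pi>)))"
    unfolding chess_cycle_def frag_extend_sum [OF fin]
    by (intro sum.cong) (auto simp: frag_extend_cmul list_boundary_sum frag_cmul_sum chess_list_def mult.commute)
  also have "\<dots> = (\<Sum>k<p - 1. frag_cmul ((-1) ^ k) (\<Sum>\<pi>\<in>?P. frag_cmul (sign \<pi>) (?del k \<pi>)))"
    by (subst sum.swap) (simp add: frag_cmul_sum)
  also have "\<dots> = 0" by (intro sum.neutral ballI) (simp only: zero lessThan_iff frag_cmul_zero2)
  finally show ?thesis .
qed

text \<open>Moving the columns by \<open>c\<close> reindexes the sum by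
  \<open>\<pi> \<mapsto> c \<circ> \<pi>\<close>, which keeps the signs because \<open>c\<close> has
  odd order.\<close>

lemma chess_cycle_invariant:
  assumes c: "c permutes {1..p}" "c ^^ p = id" "odd p"
  shows "lmap (map_prod id c) (chess_cycle p) = chess_cycle p"
proof -
  let ?P = "{\<pi>. \<pi> permutes {1..p}}"
  have fin: "finite ?P" by (simp add: finite_permutations)
  have sign: "sign (c \<circ> \<pi>) = sign \<pi>" if "\<pi> permutes {1..p}" for \<pi>
    using that c sign_of_odd_order [OF c(1) _ c(2,3)] by (simp add: sign_compose permutes_imp_permutation [of "{1..p}"])
  have "lmap (map_prod id c) (chess_cycle p) = (\<Sum>\<pi>\<in>?P. frag_cmul (sign \<pi>) (frag_of (chess_list p (c \<circ> \<pi>))))"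
    unfolding chess_cycle_def frag_extend_sum [OF fin]
    by (intro sum.cong) (auto simp: frag_extend_cmul chess_list_def o_def)
  also have "\<dots> = (\<Sum>\<pi>\<in>?P. frag_cmul (sign (c \<circ> \<pi>)) (frag_of (chess_list p (c \<circ> \<pi>))))"
    by (intro sum.cong) (auto simp: sign)
  also have "\<dots> = chess_cycle p"
    unfolding chess_cycle_def by (rule setum_permutations_compose_left [OF c(1), symmetric])
  finally show ?thesis .
qed

text \<open>This is the degree of the map of the chessboard complex to the boundary of a simplex.\<close>

lemma top_coeff_chess_cycle:
  assumes "p \<ge> 1"
  shows "top_coeff p (consf 1 (lmap snd (chess_cycle p))) = fact (p - 1)"
proof -
  let ?P = "{\<pi>. \<pi> permutes {1..p}}"
  have fin: "finite ?P" by (simp add: finite_permutations)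
  \<comment> \<open>The apex 1 repeats an entry unless column 1 is the free one; in that case the
    list is the whole permutation. The sign then meets the sign in the cycle and each such facet
    contributes 1.\<close>
  have tc: "top_coeff p (frag_of (1 # map (\<lambda>i. \<pi> (Suc i)) [1..<p])) = (if \<pi> 1 = 1 then sign \<pi> else 0)"
    if \<pi>: "\<pi> permutes {1..p}" for \<pi>
  proof -
    have l: "map \<pi> [1..<Suc p] = \<pi> 1 # map (\<lambda>i. \<pi> (Suc i)) [1..<p]"
      using assms by (simp add: upt_conv_Cons map_Suc_upt [symmetric] o_def del: upt_Suc)
    show ?thesis
    proof (cases "\<pi> 1 = 1")
      case True then show ?thesis using top_coeff_permutation [OF \<pi>] l by simp
    next
      case False
      have "1 \<in> set (\<pi> 1 # map (\<lambda>i. \<pi> (Suc i)) [1..<p])"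
        using permutes_list [OF \<pi>] assms l by (metis atLeastAtMost_iff order_refl)
      then have "1 \<in> set (map (\<lambda>i. \<pi> (Suc i)) [1..<p])" using False by auto
      then have "\<not> distinct (1 # map (\<lambda>i. \<pi> (Suc i)) [1..<p])" by simp
      then have "asort (\<lambda>x. x) (1 # map (\<lambda>i. \<pi> (Suc i)) [1..<p]) = 0" by (rule asort_repeat)
      then show ?thesis using False by (simp only: top_coeff_def frag_extend_of lookup_zero if_False)
    qed
  qed
  have "top_coeff p (consf 1 (lmap snd (chess_cycle p)))
      = (\<Sum>\<pi>\<in>?P. sign \<pi> * top_coeff p (frag_of (1 # map (\<lambda>i. \<pi> (Suc i)) [1..<p])))"
    unfolding chess_cycle_def frag_extend_sum [OF fin] consf_sum [OF fin] top_coeff_sum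
    by (intro sum.cong) (auto simp: frag_extend_cmul consf_cmul top_coeff_cmul chess_list_def o_def)
  also have "\<dots> = (\<Sum>\<pi>\<in>?P. if \<pi> 1 = 1 then 1 else 0)"
  proof (rule sum.cong [OF refl])
    fix \<pi> assume "\<pi> \<in> ?P"
    then have "\<pi> permutes {1..p}" by simp
    then show "sign \<pi> * top_coeff p (frag_of (1 # map (\<lambda>i. \<pi> (Suc i)) [1..<p])) = (if \<pi> 1 = 1 then 1 else 0)"
      by (simp only: tc) simp
  qed
  also have "\<dots> = int (card {\<pi> \<in> ?P. \<pi> 1 = 1})"
    using fin by (simp add: sum.If_cases Int_def)
  also have "{\<pi> \<in> ?P. \<pi> 1 = 1} = {\<pi>. \<pi> permutes {2..p}}"
  proof -
    have "\<pi> permutes {2..p}" if "\<pi> permutes {1..p}" "\<pi> 1 = 1" for \<pi>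
    proof (rule permutes_superset [OF that(1)])
      fix x assume "x \<in> {1..p} - {2..p}"
      then have "x = 1" by auto
      with that show "\<pi> x = x" by simp
    qed
    moreover have "\<pi> permutes {1..p}" "\<pi> 1 = 1" if "\<pi> permutes {2..p}" for \<pi>
      using that permutes_subset [OF that, of "{1..p}"] permutes_not_in [OF that, of 1] by auto
    ultimately show ?thesis by blast
  qed
  also have "card \<dots> = fact (p - 1)" by (simp add: card_permutations)
  finally show ?thesis by (simp only: of_nat_fact)
qed

section \<open>The chessboard complex over the group ring and the nonzero value on its fundamental
  cycle\<close>

lemma chessboard_complex_subset: "S \<in> chessboard_complex m n \<Longrightarrow> R \<subseteq> S \<Longrightarrow> R \<in> chessboard_complex m n"
  unfolding chessboard_complex_def using inj_on_subset by blast

lemma chessboard_complex_image: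
  assumes S: "S \<in> chessboard_complex m n" and c: "c permutes {1..n}"
  shows "map_prod id c ` S \<in> chessboard_complex m n"
proof -
  have inj: "c j = c j' \<longleftrightarrow> j = j'" for j j' using c permutes_inj inj_eq by metis
  have mem: "c j \<in> {1..n} \<longleftrightarrow> j \<in> {1..n}" for j by (rule permutes_in_image [OF c])
  show ?thesis
    unfolding chessboard_complex_def mem_Collect_eq
  proof (intro conjI inj_onI subsetI)
    fix x assume "x \<in> map_prod id c ` S"
    then obtain i j where "(i, j) \<in> S" "x = (i, c j)" by auto
    then show "x \<in> {1..m} \<times> {1..n}" using S mem [of j] by (auto simp: chessboard_complex_def)
  next
    fix x y assume "x \<in> map_prod id c ` S" "y \<in> map_prod id c ` S" and eq: "fst x = fst y"
    then obtain i j i' j' where *: "(i, j) \<in> S" "x = (i, c j)" "(i', j') \<in> S" "y = (i', c j')" by auto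
    have "inj_on fst S" using S by (simp add: chessboard_complex_def)
    from inj_onD [OF this _ *(1,3)] show "x = y" using eq * by simp
  next
    fix x y assume "x \<in> map_prod id c ` S" "y \<in> map_prod id c ` S" and eq: "snd x = snd y"
    then obtain i j i' j' where *: "(i, j) \<in> S" "x = (i, c j)" "(i', j') \<in> S" "y = (i', c j')" by auto
    have "inj_on snd S" using S by (simp add: chessboard_complex_def)
    from inj_onD [OF this _ *(1,3)] show "x = y" using eq * inj by simp
  qed
qed

context
  fixes p :: nat and c :: "nat \<Rightarrow> nat"
  assumes p: "prime p" "odd p"
    and c: "c permutes {1..p}" "c ^^ p = id" "\<And>j. j \<in> {1..p} \<Longrightarrow> c j \<noteq> j"
begin

lemma set_del: "set (take k l @ drop (Suc k) l) \<subseteq> set l"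
  using set_take_subset [of k l] set_drop_subset [of "Suc k" l] by auto

lemma Zp_complex_chess:
  "Zp_complex p (\<lambda>n. {l \<in> chess_lists p. length l = Suc n}) (\<lambda>_. list_boundary) (\<lambda>_. map (map_prod id c))"
proof (rule Zp_complex_lists [OF p(1)])
  fix l k assume l: "l \<in> chess_lists p"
  show "take k l @ drop (Suc k) l \<in> chess_lists p"
    using l chessboard_complex_subset [OF _ set_del] by (simp only: mem_Collect_eq)
  show "map (map_prod id c) l \<in> chess_lists p"
    using l chessboard_complex_image [OF _ c(1)] by simp
  have pow: "(map_prod id c ^^ n) w = (fst w, (c ^^ n) (snd w))" for n :: nat and w :: "nat \<times> nat"
    by (induction n) auto
  fix v assume v: "v \<in> set l"
  show "(map_prod id c ^^ p) v = v" unfolding pow c by simp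
  have "snd v \<in> {1..p}" using l v unfolding chessboard_complex_def by auto
  then show "map_prod id c v \<noteq> v" using c(3) [of "snd v"] by (metis snd_map_prod)
qed

text \<open>All lists in \<open>{1..p}\<close>, repetitions included: an acyclic target for the
  projection of the rooks to their columns.\<close>

lemma Zp_complex_full:
  "Zp_complex p (\<lambda>n. {l \<in> {l. set l \<subseteq> {1..p}}. length l = Suc n}) (\<lambda>_. list_boundary) (\<lambda>_. map c)"
proof (rule Zp_complex_lists [OF p(1)])
  fix l k v assume l: "l \<in> {l. set l \<subseteq> {1..p}}"
  then show "take k l @ drop (Suc k) l \<in> {l. set l \<subseteq> {1..p}}"
    unfolding mem_Collect_eq by (rule subset_trans [OF set_del])
  show "map c l \<in> {l. set l \<subseteq> {1..p}}"
    using l permutes_image [OF c(1)] by auto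
  show "(c ^^ p) v = v" using c(2) by simp
  assume "v \<in> set l" then show "c v \<noteq> v" using l c(3) [of v] by blast
qed

text \<open>By exactness the invariant cycle is congruent to the norm of some \<open>y\<close>. The
  norm of \<open>d y\<close> is congruent to 0, so \<open>y\<close> starts a tower. A value 0 would,
  by acyclicity of the full simplex, turn the image of the cycle into the boundary of the norm of
  \<open>x'\<close>; its degree \<open>(p - 1)!\<close> would then be \<open>p\<close> times that of
  \<open>x'\<close> modulo \<open>p\<close>.\<close>

lemma chess_tower:
  shows "\<exists>y l. Zp_complex.tower p (\<lambda>n. {l \<in> chess_lists p. length l = Suc n}) (\<lambda>_. list_boundary)
      (\<lambda>_. map (map_prod id c)) (p - 2) True y l \<and> \<not> [l = 0] (mod int p)"
proof -
  let ?B = "\<lambda>n. {l \<in> chess_lists p. length l = Suc n}"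
  let ?F = "\<lambda>n. {l \<in> {l. set l \<subseteq> {1..p}}. length l = Suc n}"
  interpret chess: Zp_complex p ?B "\<lambda>_. list_boundary" "\<lambda>_. map (map_prod id c)"
    by (rule Zp_complex_chess)
  interpret full: Zp_complex p ?F "\<lambda>_. list_boundary" "\<lambda>_. map c"
    by (rule Zp_complex_full)
  interpret proj: Zp_map p ?B "\<lambda>_. list_boundary" "\<lambda>_. map (map_prod id c)" ?F "\<lambda>_. list_boundary" "\<lambda>_. map c"
    "\<lambda>_. frag_of \<circ> map snd"
  proof
    fix x n assume "x \<in> ?B n"
    then show "Poly_Mapping.keys ((frag_of \<circ> map snd) x) \<subseteq> ?F n"
      by (auto simp: chessboard_complex_def)
  qed (auto simp: list_boundary_map [unfolded o_def] o_def)
  have "p \<noteq> 2" "p \<ge> 2" using p prime_ge_2_nat by auto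
  then have p3: "p \<ge> 3" by simp
  define n where "n = p - 2"
  have n: "p = Suc (Suc n)" using p3 by (simp add: n_def)
  have len: "length (chess_list p \<pi>) = Suc n" for \<pi> using p3 by (simp add: chess_list_def n_def)
  have z_in: "chess_cycle p \<in> chess.chains n"
    unfolding chess_cycle_def
  proof (rule CollectI, rule keys_sum_subset, rule keys_cmul_subset)
    fix \<pi> assume "\<pi> \<in> {\<pi>. \<pi> permutes {1..p}}"
    then show "Poly_Mapping.keys (frag_of (chess_list p \<pi>)) \<subseteq> ?B n"
      using chess_list_in [of \<pi> p] len unfolding keys_frag_of by blast
  qed
  have "chess.T True n (chess_cycle p) = 0"
    unfolding chess.T_def chess.S_def using chess_cycle_invariant [OF c(1,2) p(2)] by simp
  then obtain y where y: "y \<in> chess.chains n" "fcong p (chess_cycle p) (chess.T False n y)"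
    using chess.exact [OF z_in, of False] by auto
  have "\<exists>l. chess.tower n True y l"
  proof (rule chess.tower_exists [OF y(1)])
    fix m assume m: "n = Suc m"
    have "chess.T False m (chess.d n y) = chess.d n (chess.T False n y)" using y(1) m chess.d_T by simp
    moreover have "fcong p (chess.d n (chess_cycle p)) (chess.d n (chess.T False n y))"
      using chess.fcong_d y(2) .
    moreover have "chess.d n (chess_cycle p) = 0" by (simp add: chess.d_def chess_cycle_boundary)
    ultimately show "fcong p (chess.T (\<not> True) m (chess.d n y)) 0" by (simp add: fcong_sym)
  qed
  then obtain l where l: "chess.tower n True y l" ..
  have "\<not> [l = 0] (mod int p)"
  proof
    assume l0: "[l = 0] (mod int p)"
    let ?y = "lmap snd y"
    have acyclic: "\<exists>x\<in>full.chains (Suc k). fcong p w (full.d (Suc k) x)"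
      if w: "w \<in> full.chains k" "k \<noteq> 0 \<Longrightarrow> fcong p (full.d k w) 0" "k = 0 \<Longrightarrow> [aug w = 0] (mod int p)" for k w
    \<comment> \<open>The full simplex is contracted by the cone with apex 1.\<close>
    proof (rule bexI [of _ "consf 1 w"])
      have mem: "set m \<subseteq> {1..p} \<and> length m = Suc k" if "m \<in> Poly_Mapping.keys w" for m
        using w(1) that by auto
      show "consf 1 w \<in> full.chains (Suc k)"
        using keys_consf [of 1 w] mem p3 by fastforce
      have "fcong p (consf 1 (ld w)) 0"
      proof (cases "k = 0")
        case True
        \<comment> \<open>The augmented boundary of a 0-chain is its augmentation times the empty
          list, which is where the hypothesis on \<open>aug w\<close> enters.\<close>
        have "frag_extend list_boundary w = frag_cmul (aug w) (frag_of [])"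
          by (rule frag_additive_eq [of w "{m. length m = Suc 0}"])
            (use mem True in \<open>auto simp: frag_extend_diff aug_diff frag_cmul_diff_distrib length_Suc_conv\<close>)
        moreover obtain q where "aug w = int p * q" using w(3) True by (auto simp: cong_0_iff)
        ultimately have "consf 1 (ld w) = frag_cmul (int p) (frag_cmul q (frag_of [1]))" by (simp add: consf_cmul)
        then show ?thesis by (metis fcong_multiple)
      next
        case False
        then show ?thesis using fcong_extend [OF w(2), of "\<lambda>l. frag_of (1 # l)"]
          by (simp add: consf_def full.d_def)
      qed
      then have "fcong p (w - consf 1 (ld w)) (w - 0)" by (intro fcong_diff fcong_refl)
      then show "fcong p w (full.d (Suc k) (consf 1 w))"
        by (simp add: full.d_def ld_consf fcong_sym)
    qed
    have "full.tower n True ?y l" using proj.h_tower [OF l] .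
    then obtain x x' where x: "x \<in> full.chains n" "x' \<in> full.chains (Suc n)"
      "fcong p ?y (full.d (Suc n) x' + full.T True n x)"
      using full.tower_acyclic [OF acyclic, of n n True ?y l] l0 by auto
    have "fcong p (lmap snd (chess_cycle p)) (lmap snd (chess.T False n y))"
      using fcong_extend [OF y(2)] .
    also have "lmap snd (chess.T False n y) = full.T False n ?y" using proj.h_T [OF y(1)] by simp
    also have "fcong p \<dots> (full.T False n (full.d (Suc n) x' + full.T True n x))" using full.fcong_T x(3) .
    \<comment> \<open>The norm kills the term in \<open>S - 1\<close> and commutes with the
      boundary.\<close>
    also have "full.T False n (full.d (Suc n) x' + full.T True n x) = full.d (Suc n) (full.T False (Suc n) x')"
      using full.T_T [OF x(1), of False] full.d_T [OF x(2)] by (simp add: full.T_add)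
    finally have cong: "fcong p (lmap snd (chess_cycle p)) (full.d (Suc n) (full.T False (Suc n) x'))" .
    have "[top_coeff p (consf 1 (lmap snd (chess_cycle p))) = top_coeff p (consf 1 (full.d (Suc n) (full.T False (Suc n) x')))] (mod int p)"
      using cong unfolding fcong_def cong_iff_dvd_diff
      by (metis consf_cmul consf_diff dvd_triv_left top_coeff_cmul top_coeff_diff)
    moreover have bnd: "top_coeff p (consf 1 (full.d (Suc n) w)) = top_coeff p w" if "w \<in> full.chains (Suc n)" for w
    proof (rule frag_additive_eq [of w "?F (Suc n)"])
      show "Poly_Mapping.keys w \<subseteq> ?F (Suc n)" using that by (rule CollectD)
      fix l assume "l \<in> ?F (Suc n)"
      then have "length l = p" "set l \<subseteq> {1..p}" "p > 0" using n by auto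
      then show "top_coeff p (consf 1 (full.d (Suc n) (frag_of l))) = top_coeff p (frag_of l)"
        unfolding full.d_def frag_extend_of by (rule top_coeff_boundary)
    qed (auto simp: full.d_def frag_extend_diff consf_diff top_coeff_diff)
    have "top_coeff p (consf 1 (full.d (Suc n) (full.T False (Suc n) x'))) = top_coeff p (full.T False (Suc n) x')"
      by (rule bnd [OF full.T_chains [OF x(2)]])
    moreover have "top_coeff p (full.T False (Suc n) x') = int p * top_coeff p x'"
    proof -
      \<comment> \<open>The \<open>p\<close> rotates of \<open>x'\<close> all have the same top
        coefficient, so the norm multiplies it by \<open>p\<close>.\<close>
      have S: "top_coeff p (full.S (Suc n) w) = top_coeff p w" if "w \<in> full.chains (Suc n)" for w
      proof (rule frag_additive_eq [of w "?F (Suc n)"])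
        show "Poly_Mapping.keys w \<subseteq> ?F (Suc n)" using that by (rule CollectD)
        fix l assume "l \<in> ?F (Suc n)"
        then have "length l = p" "set l \<subseteq> {1..p}" using n by auto
        then show "top_coeff p (full.S (Suc n) (frag_of l)) = top_coeff p (frag_of l)"
          unfolding full.S_of by (rule top_coeff_rotate [OF c(1,2) p(2)])
      qed (auto simp: full.S_diff top_coeff_diff)
      have "top_coeff p ((full.S (Suc n) ^^ i) x') = top_coeff p x'" for i
      proof (induction i)
        case (Suc i)
        then show ?case using S [OF full.S_pow_chains [OF x(2)]] by simp
      qed simp
      then show ?thesis by (simp add: full.T_def top_coeff_sum)
    qed
    ultimately have "[fact (p - 1) = int p * top_coeff p x'] (mod int p)"
      using top_coeff_chess_cycle [of p] p3 by simp
    then have "int p dvd int (fact (p - 1))"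
      by (metis cong_def dvd_eq_mod_eq_0 mod_mult_self1_is_0 of_nat_fact)
    then have "p dvd fact (p - 1)" by (simp only: of_nat_dvd_iff)
    then show False using p prime_dvd_fact_iff [of p "p - 1"] p3 by simp
  qed
  then show ?thesis using l n by auto
qed

end

section \<open>Cohomology with coefficients modulo p\<close>

subsection \<open>Extension of homomorphisms modulo p\<close>

lemma additive_cmul:
  fixes F :: "('x \<Rightarrow>\<^sub>0 int) \<Rightarrow> ('y \<Rightarrow>\<^sub>0 int)"
  assumes diff: "\<And>a b. F (a - b) = F a - F b"
  shows "F (frag_cmul k c) = frag_cmul k (F c)"
proof -
  have 0: "F 0 = 0" using diff [of 0 0] by simp
  have add: "F (a + b) = F a + F b" for a b
    using diff [of a "- b"] diff [of 0 b] 0 by simp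
  have nat: "F (frag_cmul (int n) c) = frag_cmul (int n) (F c)" for n
    by (induction n) (auto simp: 0 add frag_cmul_distrib)
  show ?thesis
  proof (cases k)
    case (nonneg n) then show ?thesis using nat by simp
  next
    case (neg n)
    then have "frag_cmul k c = 0 - frag_cmul (int (Suc n)) c" "frag_cmul k (F c) = 0 - frag_cmul (int (Suc n)) (F c)" by simp_all
    then show ?thesis using nat [of "Suc n"] diff 0 by metis
  qed
qed

text \<open>A linear functional on a subspace extends to the whole space over the field with
  \<open>p\<close> elements. The partial functional is given by its graph, and \<open>mult\<close>
  makes it compatible with reduction modulo \<open>p\<close>.\<close>

lemma mod_extension:
  fixes \<Gamma> :: "(('x \<Rightarrow>\<^sub>0 int) \<times> int) set"
  assumes p: "prime p"
    and diff: "\<And>x y x' y'. (x, y) \<in> \<Gamma> \<Longrightarrow> (x', y') \<in> \<Gamma> \<Longrightarrow> (x - x', y - y') \<in> \<Gamma>"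
    and mult: "\<And>w k. (frag_cmul (int p) w, int p * k) \<in> \<Gamma>"
    and zero: "\<And>y. (0, y) \<in> \<Gamma> \<Longrightarrow> int p dvd y"
  obtains \<psi> :: "('x \<Rightarrow>\<^sub>0 int) \<Rightarrow> int" where "\<And>x y. [\<psi> (x + y) = \<psi> x + \<psi> y] (mod int p)"
    "\<And>x y. (x, y) \<in> \<Gamma> \<Longrightarrow> [\<psi> x = y] (mod int p)"
proof -
  \<comment> \<open>For a graph closed under differences, being single valued modulo
    \<open>p\<close> amounts to having only multiples of \<open>p\<close> above 0.\<close>
  define \<G> where "\<G> = {\<Delta>. \<Gamma> \<subseteq> \<Delta> \<and> (\<forall>x y x' y'. (x, y) \<in> \<Delta> \<longrightarrow> (x', y') \<in> \<Delta> \<longrightarrow> (x - x', y - y') \<in> \<Delta>)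
      \<and> (\<forall>y. (0, y) \<in> \<Delta> \<longrightarrow> int p dvd y)}"
  have "\<exists>M\<in>\<G>. \<forall>X\<in>\<G>. M \<subseteq> X \<longrightarrow> X = M"
  proof (rule subset_Zorn_nonempty)
    show "\<G> \<noteq> {}" using diff zero by (auto simp: \<G>_def)
    fix \<C> assume "\<C> \<noteq> {}" and ch: "subset.chain \<G> \<C>"
    then have C: "\<C> \<subseteq> \<G>" by (simp add: subset.chain_def)
    show "\<Union>\<C> \<in> \<G>"
      unfolding \<G>_def mem_Collect_eq
    proof (intro conjI allI impI)
      obtain D where "D \<in> \<C>" using \<open>\<C> \<noteq> {}\<close> by blast
      then show "\<Gamma> \<subseteq> \<Union>\<C>" using C unfolding \<G>_def by blast
      fix x y x' y' assume "(x, y) \<in> \<Union>\<C>" "(x', y') \<in> \<Union>\<C>"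
      then obtain D E where DE: "D \<in> \<C>" "(x, y) \<in> D" "E \<in> \<C>" "(x', y') \<in> E" by auto
      then have "D \<subseteq> E \<or> E \<subseteq> D" using ch by (auto simp: subset_chain_def)
      then obtain F where "F \<in> \<C>" "(x, y) \<in> F" "(x', y') \<in> F" using DE by auto
      then show "(x - x', y - y') \<in> \<Union>\<C>" using C unfolding \<G>_def by blast
    next
      fix y assume "(0, y) \<in> \<Union>\<C>" then show "int p dvd y" using C unfolding \<G>_def by blast
    qed
  qed
  then obtain M where M: "M \<in> \<G>" and max: "\<And>X. X \<in> \<G> \<Longrightarrow> M \<subseteq> X \<Longrightarrow> X = M" by blast
  have Md: "(x - x', y - y') \<in> M" if "(x, y) \<in> M" "(x', y') \<in> M" for x y x' y' using M that by (auto simp: \<G>_def)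
  have Mz: "int p dvd y" if "(0, y) \<in> M" for y using M that by (auto simp: \<G>_def)
  have Mp: "(frag_cmul (int p) w, int p * k) \<in> M" for w k using M mult by (auto simp: \<G>_def)
  have M0: "(0, 0) \<in> M" using Mp [of 0 0] by simp
  have Ma: "(x + x', y + y') \<in> M" if "(x, y) \<in> M" "(x', y') \<in> M" for x y x' y'
    using Md [OF that(1) Md [OF M0 that(2)]] by simp
  have Mm: "(frag_cmul k x, k * y) \<in> M" if "(x, y) \<in> M" for x y k
  proof -
    have nat: "(frag_cmul (int n) x, int n * y) \<in> M" for n
    proof (induction n)
      case (Suc n)
      then show ?case using Ma [OF that Suc] by (simp add: frag_cmul_distrib algebra_simps)
    qed (simp add: M0)
    show ?thesis
    proof (cases k)
      case (neg n)
      then show ?thesis using Md [OF M0 nat [of "Suc n"]] by (simp del: of_nat_Suc)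
    qed (use nat in simp)
  qed
  have total: "\<exists>y. (x, y) \<in> M" for x
  proof (rule ccontr)
    assume nx: "\<nexists>y. (x, y) \<in> M"
    \<comment> \<open>The functional is extended to the new element \<open>x\<close> by the value 0
      there.\<close>
    define X where "X = {(u + frag_cmul m x, v) | u v m. (u, v) \<in> M}"
    have "X \<in> \<G>"
      unfolding \<G>_def mem_Collect_eq
    proof (intro conjI allI impI)
      show "\<Gamma> \<subseteq> X"
      proof
        fix z assume "z \<in> \<Gamma>"
        then have "(fst z, snd z) \<in> M" using M by (auto simp: \<G>_def)
        moreover have "z = (fst z + frag_cmul 0 x, snd z)" by simp
        ultimately show "z \<in> X" unfolding X_def by blast
      qed
      fix a b a' b' assume "(a, b) \<in> X" "(a', b') \<in> X"
      then obtain u m u' m' where "a = u + frag_cmul m x" "(u, b) \<in> M" "a' = u' + frag_cmul m' x" "(u', b') \<in> M"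
        by (auto simp: X_def)
      then have "a - a' = (u - u') + frag_cmul (m - m') x" "(u - u', b - b') \<in> M"
        using Md by (auto simp: frag_cmul_diff_distrib)
      then show "(a - a', b - b') \<in> X" unfolding X_def by blast
    next
      fix v assume "(0, v) \<in> X"
      then obtain u m where u: "0 = u + frag_cmul m x" "(u, v) \<in> M" by (auto simp: X_def)
      show "int p dvd v"
      proof (cases "int p dvd m")
        case True
        then obtain q where "m = int p * q" by auto
        then have "(u + frag_cmul m x, v + 0) \<in> M" using Ma [OF u(2) Mp [of "frag_cmul q x" 0]] by simp
        then show ?thesis using u(1) Mz by simp
      next
        \<comment> \<open>By Bezout \<open>x\<close> is a combination of \<open>m x = - u\<close>
          and \<open>p x\<close>, both in the domain already, contrary to the choice of
          \<open>x\<close>.\<close>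
        case False
        then have "coprime (int p) m" using p by (simp add: prime_imp_coprime)
        then obtain a b where ab: "a * int p + b * m = 1" by (metis bezout_int coprime_imp_gcd_eq_1)
        have "u = - frag_cmul m x" using u(1) by (metis add_eq_0_iff2)
        then have "(frag_cmul (-1) u, -1 * v) \<in> M" "frag_cmul (-1) u = frag_cmul m x" using Mm [OF u(2), of "-1"] by auto
        then have "(frag_cmul b (frag_cmul m x), b * (-1 * v)) \<in> M" using Mm by metis
        then have "(frag_cmul b (frag_cmul m x) + frag_cmul (int p) (frag_cmul a x), b * (-1 * v) + int p * 0) \<in> M"
          using Ma Mp by blast
        moreover have "frag_cmul b (frag_cmul m x) + frag_cmul (int p) (frag_cmul a x) = x"
          using ab by (metis frag_cmul_cmul frag_cmul_distrib frag_cmul_one add.commute mult.commute)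
        ultimately show ?thesis using nx by auto
      qed
    qed
    moreover have "M \<subseteq> X"
    proof
      fix z assume "z \<in> M"
      then have "(fst z, snd z) \<in> M" by simp
      moreover have "z = (fst z + frag_cmul 0 x, snd z)" by simp
      ultimately show "z \<in> X" unfolding X_def by blast
    qed
    ultimately have "X = M" using max by blast
    moreover have "(0 + frag_cmul 1 x, 0) \<in> X" unfolding X_def using M0 by blast
    ultimately show False using nx by auto
  qed
  define \<psi> where "\<psi> x = (SOME y. (x, y) \<in> M)" for x
  have \<psi>: "(x, \<psi> x) \<in> M" for x unfolding \<psi>_def using total by (rule someI_ex)
  have unique: "[y = y'] (mod int p)" if "(x, y) \<in> M" "(x, y') \<in> M" for x y y'
    using Md [OF that] Mz by (simp add: cong_iff_dvd_diff)
  show ?thesis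
  proof
    show "[\<psi> (x + y) = \<psi> x + \<psi> y] (mod int p)" for x y
      using unique [OF \<psi> Ma [OF \<psi> \<psi>]] .
    show "[\<psi> x = y] (mod int p)" if "(x, y) \<in> \<Gamma>" for x y
      using unique [OF \<psi>] that M by (auto simp: \<G>_def)
  qed
qed

subsection \<open>The groups of cochains and the cohomology groups\<close>

lemma carrier_cochain_group:
  "carrier (cochain_group n X A) = hom (chain_group n X) A \<inter> extensional (singular_chain_set n X)"
  and mult_cochain_group: "\<phi> \<otimes>\<^bsub>cochain_group n X A\<^esub> \<psi> = (\<lambda>c\<in>singular_chain_set n X. \<phi> c \<otimes>\<^bsub>A\<^esub> \<psi> c)"
  and one_cochain_group: "\<one>\<^bsub>cochain_group n X A\<^esub> = (\<lambda>c\<in>singular_chain_set n X. \<one>\<^bsub>A\<^esub>)"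
  by (simp_all add: cochain_group_def)

lemma cochain_hom:
  assumes "\<phi> \<in> carrier (cochain_group n X A)" "singular_chain n X a" "singular_chain n X b"
  shows "\<phi> (a + b) = \<phi> a \<otimes>\<^bsub>A\<^esub> \<phi> b"
  using assms by (auto simp: carrier_cochain_group hom_def)

lemma cochain_closed:
  "\<phi> \<in> carrier (cochain_group n X A) \<Longrightarrow> singular_chain n X a \<Longrightarrow> \<phi> a \<in> carrier A"
  by (auto simp: carrier_cochain_group hom_def)

lemma cochainI:
  assumes "\<And>a. singular_chain n X a \<Longrightarrow> f a \<in> carrier A"
    "\<And>a b. singular_chain n X a \<Longrightarrow> singular_chain n X b \<Longrightarrow> f (a + b) = f a \<otimes>\<^bsub>A\<^esub> f b"
  shows "(\<lambda>c\<in>singular_chain_set n X. f c) \<in> carrier (cochain_group n X A)"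
  using assms by (auto simp: carrier_cochain_group hom_def singular_chain_add)

context comm_group
begin

lemma comm_group_cochain_group: "comm_group (cochain_group n X G)"
proof (rule comm_groupI)
  let ?C = "cochain_group n X G"
  fix x y assume x: "x \<in> carrier ?C" and y: "y \<in> carrier ?C"
  show "x \<otimes>\<^bsub>?C\<^esub> y \<in> carrier ?C"
    unfolding mult_cochain_group
    by (rule cochainI) (use cochain_hom [OF x] cochain_closed [OF x] cochain_hom [OF y] cochain_closed [OF y] in \<open>auto simp: m_ac\<close>)
  show "x \<otimes>\<^bsub>?C\<^esub> y = y \<otimes>\<^bsub>?C\<^esub> x"
    unfolding mult_cochain_group
    by (rule restrict_ext) (use cochain_hom [OF x] cochain_closed [OF x] cochain_hom [OF y] cochain_closed [OF y] in \<open>auto simp: m_comm\<close>)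
  show "\<one>\<^bsub>?C\<^esub> \<otimes>\<^bsub>?C\<^esub> x = x"
    unfolding mult_cochain_group one_cochain_group
    by (rule extensionalityI [of _ "singular_chain_set n X"])
      (use cochain_hom [OF x] cochain_closed [OF x] x in \<open>auto simp: carrier_cochain_group\<close>)
  show "\<exists>y\<in>carrier ?C. y \<otimes>\<^bsub>?C\<^esub> x = \<one>\<^bsub>?C\<^esub>"
  proof
    let ?y = "\<lambda>c\<in>singular_chain_set n X. inv x c"
    show "?y \<in> carrier ?C"
      by (rule cochainI) (use cochain_hom [OF x] cochain_closed [OF x] in \<open>auto simp: inv_mult\<close>)
    show "?y \<otimes>\<^bsub>?C\<^esub> x = \<one>\<^bsub>?C\<^esub>"
      unfolding mult_cochain_group one_cochain_group
      by (rule restrict_ext) (use cochain_hom [OF x] cochain_closed [OF x] in auto)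
  qed
  fix z assume z: "z \<in> carrier ?C"
  show "x \<otimes>\<^bsub>?C\<^esub> y \<otimes>\<^bsub>?C\<^esub> z = x \<otimes>\<^bsub>?C\<^esub> (y \<otimes>\<^bsub>?C\<^esub> z)"
    unfolding mult_cochain_group
    by (rule restrict_ext) (use cochain_hom [OF x] cochain_closed [OF x] cochain_hom [OF y] cochain_closed [OF y] cochain_hom [OF z] cochain_closed [OF z] in \<open>auto simp: m_assoc\<close>)
next
  show "\<one>\<^bsub>cochain_group n X G\<^esub> \<in> carrier (cochain_group n X G)"
    unfolding one_cochain_group by (rule cochainI) auto
qed

lemma coboundary_hom: "coboundary n X \<in> hom (cochain_group n X G) (cochain_group (Suc n) X G)"
proof (rule homI)
  fix x assume x: "x \<in> carrier (cochain_group n X G)"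
  show "coboundary n X x \<in> carrier (cochain_group (Suc n) X G)"
    unfolding coboundary_def
    by (rule cochainI) (use cochain_hom [OF x] cochain_closed [OF x] in \<open>auto simp: chain_boundary_add singular_chain_boundary_alt\<close>)
  fix y assume y: "y \<in> carrier (cochain_group n X G)"
  show "coboundary n X (x \<otimes>\<^bsub>cochain_group n X G\<^esub> y)
      = coboundary n X x \<otimes>\<^bsub>cochain_group (Suc n) X G\<^esub> coboundary n X y"
    unfolding coboundary_def mult_cochain_group
    by (rule restrict_ext) (simp add: singular_chain_boundary_alt)
qed

lemma group_hom_coboundary: "group_hom (cochain_group n X G) (cochain_group (Suc n) X G) (coboundary n X)"
  unfolding group_hom_def group_hom_axioms_def
  using coboundary_hom comm_group_cochain_group comm_group.axioms(2) by blast

lemma subgroup_cocycles: "subgroup (cocycles n X G) (cochain_group n X G)"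
  unfolding cocycles_def by (rule group_hom.subgroup_kernel [OF group_hom_coboundary])

lemma subgroup_coboundaries: "subgroup (coboundaries n X G) (cochain_group n X G)"
proof (cases n)
  case 0
  then show ?thesis
    using group.triv_subgroup comm_group_cochain_group comm_group.axioms(2) by fastforce
next
  case (Suc m)
  then show ?thesis using group_hom.img_is_subgroup [OF group_hom_coboundary] by simp
qed

lemma cocycles_iff:
  "\<phi> \<in> cocycles n X G \<longleftrightarrow> \<phi> \<in> carrier (cochain_group n X G) \<and>
     (\<forall>c. singular_chain (Suc n) X c \<longrightarrow> \<phi> (chain_boundary (Suc n) c) = \<one>)"
  unfolding cocycles_def kernel_def coboundary_def one_cochain_group
  by (auto simp: fun_eq_iff restrict_def)

lemma cochain_0: assumes "\<phi> \<in> carrier (cochain_group n X G)" shows "\<phi> 0 = \<one>"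
  using cochain_hom [OF assms, of 0 0] cochain_closed [OF assms, of 0] by simp

lemma coboundaries_subset_cocycles: "coboundaries n X G \<subseteq> cocycles n X G"
proof (cases n)
  case 0
  have "\<one>\<^bsub>cochain_group 0 X G\<^esub> \<in> cocycles 0 X G"
    using subgroup.one_closed [OF subgroup_cocycles] .
  with 0 show ?thesis by simp
next
  case (Suc m)
  show ?thesis
  proof
    fix \<phi> assume "\<phi> \<in> coboundaries n X G"
    then obtain \<psi> where psi: "\<psi> \<in> carrier (cochain_group m X G)" "\<phi> = coboundary m X \<psi>" using Suc by auto
    have "\<phi> \<in> carrier (cochain_group n X G)" using coboundary_hom psi Suc hom_in_carrier by metis
    moreover have "\<phi> (chain_boundary (Suc n) c) = \<one>" if "singular_chain (Suc n) X c" for c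
      using that chain_boundary_boundary [OF that] singular_chain_boundary_alt [OF that] psi Suc cochain_0
      by (simp add: coboundary_def)
    ultimately show "\<phi> \<in> cocycles n X G" by (simp add: cocycles_iff)
  qed
qed

lemma carrier_cohomology_group:
  "carrier (cohomology_group n X G) = (\<lambda>a. (\<lambda>h. h \<otimes>\<^bsub>cochain_group n X G\<^esub> a) ` coboundaries n X G) ` cocycles n X G"
proof -
  have "carrier (subgroup_generated (cochain_group n X G) (cocycles n X G)) = cocycles n X G"
    by (rule subgroup.carrier_subgroup_generated_subgroup [OF subgroup_cocycles])
  then show ?thesis
    by (auto simp: cohomology_group_def FactGroup_def RCOSETS_def r_coset_def image_iff)
qed

lemma one_cohomology_group: "\<one>\<^bsub>cohomology_group n X G\<^esub> = coboundaries n X G"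
  by (simp add: cohomology_group_def FactGroup_def)

lemma group_cohomology_group: "group (cohomology_group n X G)"
proof -
  interpret C: comm_group "cochain_group n X G" by (rule comm_group_cochain_group)
  interpret Z: comm_group "subgroup_generated (cochain_group n X G) (cocycles n X G)"
    using C.abelian_subgroup_generated comm_group_cochain_group by blast
  have "subgroup (coboundaries n X G) (subgroup_generated (cochain_group n X G) (cocycles n X G))"
    using subgroup_coboundaries coboundaries_subset_cocycles C.subgroup_subgroup_generated_iff
      subgroup.carrier_subgroup_generated_subgroup [OF subgroup_cocycles] by metis
  then show ?thesis
    unfolding cohomology_group_def using Z.subgroup_imp_normal normal.factorgroup_is_group by blast
qed

lemma mem_cohomology_induced:
  "x \<in> cohomology_induced n X A f K \<longleftrightarrow>
    (\<exists>h\<in>coboundaries n X A. \<exists>k\<in>K. x = h \<otimes>\<^bsub>cochain_group n X A\<^esub> cochain_pullback n X f k)"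
  by (simp add: cohomology_induced_def set_mult_def)

lemma cochain_pullback_carrier:
  assumes f: "continuous_map X Y f" and x: "\<phi> \<in> carrier (cochain_group n Y G)"
  shows "cochain_pullback n X f \<phi> \<in> carrier (cochain_group n X G)"
  unfolding cochain_pullback_def
  by (rule cochainI) (use cochain_hom [OF x] cochain_closed [OF x] singular_chain_chain_map [OF _ f] in \<open>auto simp: chain_map_add\<close>)

text \<open>The kernel is computed degree by degree, and a class is a coset of one cocycle; its
  image vanishes exactly if the pullback of that cocycle is a coboundary. Thus vanishing in degrees
  at least \<open>m\<close> and injectivity below \<open>m\<close> can be checked on single
  cocycles.\<close>

lemma kernel_cohomology_map_eq_ge:
  assumes f: "continuous_map Y B f"
    and ge: "\<And>n \<phi>. m \<le> n \<Longrightarrow> \<phi> \<in> cocycles n B G \<Longrightarrow> cochain_pullback n Y f \<phi> \<in> coboundaries n Y G"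
    and less: "\<And>n \<phi>. n < m \<Longrightarrow> \<phi> \<in> cocycles n B G \<Longrightarrow> cochain_pullback n Y f \<phi> \<in> coboundaries n Y G
      \<Longrightarrow> \<phi> \<in> coboundaries n B G"
  shows "kernel (cohomology B G) (cohomology Y G) (cohomology_map Y G f) = cohomology_ge m B G"
proof -
  have "(cohomology_map Y G f c = \<one>\<^bsub>cohomology Y G\<^esub>) \<longleftrightarrow> (\<forall>n<m. c n = \<one>\<^bsub>cohomology_group n B G\<^esub>)"
    if c: "c \<in> carrier (cohomology B G)" for c
  proof -
    have cn: "c n \<in> carrier (cohomology_group n B G)" for n
      using c carrier_sum_group [of UNIV "\<lambda>n. cohomology_group n B G"] group_cohomology_group
      by (auto simp: cohomology_def)
    have "cohomology_map Y G f c = \<one>\<^bsub>cohomology Y G\<^esub> \<longleftrightarrow>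
        (\<forall>n. cohomology_induced n Y G f (c n) = coboundaries n Y G)"
      by (auto simp: cohomology_def cohomology_map_def one_cohomology_group fun_eq_iff)
    moreover have "cohomology_induced n Y G f (c n) = coboundaries n Y G" if n: "m \<le> n" for n
    proof -
      obtain a where a: "a \<in> cocycles n B G"
        "c n = (\<lambda>h. h \<otimes>\<^bsub>cochain_group n B G\<^esub> a) ` coboundaries n B G"
        using cn [of n] unfolding carrier_cohomology_group by blast
      have sub: "c n \<subseteq> cocycles n B G"
        unfolding a(2) using subgroup.m_closed [OF subgroup_cocycles _ a(1)] coboundaries_subset_cocycles [of n B]
        by (auto simp: subset_eq)
      have ne: "c n \<noteq> {}" using a(2) subgroup.one_closed [OF subgroup_coboundaries] by blast
      interpret C: comm_group "cochain_group n Y G" by (rule comm_group_cochain_group)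
      interpret H: subgroup "coboundaries n Y G" "cochain_group n Y G" by (rule subgroup_coboundaries)
      show ?thesis
      proof (intro equalityI subsetI)
        fix x assume "x \<in> cohomology_induced n Y G f (c n)"
        then obtain h k where h: "h \<in> coboundaries n Y G" and k: "k \<in> c n"
          and x: "x = h \<otimes>\<^bsub>cochain_group n Y G\<^esub> cochain_pullback n Y f k"
          unfolding mem_cohomology_induced by metis
        show "x \<in> coboundaries n Y G"
          unfolding x by (rule H.m_closed [OF h ge [OF n subsetD [OF sub k]]])
      next
        fix x assume x: "x \<in> coboundaries n Y G"
        obtain b where b: "b \<in> c n" using ne by blast
        define k where "k = cochain_pullback n Y f b"
        have k: "k \<in> coboundaries n Y G" unfolding k_def using ge [OF n] sub b by blast
        \<comment> \<open>An arbitrary coboundary is reached by correcting the coset representative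
          with the inverse of the pullback \<open>k\<close>.\<close>
        have "x = (x \<otimes>\<^bsub>cochain_group n Y G\<^esub> inv\<^bsub>cochain_group n Y G\<^esub> k) \<otimes>\<^bsub>cochain_group n Y G\<^esub> k"
          using x k H.mem_carrier by (simp add: C.m_assoc)
        moreover have "x \<otimes>\<^bsub>cochain_group n Y G\<^esub> inv\<^bsub>cochain_group n Y G\<^esub> k \<in> coboundaries n Y G"
          using x k H.m_closed H.m_inv_closed by blast
        ultimately show "x \<in> cohomology_induced n Y G f (c n)"
          unfolding mem_cohomology_induced using b k_def by metis
      qed
    qed
    moreover have "cohomology_induced n Y G f (c n) = coboundaries n Y G \<longleftrightarrow> c n = coboundaries n B G" if n: "n < m" for n
    proof -
      obtain a where a: "a \<in> cocycles n B G"
        "c n = (\<lambda>h. h \<otimes>\<^bsub>cochain_group n B G\<^esub> a) ` coboundaries n B G"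
        using cn [of n] unfolding carrier_cohomology_group by blast
      have acarr: "a \<in> carrier (cochain_group n B G)" using a by (simp add: cocycles_iff)
      interpret CB: comm_group "cochain_group n B G" by (rule comm_group_cochain_group)
      interpret HB: subgroup "coboundaries n B G" "cochain_group n B G" by (rule subgroup_coboundaries)
      interpret C: comm_group "cochain_group n Y G" by (rule comm_group_cochain_group)
      interpret H: subgroup "coboundaries n Y G" "cochain_group n Y G" by (rule subgroup_coboundaries)
      \<comment> \<open>Pullback commutes with the coboundary. Degree 0 is separate, as there the
        only coboundary is the unit.\<close>
      have pull: "cochain_pullback n Y f b \<in> coboundaries n Y G" if b: "b \<in> coboundaries n B G" for b
      proof (cases n)
        case 0
        then show ?thesis using b singular_chain_chain_map [OF _ f]
          by (auto simp: one_cochain_group cochain_pullback_def fun_eq_iff restrict_def)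
      next
        case (Suc k)
        then obtain \<psi> where psi: "\<psi> \<in> carrier (cochain_group k B G)" "b = coboundary k B \<psi>" using b by auto
        have "cochain_pullback n Y f b = coboundary k Y (cochain_pullback k Y f \<psi>)"
          unfolding cochain_pullback_def coboundary_def Suc psi
          by (rule restrict_ext)
            (simp add: singular_chain_chain_map [OF _ f] singular_chain_boundary_alt chain_boundary_chain_map [of "Suc k" Y])
        then show ?thesis using cochain_pullback_carrier [OF f psi(1)] Suc by auto
      qed
      show ?thesis
      proof
        assume L: "cohomology_induced n Y G f (c n) = coboundaries n Y G"
        have "a \<in> c n" unfolding a(2) using HB.one_closed CB.l_one [OF acarr] by (metis imageI)
        then have "\<one>\<^bsub>cochain_group n Y G\<^esub> \<otimes>\<^bsub>cochain_group n Y G\<^esub> cochain_pullback n Y f a \<in> cohomology_induced n Y G f (c n)"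
          unfolding mem_cohomology_induced using H.one_closed by metis
        then have "cochain_pullback n Y f a \<in> coboundaries n Y G"
          using L C.l_one [OF cochain_pullback_carrier [OF f acarr]] by simp
        then have ab: "a \<in> coboundaries n B G" using less n a(1) by blast
        show "c n = coboundaries n B G"
        proof (intro equalityI subsetI)
          fix x assume "x \<in> c n"
          then show "x \<in> coboundaries n B G" unfolding a(2) using HB.m_closed [OF _ ab] by auto
        next
          fix x assume x: "x \<in> coboundaries n B G"
          have "x = (x \<otimes>\<^bsub>cochain_group n B G\<^esub> inv\<^bsub>cochain_group n B G\<^esub> a) \<otimes>\<^bsub>cochain_group n B G\<^esub> a"
            using x ab HB.mem_carrier by (simp add: CB.m_assoc)
          moreover have "x \<otimes>\<^bsub>cochain_group n B G\<^esub> inv\<^bsub>cochain_group n B G\<^esub> a \<in> coboundaries n B G"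
            using x ab HB.m_closed HB.m_inv_closed by blast
          ultimately show "x \<in> c n" unfolding a(2) by blast
        qed
      next
        assume R: "c n = coboundaries n B G"
        show "cohomology_induced n Y G f (c n) = coboundaries n Y G"
        proof (intro equalityI subsetI)
          fix x assume "x \<in> cohomology_induced n Y G f (c n)"
          then obtain h k where h: "h \<in> coboundaries n Y G" and k: "k \<in> coboundaries n B G"
            and x: "x = h \<otimes>\<^bsub>cochain_group n Y G\<^esub> cochain_pullback n Y f k"
            unfolding mem_cohomology_induced R by metis
          show "x \<in> coboundaries n Y G"
            unfolding x by (rule H.m_closed [OF h pull [OF k]])
        next
          fix x assume x: "x \<in> coboundaries n Y G"
          have "cochain_pullback n Y f \<one>\<^bsub>cochain_group n B G\<^esub> = \<one>\<^bsub>cochain_group n Y G\<^esub>"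
            unfolding cochain_pullback_def one_cochain_group
            by (rule restrict_ext) (simp add: singular_chain_chain_map [OF _ f])
          moreover have "x = x \<otimes>\<^bsub>cochain_group n Y G\<^esub> \<one>\<^bsub>cochain_group n Y G\<^esub>" using x H.mem_carrier by simp
          ultimately show "x \<in> cohomology_induced n Y G f (c n)"
            unfolding mem_cohomology_induced R using x HB.one_closed by metis
        qed
      qed
    qed
    ultimately show ?thesis by (metis not_le one_cohomology_group)
  qed
  then show ?thesis by (auto simp: kernel_def cohomology_ge_def)
qed

end

subsection \<open>Detection of coboundaries by cycles modulo p\<close>

abbreviation mod_cycle :: "nat \<Rightarrow> nat \<Rightarrow> 'a topology \<Rightarrow> 'a chain \<Rightarrow> bool" where
  "mod_cycle p n X z \<equiv> singular_chain n X z \<and> fcong p (chain_boundary n z) 0"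

context
  fixes p :: nat
  assumes p: "prime p"
begin

interpretation A: comm_group "integer_mod_group p" by simp

lemma carrier_mod: "carrier (integer_mod_group p) = {0..<int p}"
  using p prime_gt_0_nat by (simp add: carrier_integer_mod_group)

lemma cochain_range:
  assumes "\<phi> \<in> carrier (cochain_group n X (integer_mod_group p))" "singular_chain n X a"
  shows "0 \<le> \<phi> a" "\<phi> a < int p"
  using cochain_closed [OF assms] by (auto simp: carrier_mod)

lemma cochain_eq_0: 
  assumes "\<phi> \<in> carrier (cochain_group n X (integer_mod_group p))" "singular_chain n X a" "[\<phi> a = 0] (mod int p)"
  shows "\<phi> a = 0"
  using cochain_range [OF assms(1,2)] assms(3) by (simp add: cong_def)

lemma cochain_add:
  assumes "\<phi> \<in> carrier (cochain_group n X (integer_mod_group p))" "singular_chain n X a" "singular_chain n X b"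
  shows "[\<phi> (a + b) = \<phi> a + \<phi> b] (mod int p)"
  using cochain_hom [OF assms] by (simp add: cong_def)

lemma cochain_diff:
  assumes "\<phi> \<in> carrier (cochain_group n X (integer_mod_group p))" "singular_chain n X a" "singular_chain n X b"
  shows "[\<phi> (a - b) = \<phi> a - \<phi> b] (mod int p)"
proof -
  have "[\<phi> (a - b + b) - \<phi> b = \<phi> (a - b) + \<phi> b - \<phi> b] (mod int p)"
    using cochain_add [OF assms(1) singular_chain_diff [OF assms(2,3)] assms(3)] by (intro cong_diff) auto
  then show ?thesis by (simp add: cong_sym)
qed

lemma cochain_multiple:
  assumes \<phi>: "\<phi> \<in> carrier (cochain_group n X (integer_mod_group p))" and a: "singular_chain n X a"
  shows "\<phi> (frag_cmul (int p) a) = 0"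
proof -
  have "[\<phi> (frag_cmul (int k) a) = int k * \<phi> a] (mod int p)" for k
  proof (induction k)
    case 0 then show ?case using A.cochain_0 [OF \<phi>] by simp
  next
    case (Suc k)
    have "frag_cmul (int (Suc k)) a = frag_cmul (int k) a + a"
      using frag_cmul_distrib [of "int k" 1 a] by (simp add: add.commute)
    then have "[\<phi> (frag_cmul (int (Suc k)) a) = \<phi> (frag_cmul (int k) a) + \<phi> a] (mod int p)"
      using cochain_add [OF \<phi> singular_chain_cmul [OF a] a] by simp
    also have "[\<phi> (frag_cmul (int k) a) + \<phi> a = int k * \<phi> a + \<phi> a] (mod int p)"
      using Suc by (intro cong_add) auto
    finally show ?case by (simp add: algebra_simps)
  qed
  from this [of p] have "[\<phi> (frag_cmul (int p) a) = 0] (mod int p)" by (simp add: cong_def)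
  then show ?thesis using cochain_eq_0 [OF \<phi> singular_chain_cmul [OF a]] by simp
qed

lemma fcong_singular_witness:
  assumes "fcong p a b" "singular_chain n X a" "singular_chain n X b"
  obtains w where "a = b + frag_cmul (int p) w" "singular_chain n X w"
proof -
  obtain w where w: "a - b = frag_cmul (int p) w" using assms by (auto simp: fcong_def)
  have "singular_chain n X w"
    using keys_fcong_witness [OF w prime_gt_0_nat [OF p]] assms unfolding singular_chain_def by blast
  then show ?thesis using that [of w] w by (metis add.commute diff_add_cancel)
qed

lemma cochain_fcong:
  assumes \<phi>: "\<phi> \<in> carrier (cochain_group n X (integer_mod_group p))"
    and "fcong p a b" and a: "singular_chain n X a" and b: "singular_chain n X b"
  shows "\<phi> a = \<phi> b"
proof -
  obtain w where w: "a = b + frag_cmul (int p) w" "singular_chain n X w"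
    using fcong_singular_witness assms by blast
  have "[\<phi> a = \<phi> b + 0] (mod int p)"
    using cochain_add [OF \<phi> b singular_chain_cmul [OF w(2)], of "int p"] cochain_multiple [OF \<phi> w(2)] w(1) by simp
  then show ?thesis using cochain_range [OF \<phi> a] cochain_range [OF \<phi> b] by (simp add: cong_def)
qed

text \<open>Universal coefficients over a field: if \<phi> kills cycles modulo \<open>p\<close>,
  then \<open>d c \<mapsto> \<phi> c\<close> is well defined modulo \<open>p\<close> on boundaries,
  and any extension to all chains is a primitive. In degree 0 every chain is a cycle.\<close>

lemma coboundary_iff_mod_cycle:
  assumes \<phi>: "\<phi> \<in> carrier (cochain_group n X (integer_mod_group p))"
  shows "\<phi> \<in> coboundaries n X (integer_mod_group p) \<longleftrightarrow> (\<forall>z. mod_cycle p n X z \<longrightarrow> \<phi> z = 0)"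
proof (cases n)
  case 0
  have "\<phi> \<in> coboundaries n X (integer_mod_group p) \<longleftrightarrow> (\<forall>z. singular_chain n X z \<longrightarrow> \<phi> z = 0)"
    using \<phi> 0 by (auto simp: one_cochain_group carrier_cochain_group extensional_def fun_eq_iff)
  then show ?thesis by (simp add: 0 chain_boundary_def)
next
  case (Suc m)
  show ?thesis
  proof (intro iffI allI impI)
    fix z assume "\<phi> \<in> coboundaries n X (integer_mod_group p)" and z: "mod_cycle p n X z"
    then obtain \<psi> where \<psi>: "\<psi> \<in> carrier (cochain_group m X (integer_mod_group p))" "\<phi> = coboundary m X \<psi>"
      using Suc by auto
    have b: "singular_chain m X (chain_boundary n z)" using z Suc singular_chain_boundary_alt by blast
    have "\<psi> (chain_boundary n z) = \<psi> 0" using cochain_fcong [OF \<psi>(1) _ b] z by auto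
    then show "\<phi> z = 0" using \<psi> z Suc A.cochain_0 [OF \<psi>(1)] by (simp add: coboundary_def)
  next
    assume van: "\<forall>z. mod_cycle p n X z \<longrightarrow> \<phi> z = 0"
    \<comment> \<open>The graph of the partial primitive, enlarged by multiples of \<open>p\<close>
      on both sides.\<close>
    define \<Gamma> where "\<Gamma> = {(chain_boundary n c + frag_cmul (int p) w, \<phi> c + int p * k) | c w k. singular_chain n X c}"
    obtain \<psi> where \<psi>: "\<And>x y. [\<psi> (x + y) = \<psi> x + \<psi> y] (mod int p)"
      "\<And>x y. (x, y) \<in> \<Gamma> \<Longrightarrow> [\<psi> x = y] (mod int p)"
    proof (rule mod_extension [OF p, of \<Gamma>])
      fix x y x' y' assume xy: "(x, y) \<in> \<Gamma>" and xy': "(x', y') \<in> \<Gamma>"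
      obtain c w k where 1: "x = chain_boundary n c + frag_cmul (int p) w" "y = \<phi> c + int p * k"
        "singular_chain n X c" using xy by (auto simp: \<Gamma>_def)
      obtain c' w' k' where 2: "x' = chain_boundary n c' + frag_cmul (int p) w'" "y' = \<phi> c' + int p * k'"
        "singular_chain n X c'" using xy' by (auto simp: \<Gamma>_def)
      note * = 1(1,2) 2(1,2) 1(3) 2(3)
      obtain q where "\<phi> c - \<phi> c' = \<phi> (c - c') + int p * q"
        using cochain_diff [OF \<phi> *(5,6)] by (metis cong_iff_lin cong_sym)
      then have "y - y' = \<phi> (c - c') + int p * (q + k - k')" using * by (simp add: algebra_simps)
      moreover have "x - x' = chain_boundary n (c - c') + frag_cmul (int p) (w - w')"
        using * by (simp add: chain_boundary_diff frag_cmul_diff2)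
      ultimately show "(x - x', y - y') \<in> \<Gamma>" unfolding \<Gamma>_def using * singular_chain_diff by blast
    next
      fix w :: "'a chain" and k
      have "frag_cmul (int p) w = chain_boundary n 0 + frag_cmul (int p) w" "int p * k = \<phi> 0 + int p * k"
        using A.cochain_0 [OF \<phi>] by simp_all
      then show "(frag_cmul (int p) w, int p * k) \<in> \<Gamma>" unfolding \<Gamma>_def using singular_chain_0 by blast
    next
      fix y assume "(0, y) \<in> \<Gamma>"
      then obtain c w k where *: "0 = chain_boundary n c + frag_cmul (int p) w" "y = \<phi> c + int p * k" "singular_chain n X c"
        by (auto simp: \<Gamma>_def)
      then have "chain_boundary n c = frag_cmul (int p) (- w)"
        by (metis add_eq_0_iff2 minus_frag_cmul frag_cmul_minus_one frag_cmul_cmul mult.commute mult_minus1_right)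
      then have "\<phi> c = 0" using van * by auto
      then show "int p dvd y" using * by simp
    qed (rule that)
    define \<psi>' where "\<psi>' = (\<lambda>c\<in>singular_chain_set m X. \<psi> c mod int p)"
    have "\<psi>' \<in> carrier (cochain_group m X (integer_mod_group p))"
      unfolding \<psi>'_def
    proof (rule cochainI)
      show "\<psi> a mod int p \<in> carrier (integer_mod_group p)" for a
        using prime_gt_0_nat [OF p] by (simp add: carrier_mod)
      show "\<psi> (a + b) mod int p = \<psi> a mod int p \<otimes>\<^bsub>integer_mod_group p\<^esub> (\<psi> b mod int p)" for a b
        using \<psi>(1) [of a b] by (simp add: cong_def mod_simps)
    qed
    moreover have "\<phi> = coboundary m X \<psi>'"
    proof (rule extensionalityI [of _ "singular_chain_set n X"])
      show "\<phi> \<in> extensional (singular_chain_set n X)" using \<phi> by (simp add: carrier_cochain_group)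
      show "coboundary m X \<psi>' \<in> extensional (singular_chain_set n X)" by (simp add: coboundary_def Suc)
      fix c assume "c \<in> singular_chain_set n X"
      then have c: "singular_chain n X c" by simp
      have "(chain_boundary n c + frag_cmul (int p) 0, \<phi> c + int p * 0) \<in> \<Gamma>"
        unfolding \<Gamma>_def using c by blast
      then have "[\<psi> (chain_boundary n c) = \<phi> c] (mod int p)" using \<psi>(2) by fastforce
      then show "\<phi> c = coboundary m X \<psi>' c"
        using c Suc singular_chain_boundary_alt [of m X c] cochain_range [OF \<phi> c] by (simp add: coboundary_def \<psi>'_def cong_def)
    qed
    ultimately show "\<phi> \<in> coboundaries n X (integer_mod_group p)" using Suc by auto
  qed
qed

lemma cocycle_homologous:
  assumes \<phi>: "\<phi> \<in> cocycles n X (integer_mod_group p)"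
    and z: "singular_chain n X z" "singular_chain n X z'" "singular_chain (Suc n) X u"
    and "fcong p (z - z') (chain_boundary (Suc n) u)"
  shows "\<phi> z = \<phi> z'"
proof -
  have c: "\<phi> \<in> carrier (cochain_group n X (integer_mod_group p))" using \<phi> by (simp add: A.cocycles_iff)
  have "\<phi> (z - z') = \<phi> (chain_boundary (Suc n) u)"
    using cochain_fcong [OF c] assms singular_chain_diff singular_chain_boundary_alt by blast
  then have "[\<phi> z - \<phi> z' = 0] (mod int p)"
    using cochain_diff [OF c z(1,2)] \<phi> z(3) by (simp add: A.cocycles_iff cong_sym)
  then have "[\<phi> z = \<phi> z'] (mod int p)" by (simp add: cong_iff_dvd_diff)
  then show ?thesis using cochain_range [OF c] z by (simp add: cong_def)
qed

text \<open>The homotopy \<open>h\<close> between the identity and iterated subdivision is additive,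
  so it sends the boundary of \<open>z\<close>, a multiple of \<open>p\<close>, to a multiple of
  \<open>p\<close>; only the boundary term survives.\<close>

lemma small_mod_cycle:
  assumes \<C>: "\<And>U. U \<in> \<C> \<Longrightarrow> openin X U" "topspace X \<subseteq> \<Union>\<C>"
    and z: "mod_cycle p n X z"
  obtains z' u where "singular_chain n X z'" "singular_chain (Suc n) X u"
    "fcong p (z' - z) (chain_boundary (Suc n) u)"
    "\<And>f. f \<in> Poly_Mapping.keys z' \<Longrightarrow> \<exists>V\<in>\<C>. f \<in> standard_simplex n \<rightarrow> V"
proof -
  obtain N where N: "\<And>m f. N \<le> m \<Longrightarrow> f \<in> Poly_Mapping.keys ((singular_subdivision n ^^ m) z)
      \<Longrightarrow> \<exists>V\<in>\<C>. f \<in> standard_simplex n \<rightarrow> V"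
    by (rule sufficient_iterated_singular_subdivision_exists [of \<C> X n z]) (use \<C> z in blast)+
  obtain h where h: "\<And>p. h p 0 = (0 :: 'a chain)"
        "\<And>p c1 c2. h p (c1-c2) = h p c1 - h p c2"
        "\<And>p X c. singular_chain p X c \<Longrightarrow> singular_chain (Suc p) X (h p c)"
        "\<And>p X c. singular_chain p X c
                 \<Longrightarrow> chain_boundary (Suc p) (h p c) + h (p - Suc 0) (chain_boundary p c)
                   = (singular_subdivision p ^^ N) c - c"
    using chain_homotopic_iterated_singular_subdivision by blast
  let ?z = "(singular_subdivision n ^^ N) z"
  have hz: "?z - z = chain_boundary (Suc n) (h n z) + h (n - Suc 0) (chain_boundary n z)" using h(4) z by metis
  obtain w where "chain_boundary n z = frag_cmul (int p) w" using z by (auto simp: fcong_def)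
  then have "h (n - Suc 0) (chain_boundary n z) = frag_cmul (int p) (h (n - Suc 0) w)"
    by (simp add: additive_cmul [of "h (n - Suc 0)", OF h(2)])
  then have "fcong p (?z - z) (chain_boundary (Suc n) (h n z) + 0)"
    unfolding hz by (intro fcong_add) simp_all
  moreover have "singular_chain n X ((singular_subdivision n ^^ m) z)" for m
    by (induction m) (use z in \<open>auto simp: singular_chain_singular_subdivision\<close>)
  moreover have "singular_chain (Suc n) X (h n z)" using h(3) z by blast
  moreover have "\<exists>V\<in>\<C>. f \<in> standard_simplex n \<rightarrow> V" if "f \<in> Poly_Mapping.keys ?z" for f
    using N [OF order_refl that] .
  ultimately show ?thesis using that [of ?z "h n z"] by simp
qed

end

section \<open>Free actions of a cyclic group of prime order on spaces\<close>

lemma chain_boundary_extend: "frag_extend (\<lambda>f. chain_boundary n (frag_of f)) c = chain_boundary n c"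
  by (rule frag_additive_eq [of c UNIV]) (auto simp: frag_extend_diff chain_boundary_diff)

lemma keys_chain_boundary_of:
  "Poly_Mapping.keys (chain_boundary (Suc n) (frag_of f)) \<subseteq> (\<lambda>k. singular_face (Suc n) k f) ` {..Suc n}"
  unfolding chain_boundary_of by (simp del: sum.atMost_Suc) (intro keys_sum_subset keys_cmul_subset, auto)

lemma singular_face_image:
  "k \<le> Suc n \<Longrightarrow> singular_face (Suc n) k f ` standard_simplex n \<subseteq> f ` standard_simplex (Suc n)"
  using simplical_face_in_standard_simplex [of "Suc n" k] by (auto simp: singular_face_def)

lemma simplex_map_pow:
  fixes s :: "'a \<Rightarrow> 'a"
  assumes "singular_simplex n Y f" shows "(simplex_map n s ^^ i) f = simplex_map n (s ^^ i) f"
proof (induction i)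
  case 0
  show ?case using assms by (simp add: simplex_map_id_gen [of n Y f] id_def)
next
  case (Suc i)
  then have "(simplex_map n s ^^ Suc i) f = simplex_map n s (simplex_map n (s ^^ i) f)" by simp
  also have "\<dots> = simplex_map n (s \<circ> s ^^ i) f" by (simp only: simplex_map_compose comp_apply)
  finally show ?case by (simp only: funpow.simps)
qed

text \<open>\<open>P\<close> expresses smallness. It is a property of image sets that passes to
  subsets, so that the faces of a small simplex are small.\<close>

lemma Zp_complex_singular:
  assumes p: "prime p"
    and s: "continuous_map Y Y s" "\<And>y. y \<in> topspace Y \<Longrightarrow> (s ^^ p) y = y" "\<And>y. y \<in> topspace Y \<Longrightarrow> s y \<noteq> y"
    and P: "\<And>A A'. P A \<Longrightarrow> A' \<subseteq> A \<Longrightarrow> P A'" "\<And>A. A \<subseteq> topspace Y \<Longrightarrow> P A \<Longrightarrow> P (s ` A)"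
  shows "Zp_complex p (\<lambda>n. {f. singular_simplex n Y f \<and> P (f ` standard_simplex n)})
    (\<lambda>n f. chain_boundary n (frag_of f)) (\<lambda>n. simplex_map n s)"
proof
  fix f n assume f: "f \<in> {f. singular_simplex n Y f \<and> P (f ` standard_simplex n)}"
  then have im: "f ` standard_simplex n \<subseteq> topspace Y"
    by (auto simp: singular_simplex_def continuous_map_def)
  have "simplex_map n s f ` standard_simplex n = s ` f ` standard_simplex n"
    by (auto simp: simplex_map_def)
  then show "simplex_map n s f \<in> {f. singular_simplex n Y f \<and> P (f ` standard_simplex n)}"
    using f im s(1) P(2) by (auto simp: singular_simplex_simplex_map)
  show "(simplex_map n s ^^ p) f = f"
    using f s(2) by (simp add: simplex_map_pow [of n Y] simplex_map_id_gen [of n Y])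
  obtain x where x: "x \<in> standard_simplex n" using nonempty_standard_simplex by blast
  then have "simplex_map n s f x \<noteq> f x" using s(3) im by (auto simp: simplex_map_def)
  then show "simplex_map n s f \<noteq> f" by auto
next
  fix f n assume f: "f \<in> {f. singular_simplex (Suc n) Y f \<and> P (f ` standard_simplex (Suc n))}"
  show "Poly_Mapping.keys (chain_boundary (Suc n) (frag_of f)) \<subseteq> {f. singular_simplex n Y f \<and> P (f ` standard_simplex n)}"
  proof
    fix g assume "g \<in> Poly_Mapping.keys (chain_boundary (Suc n) (frag_of f))"
    then obtain k where k: "k \<le> Suc n" "g = singular_face (Suc n) k f" using keys_chain_boundary_of by blast
    then have "singular_simplex n Y g" using singular_simplex_singular_face [of "Suc n" Y f k] f by simp
    moreover have "P (g ` standard_simplex n)"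
      using P(1) [OF _ singular_face_image [OF k(1), of f]] f k by simp
    ultimately show "g \<in> {f. singular_simplex n Y f \<and> P (f ` standard_simplex n)}" by simp
  qed
  have "singular_chain (Suc n) Y (frag_of f)" using f by (simp add: singular_chain_of)
  then show "chain_boundary (Suc n) (frag_of (simplex_map (Suc n) s f)) =
      frag_extend (frag_of \<circ> simplex_map n s) (chain_boundary (Suc n) (frag_of f))"
    using chain_boundary_chain_map [of "Suc n" Y "frag_of f" s] by (simp add: chain_map_def)
next
  fix f n assume f: "f \<in> {f. singular_simplex (Suc (Suc n)) Y f \<and> P (f ` standard_simplex (Suc (Suc n)))}"
  then have "singular_chain (Suc (Suc n)) Y (frag_of f)" by (simp add: singular_chain_of)
  then show "frag_extend (\<lambda>f. chain_boundary (Suc n) (frag_of f)) (chain_boundary (Suc (Suc n)) (frag_of f)) = 0"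
    using chain_boundary_boundary_alt unfolding chain_boundary_extend by blast
next
  fix f
  show "aug (chain_boundary (Suc 0) (frag_of f)) = 0"
    by (simp add: chain_boundary_of aug_diff)
qed (rule p)

text \<open>A free action on a Hausdorff space with its orbit map, described by its properties so
  that \<open>BG\<close> and the Borel construction are treated alike.\<close>

locale Zp_space =
  fixes p :: nat and Y :: "'a topology" and s :: "'a \<Rightarrow> 'a" and Q :: "'b topology" and q :: "'a \<Rightarrow> 'b"
  assumes p: "prime p"
    and s_cont: "continuous_map Y Y s"
    and s_order: "\<And>y. y \<in> topspace Y \<Longrightarrow> (s ^^ p) y = y"
    and s_free: "\<And>y. y \<in> topspace Y \<Longrightarrow> s y \<noteq> y"
    and Hausdorff: "Hausdorff_space Y"
    and q_cont: "continuous_map Y Q q"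
    and q_open: "open_map Y Q q"
    and q_surj: "q ` topspace Y = topspace Q"
    and q_s: "\<And>y. y \<in> topspace Y \<Longrightarrow> q (s y) = q y"
    and q_eq: "\<And>y y'. y \<in> topspace Y \<Longrightarrow> y' \<in> topspace Y \<Longrightarrow> q y = q y' \<Longrightarrow> \<exists>i. y' = (s ^^ i) y"
begin

text \<open>Points form a complex concentrated in degree 0; this makes the facts on powers of
  \<open>s\<close> and free orbits available for points.\<close>

sublocale pt: Zp_complex p "\<lambda>n. if n = 0 then topspace Y else {}" "\<lambda>_ _. 0" "\<lambda>_. s"
  by unfold_locales (use p s_cont s_order s_free in \<open>auto simp: continuous_map_def split: if_splits\<close>)

lemma s_pow_cont: "continuous_map Y Y (s ^^ i)"
  by (induction i) (auto intro: continuous_map_compose [OF _ s_cont] simp del: comp_apply simp: id_def)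

text \<open>The sets \<open>C i\<close> where the \<open>i\<close>-th translate of \<open>f\<close>
  agrees with \<open>g\<close> are closed, since \<open>Y\<close> is Hausdorff, and finitely many of
  them cover the simplex. Freeness makes those with \<open>i < p\<close> disjoint, hence open as
  well, and connectedness leaves a single one.\<close>

lemma lift_unique:
  assumes f: "singular_simplex n Y f" and g: "singular_simplex n Y g"
    and eq: "simplex_map n q f = simplex_map n q g"
  shows "\<exists>i. g = (simplex_map n s ^^ i) f"
proof -
  let ?T = "subtopology (powertop_real UNIV) (standard_simplex n)"
  have top: "topspace ?T = standard_simplex n" by (simp add: topspace_standard_simplex)
  have fc: "continuous_map ?T Y f" and gc: "continuous_map ?T Y g" using f g by (auto simp: singular_simplex_def)
  have fY: "f x \<in> topspace Y" and gY: "g x \<in> topspace Y" if "x \<in> standard_simplex n" for x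
    using continuous_map_image_subset_topspace [OF fc] continuous_map_image_subset_topspace [OF gc] that top by auto
  define C where "C i = {x \<in> standard_simplex n. (s ^^ i) (f x) = g x}" for i
  have C: "closedin ?T (C i)" for i
    using closedin_continuous_maps_eq [OF Hausdorff continuous_map_compose [OF fc s_pow_cont [of i]] gc]
    unfolding C_def top by (simp add: o_def)
  have cover: "\<exists>i<p. x \<in> C i" if x: "x \<in> standard_simplex n" for x
  proof -
    have "q (f x) = q (g x)" using fun_cong [OF eq, of x] x by (simp add: simplex_map_def)
    then obtain i where "g x = (s ^^ i) (f x)" using q_eq fY gY x by blast
    then have "x \<in> C (i mod p)" using pt.s_pow_mod [of "f x" 0 i] fY x by (simp add: C_def)
    then show ?thesis using pt.p_pos by (intro exI [of _ "i mod p"]) auto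
  qed
  obtain x0 where x0: "x0 \<in> standard_simplex n" using nonempty_standard_simplex by blast
  then obtain i where i: "i < p" "x0 \<in> C i" using cover by blast
  have compl: "standard_simplex n - C i = (\<Union>j\<in>{..<p} - {i}. C j)"
  proof (intro equalityI subsetI)
    fix x assume "x \<in> standard_simplex n - C i" then show "x \<in> (\<Union>j\<in>{..<p} - {i}. C j)" using cover [of x] by auto
  next
    fix x assume "x \<in> (\<Union>j\<in>{..<p} - {i}. C j)"
    then obtain j where j: "j < p" "j \<noteq> i" "x \<in> C j" by auto
    then have "x \<notin> C i" using pt.s_pow_eqD [of "f x" 0 i j] i fY by (auto simp: C_def)
    then show "x \<in> standard_simplex n - C i" using j by (auto simp: C_def)
  qed
  have "closedin ?T (standard_simplex n - C i)" unfolding compl by (intro closedin_Union) (auto simp: C)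
  then have "openin ?T (C i)"
    using C [of i] by (metis top closedin_subset double_diff openin_closedin_eq order_refl closedin_def)
  moreover have "connected_space ?T"
    using connectedin_standard_simplex [of n] by (simp add: connectedin_def)
  ultimately have "C i = {} \<or> C i = topspace ?T" using C [of i] unfolding connected_space_clopen_in by blast
  then have Ci: "C i = standard_simplex n" using i top by auto
  have "g = simplex_map n (s ^^ i) f"
  proof (rule extensionalityI [of _ "standard_simplex n"])
    show "g \<in> extensional (standard_simplex n)" using g by (simp add: singular_simplex_def)
    show "g x = simplex_map n (s ^^ i) f x" if "x \<in> standard_simplex n" for x
    proof -
      have "x \<in> C i" using that Ci by simp
      then show ?thesis by (simp add: C_def simplex_map_def)
    qed
  qed (simp add: simplex_map_def)
  then show ?thesis using simplex_map_pow [OF f] by metis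
qed

text \<open>On \<open>U\<close> the open injective map \<open>q\<close> is a homeomorphism onto its
  image, and its inverse lifts the simplex.\<close>

lemma lift_simplex:
  assumes U: "openin Y U" "inj_on q U" and f: "singular_simplex n Q f" "f \<in> standard_simplex n \<rightarrow> q ` U"
  shows "\<exists>g. singular_simplex n Y g \<and> g ` standard_simplex n \<subseteq> U \<and> simplex_map n q g = f"
proof -
  have UY: "U \<subseteq> topspace Y" using U openin_subset by blast
  have hom: "homeomorphic_map (subtopology Y U) (subtopology Q (q ` U)) q"
  proof (rule bijective_open_imp_homeomorphic_map)
    have qU: "q ` U \<subseteq> topspace Q" using UY q_surj by blast
    show "continuous_map (subtopology Y U) (subtopology Q (q ` U)) q"
      using q_cont by (auto simp: continuous_map_in_subtopology continuous_map_from_subtopology)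
    show "open_map (subtopology Y U) (subtopology Q (q ` U)) q"
      unfolding open_map_def
    proof (intro allI impI)
      fix V assume "openin (subtopology Y U) V"
      then have "openin Y V" "V \<subseteq> U" using U openin_open_subtopology by blast+
      then have "openin Q (q ` V)" "q ` V \<subseteq> q ` U" using q_open by (auto simp: open_map_def)
      then show "openin (subtopology Q (q ` U)) (q ` V)"
        by (simp add: openin_subset_topspace_eq openin_subtopology_alt image_iff)
          (metis inf.absorb_iff2 inf_commute)
    qed
    show "q ` topspace (subtopology Y U) = topspace (subtopology Q (q ` U))"
      using UY qU by (auto simp: topspace_subtopology)
    show "inj_on q (topspace (subtopology Y U))" using U inj_on_subset by (metis inf_le2 topspace_subtopology)
  qed
  then obtain r where r: "homeomorphic_maps (subtopology Y U) (subtopology Q (q ` U)) q r"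
    using homeomorphic_map_maps by blast
  have f': "singular_simplex n (subtopology Q (q ` U)) f"
    using f by (auto simp: singular_simplex_subtopology)
  define g where "g = simplex_map n r f"
  have g: "singular_simplex n (subtopology Y U) g"
    unfolding g_def using singular_simplex_simplex_map [OF f', of "subtopology Y U" r] r by (simp add: homeomorphic_maps_def)
  have "simplex_map n q g = simplex_map n (q \<circ> r) f" by (simp add: g_def simplex_map_compose)
  also have "\<dots> = f"
    using simplex_map_id_gen [OF f', of "q \<circ> r"] r by (simp add: homeomorphic_maps_def)
  finally show ?thesis using g by (auto simp: singular_simplex_subtopology)
qed

end

text \<open>Only the images of the admissible sets have to cover the quotient, so
  \<open>P_local\<close> asks for one around some point of each orbit.\<close>

locale small_Zp_space = Zp_space p Y s Q q for p and Y :: "'a topology" and s and Q :: "'b topology" and q +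
  fixes P :: "'a set \<Rightarrow> bool"
  assumes P_mono: "\<And>A A'. P A \<Longrightarrow> A' \<subseteq> A \<Longrightarrow> P A'"
    and P_s: "\<And>A. A \<subseteq> topspace Y \<Longrightarrow> P A \<Longrightarrow> P (s ` A)"
    and P_local: "\<And>y. y \<in> topspace Y \<Longrightarrow> \<exists>i U. openin Y U \<and> (s ^^ i) y \<in> U \<and> P U \<and> inj_on q U"
begin

sublocale sing: Zp_complex p "\<lambda>n. {f. singular_simplex n Y f \<and> P (f ` standard_simplex n)}"
    "\<lambda>n f. chain_boundary n (frag_of f)" "\<lambda>n. simplex_map n s"
  by (rule Zp_complex_singular [where P = P, OF p s_cont s_order s_free P_mono P_s])

lemma sing_d: "sing.d n c = chain_boundary n c"
  by (simp add: sing.d_def chain_boundary_extend)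

lemma sing_chains: "c \<in> sing.chains n \<Longrightarrow> singular_chain n Y c"
  by (auto simp: singular_chain_def)

lemma q_T: "c \<in> sing.chains n \<Longrightarrow> chain_map n q (sing.T True n c) = 0"
proof (rule frag_additive_eq [of c "{f. singular_simplex n Y f \<and> P (f ` standard_simplex n)}" _ "\<lambda>_. 0"])
  fix f assume f: "f \<in> {f. singular_simplex n Y f \<and> P (f ` standard_simplex n)}"
  then have "simplex_map n q (simplex_map n s f) = simplex_map n q f"
    using simplex_map_compose [of n q s] simplex_map_eq [of n Y f "q \<circ> s" q] q_s by (simp add: fun_eq_iff)
  then show "chain_map n q (sing.T True n (frag_of f)) = 0"
    by (simp add: sing.T_def chain_map_diff)
qed (auto simp: sing.T_diff chain_map_diff)

text \<open>After subdivision each simplex lies in the image of an admissible set and lifts to a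
  small simplex. The boundary of the lift dies modulo \<open>p\<close> in the quotient, so it is
  congruent to \<open>S - 1\<close> of a chain and is killed by the norm, as
  \<open>tower_exists\<close> requires.\<close>

lemma lift_mod_cycle:
  assumes z: "mod_cycle p n Q z"
  obtains y l u where "sing.tower n True y l" "singular_chain (Suc n) Q u"
    "fcong p (chain_map n q y - z) (chain_boundary (Suc n) u)"
proof -
  define \<U> where "\<U> = {U. openin Y U \<and> P U \<and> inj_on q U}"
  obtain z' u where z': "singular_chain n Q z'" "singular_chain (Suc n) Q u"
    "fcong p (z' - z) (chain_boundary (Suc n) u)"
    "\<And>f. f \<in> Poly_Mapping.keys z' \<Longrightarrow> \<exists>V\<in>(`) q ` \<U>. f \<in> standard_simplex n \<rightarrow> V"
  proof (rule small_mod_cycle [OF p _ _ z, of "(`) q ` \<U>"])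
    show "openin Q V" if "V \<in> (`) q ` \<U>" for V using that q_open by (auto simp: \<U>_def open_map_def)
    show "topspace Q \<subseteq> \<Union> ((`) q ` \<U>)"
    proof
      fix t assume "t \<in> topspace Q"
      then obtain y where y: "y \<in> topspace Y" "t = q y" using q_surj by blast
      then obtain i U where U: "U \<in> \<U>" "(s ^^ i) y \<in> U" using P_local unfolding \<U>_def by blast
      have "(s ^^ i) y \<in> topspace Y \<and> q ((s ^^ i) y) = q y"
        using y s_cont q_s by (induction i) (auto simp: continuous_map_def)
      then show "t \<in> \<Union> ((`) q ` \<U>)" using U y by (metis UN_I image_eqI)
    qed
  qed (rule that)
  define lift where "lift f = (SOME g. singular_simplex n Y g \<and> P (g ` standard_simplex n) \<and> simplex_map n q g = f)" for f
  have lift: "singular_simplex n Y (lift f) \<and> P (lift f ` standard_simplex n) \<and> simplex_map n q (lift f) = f"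
    if f: "f \<in> Poly_Mapping.keys z'" for f
  proof -
    obtain U where U: "U \<in> \<U>" "f \<in> standard_simplex n \<rightarrow> q ` U" using z'(4) [OF f] by blast
    have "singular_simplex n Q f" using z'(1) f by (auto simp: singular_chain_def)
    then obtain g where "singular_simplex n Y g" "g ` standard_simplex n \<subseteq> U" "simplex_map n q g = f"
      using lift_simplex [of U n f] U by (auto simp: \<U>_def)
    then have "\<exists>g. singular_simplex n Y g \<and> P (g ` standard_simplex n) \<and> simplex_map n q g = f"
      using P_mono U by (auto simp: \<U>_def)
    then show ?thesis unfolding lift_def by (rule someI_ex)
  qed
  define y where "y = frag_extend (frag_of \<circ> lift) z'"
  have y: "y \<in> sing.chains n"
    unfolding y_def mem_Collect_eq
    by (rule keys_frag_extend_subset [of z' "Poly_Mapping.keys z'"]) (use lift in auto)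
  have qy: "chain_map n q y = z'"
    unfolding y_def
    by (rule frag_additive_eq [of z' "Poly_Mapping.keys z'"]) (use lift in \<open>auto simp: frag_extend_diff chain_map_diff\<close>)
  have "\<exists>l. sing.tower n True y l"
  proof (rule sing.tower_exists [OF y])
    fix m assume m: "n = Suc m"
    have dy: "chain_boundary n y \<in> sing.chains m" using sing.d_chains [of y m] y m by (simp only: sing_d)
    have "chain_map m q (chain_boundary n y) = chain_boundary n z'"
      using chain_boundary_chain_map [OF sing_chains [OF y], of q] qy m by simp
    moreover have "fcong p (chain_boundary n z' - chain_boundary n z) 0"
      using fcong_extend [OF z'(3), of "\<lambda>f. chain_boundary n (frag_of f)"]
        chain_boundary_boundary_alt [OF z'(2)[unfolded m]] m by (simp add: chain_boundary_extend chain_boundary_diff)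
    ultimately have "fcong p (chain_map m q (chain_boundary n y)) 0"
      using z by (metis fcong_diff_iff fcong_trans)
    then obtain x where x: "x \<in> sing.chains m" "fcong p (chain_boundary n y) (sing.T True m x)"
      using sing.quotient_kernel [OF dy, of "simplex_map m q"] lift_unique unfolding chain_map_def by blast
    have "fcong p (sing.T False m (chain_boundary n y)) (sing.T False m (sing.T True m x))"
      using sing.fcong_T x by blast
    then show "fcong p (sing.T (\<not> True) m (sing.d n y)) 0"
      using sing.T_T [OF x(1), of False] by (simp add: sing_d)
  qed
  then show ?thesis using that z' qy by blast
qed

end

subsection \<open>Acyclicity of contractible spaces\<close>

lemma aug_chain_boundary: "aug (chain_boundary (Suc 0) c) = 0"
proof -
  have "aug (frag_extend (\<lambda>f. chain_boundary (Suc 0) (frag_of f)) c) = 0"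
    by (rule aug_extend_0 [of c UNIV]) (auto simp: chain_boundary_of aug_diff)
  then show ?thesis by (simp add: chain_boundary_extend)
qed

text \<open>A cycle is homologous to its image under a constant map. In positive degree this bounds
  in the one-point space; in degree 0 it is the augmentation times a point, which is 0.\<close>

lemma contractible_cycle_boundary:
  assumes X: "contractible_space X" and c: "singular_chain n X c" "chain_boundary n c = 0" "n = 0 \<Longrightarrow> aug c = 0"
  shows "\<exists>x. singular_chain (Suc n) X x \<and> chain_boundary (Suc n) x = c"
proof (cases "c = 0")
  case True
  then show ?thesis by (intro exI [of _ 0]) simp
next
  case False
  then have "topspace X \<noteq> {}" using c singular_chain_empty by blast
  obtain a where a': "homotopic_with (\<lambda>x. True) X X id (\<lambda>x. a)"
    using X unfolding contractible_space_def by blast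
  then have "continuous_map X X (\<lambda>x. a)" using homotopic_with_imp_continuous_maps by blast
  then have "a \<in> topspace X" using \<open>topspace X \<noteq> {}\<close> by simp
  with a' have a: "a \<in> topspace X" "homotopic_with (\<lambda>x. True) X X id (\<lambda>x. a)" by auto
  have cyc: "singular_relcycle n X {} c" using c by (simp add: singular_cycle)
  have "homologous_rel n X {} (chain_map n id c) (chain_map n (\<lambda>x. a) c)"
    by (rule homotopic_imp_homologous_rel_chain_maps [OF _ cyc]) (use a in simp)
  then have "singular_relboundary n X {} (c - chain_map n (\<lambda>x. a) c)"
    using c by (simp add: homologous_rel_def chain_map_ident)
  moreover have "singular_relboundary n X {} (chain_map n (\<lambda>x. a) c)"
  proof (cases "n = 0")
    case True
    have "chain_map 0 (\<lambda>x. a) c = frag_cmul (aug c) (frag_of (restrict (\<lambda>x. a) (standard_simplex 0)))"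
      by (rule frag_additive_eq [of c UNIV])
        (auto simp: chain_map_diff aug_diff frag_cmul_diff_distrib simplex_map_def restrict_def)
    then show ?thesis using True c by simp
  next
    case False
    let ?X = "subtopology X {a}"
    have cont: "continuous_map X ?X (\<lambda>x. a)" using a by (simp add: continuous_map_in_subtopology)
    have "singular_relcycle n ?X {} (chain_map n (\<lambda>x. a) c)"
      using singular_relcycle_chain_map [OF cyc cont, of "{}"] by simp
    then have "singular_relboundary n ?X {} (chain_map n (\<lambda>x. a) c)"
      using singular_boundary_eq_cycle_singleton [of ?X a n] a False by (simp add: topspace_subtopology)
    then show ?thesis unfolding singular_boundary using singular_chain_subtopology by blast
  qed
  ultimately have "singular_relboundary n X {} (c - chain_map n (\<lambda>x. a) c + chain_map n (\<lambda>x. a) c)"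
    by (rule singular_relboundary_add)
  then show ?thesis by (auto simp: singular_boundary)
qed

text \<open>A cycle modulo \<open>p\<close> is first corrected to an integral cycle: if
  \<open>d c = p w\<close>, then \<open>w\<close> is a cycle because chains are torsion free,
  \<open>w = d v\<close>, and \<open>c - p v\<close> can be filled integrally. In degree 0 a
  multiple of a point corrects the augmentation.\<close>

lemma contractible_acyclic:
  assumes X: "contractible_space X" and p: "prime p" and c: "singular_chain n X c"
    and cyc: "n \<noteq> 0 \<Longrightarrow> fcong p (chain_boundary n c) 0" and aug: "n = 0 \<Longrightarrow> [aug c = 0] (mod int p)"
  shows "\<exists>x. singular_chain (Suc n) X x \<and> fcong p c (chain_boundary (Suc n) x)"
proof -
  have p0: "int p \<noteq> 0" using p prime_gt_0_nat by auto
  have "\<exists>v. singular_chain n X v \<and> chain_boundary n (c - frag_cmul (int p) v) = 0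
      \<and> (n = 0 \<longrightarrow> aug (c - frag_cmul (int p) v) = 0)"
  proof (cases n)
    case 0
    show ?thesis
    proof (cases "c = 0")
      case False
      then obtain f where "f \<in> Poly_Mapping.keys c" by fastforce
      then have f: "singular_simplex 0 X f" using c 0 by (auto simp: singular_chain_def)
      obtain k where "aug c = int p * k" using aug 0 by (auto simp: cong_0_iff)
      then show ?thesis using f 0
        by (intro exI [of _ "frag_cmul k (frag_of f)"])
          (simp add: aug_diff aug_cmul chain_boundary_def singular_chain_cmul singular_chain_of)
    qed (intro exI [of _ 0], simp)
  next
    case (Suc m)
    have bc: "singular_chain m X (chain_boundary n c)" using c Suc singular_chain_boundary_alt by blast
    obtain w where w: "chain_boundary n c = frag_cmul (int p) w" "singular_chain m X w"
      using fcong_singular_witness [OF p cyc bc] Suc by auto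
    have "frag_cmul (int p) (chain_boundary m w) = chain_boundary m (chain_boundary n c)"
      using w by (simp add: chain_boundary_cmul)
    also have "\<dots> = 0" using chain_boundary_boundary [OF c] Suc by simp
    finally have "chain_boundary m w = 0" using p0 by simp
    \<comment> \<open>Filling a 0-chain also requires augmentation 0, which \<open>w\<close>
      inherits from the boundary of a 1-chain.\<close>
    moreover have "aug w = 0" if "m = 0"
    proof -
      have "int p * aug w = aug (chain_boundary n c)" using w by (simp add: aug_cmul)
      also have "\<dots> = 0" using aug_chain_boundary Suc that by simp
      finally show ?thesis using p0 by simp
    qed
    ultimately obtain v where v: "singular_chain n X v" "chain_boundary n v = w"
      using contractible_cycle_boundary [OF X w(2)] Suc by blast
    then show ?thesis using w Suc by (intro exI [of _ v]) (simp add: chain_boundary_diff chain_boundary_cmul)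
  qed
  then obtain v where v: "singular_chain n X v" "chain_boundary n (c - frag_cmul (int p) v) = 0"
      "n = 0 \<Longrightarrow> aug (c - frag_cmul (int p) v) = 0" by blast
  then obtain x where x: "singular_chain (Suc n) X x" "chain_boundary (Suc n) x = c - frag_cmul (int p) v"
    using contractible_cycle_boundary [OF X singular_chain_diff [OF c singular_chain_cmul]] by blast
  have "c - chain_boundary (Suc n) x = frag_cmul (int p) v" using x by simp
  then show ?thesis using x(1) unfolding fcong_def by blast
qed

section \<open>Geometric realizations\<close>

lemma realization_memI:
  assumes K: "\<And>S R. S \<in> K \<Longrightarrow> R \<subseteq> S \<Longrightarrow> R \<in> K" and S: "S \<in> K" "finite S"
    and x: "\<And>v. 0 \<le> x v" "\<And>v. v \<notin> S \<Longrightarrow> x v = 0" "(\<Sum>v\<in>S. x v) = 1"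
  shows "x \<in> topspace (realization K)"
proof -
  have "{v. x v \<noteq> 0} \<subseteq> S" using x(2) by auto
  moreover have "(\<Sum>v | x v \<noteq> 0. x v) = (\<Sum>v\<in>S. x v)"
    using x(2) S by (intro sum.mono_neutral_left) auto
  ultimately show ?thesis using assms by (auto simp: realization_def topspace_subtopology)
qed

lemma realization_memD:
  assumes "x \<in> topspace (realization K)"
  shows "0 \<le> x v" "{v. x v \<noteq> 0} \<in> K" "(\<Sum>v | x v \<noteq> 0. x v) = 1" "finite {v. x v \<noteq> 0}" "x v \<noteq> 0 \<Longrightarrow> v \<in> \<Union>K"
    "\<exists>v. x v > 0"
proof -
  show 1: "0 \<le> x v" "{v. x v \<noteq> 0} \<in> K" "(\<Sum>v | x v \<noteq> 0. x v) = 1" for v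
    using assms by (auto simp: realization_def topspace_subtopology)
  then show fin: "finite {v. x v \<noteq> 0}" using sum.infinite by fastforce
  show "x v \<noteq> 0 \<Longrightarrow> v \<in> \<Union>K" using 1(2) by blast
  have "{v. x v \<noteq> 0} \<noteq> {}" using 1(3) by (metis sum.empty zero_neq_one)
  then show "\<exists>v. x v > 0" using 1(1) by (metis (mono_tags, lifting) empty_Collect_eq less_eq_real_def)
qed

lemma continuous_map_realization_component:
  "continuous_map (realization K) euclideanreal (\<lambda>x. x v)"
  unfolding realization_def by (intro continuous_map_from_subtopology continuous_map_product_projection) simp

lemma continuous_map_into_realization:
  "continuous_map X (realization K) f \<longleftrightarrow>
    (\<forall>v. continuous_map X euclideanreal (\<lambda>x. f x v)) \<and> f \<in> topspace X \<rightarrow> topspace (realization K)"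
  by (auto simp: realization_def continuous_map_in_subtopology continuous_map_componentwise_UNIV topspace_subtopology)

lemma Hausdorff_realization: "Hausdorff_space (realization K)"
  unfolding realization_def by (intro Hausdorff_space_subtopology) (simp add: Hausdorff_space_product_topology)

section \<open>Group actions on realizations of simplicial complexes\<close>

locale simplicial_action =
  fixes G :: "('g, 'm) monoid_scheme" and K :: "'v set set" and a :: "'g \<Rightarrow> 'v \<Rightarrow> 'v"
  assumes G: "group G"
    and K_fin: "\<And>S. S \<in> K \<Longrightarrow> finite S"
    and K_mono: "\<And>S R. S \<in> K \<Longrightarrow> R \<subseteq> S \<Longrightarrow> R \<in> K"
    and a_K: "\<And>g S. g \<in> carrier G \<Longrightarrow> S \<in> K \<Longrightarrow> a g ` S \<in> K"
    and a_one: "\<And>v. v \<in> \<Union>K \<Longrightarrow> a \<one>\<^bsub>G\<^esub> v = v"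
    and a_mult: "\<And>g h v. g \<in> carrier G \<Longrightarrow> h \<in> carrier G \<Longrightarrow> v \<in> \<Union>K \<Longrightarrow> a (g \<otimes>\<^bsub>G\<^esub> h) v = a g (a h v)"
begin

interpretation group G by (rule G)

lemma a_in: "g \<in> carrier G \<Longrightarrow> v \<in> \<Union>K \<Longrightarrow> a g v \<in> \<Union>K"
  using a_K by blast

lemma a_inv: "g \<in> carrier G \<Longrightarrow> v \<in> \<Union>K \<Longrightarrow> a (inv\<^bsub>G\<^esub> g) (a g v) = v"
  "g \<in> carrier G \<Longrightarrow> v \<in> \<Union>K \<Longrightarrow> a g (a (inv\<^bsub>G\<^esub> g) v) = v"
  by (simp_all add: a_one flip: a_mult)

abbreviation act where "act \<equiv> realization_action G K a"

lemma act_apply: "x \<in> topspace (realization K) \<Longrightarrow> act g x v = (if v \<in> \<Union>K then x (a (inv\<^bsub>G\<^esub> g) v) else 0)"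
  by (simp add: realization_action_def)

lemma act_apply_image:
  "x \<in> topspace (realization K) \<Longrightarrow> g \<in> carrier G \<Longrightarrow> v \<in> \<Union>K \<Longrightarrow> act g x (a g v) = x v"
  by (simp add: act_apply a_in a_inv del: Union_iff)

lemma act_in:
  assumes x: "x \<in> topspace (realization K)" and g: "g \<in> carrier G"
  shows "act g x \<in> topspace (realization K)"
proof (rule realization_memI [OF K_mono a_K [OF g realization_memD(2) [OF x]]])
  let ?S = "{v. x v \<noteq> 0}"
  have S: "?S \<subseteq> \<Union>K" using realization_memD(2) [OF x] by blast
  show "finite (a g ` ?S)" using realization_memD(4) [OF x] by simp
  show "0 \<le> act g x v" for v using realization_memD(1) [OF x] x by (simp add: act_apply)
  show "act g x v = 0" if "v \<notin> a g ` ?S" for v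
  proof (rule ccontr)
    assume "act g x v \<noteq> 0"
    then have "v \<in> \<Union>K" "x (a (inv\<^bsub>G\<^esub> g) v) \<noteq> 0" using x by (auto simp: act_apply split: if_splits)
    then show False using that a_inv(2) [OF g] by (metis (mono_tags, lifting) imageI mem_Collect_eq)
  qed
  have "inj_on (a g) ?S" using a_inv(1) [OF g] S by (metis inj_on_inverseI subsetD)
  then have "(\<Sum>v\<in>a g ` ?S. act g x v) = (\<Sum>v\<in>?S. act g x (a g v))" by (simp add: sum.reindex)
  also have "\<dots> = (\<Sum>v\<in>?S. x v)"
    by (rule sum.cong [OF refl], rule act_apply_image [OF x g subsetD [OF S]])
  finally show "(\<Sum>v\<in>a g ` ?S. act g x v) = 1" using realization_memD(3) [OF x] by simp
qed

lemma act_continuous: "g \<in> carrier G \<Longrightarrow> continuous_map (realization K) (realization K) (act g)"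
  unfolding continuous_map_into_realization
proof (intro conjI allI)
  fix v assume g: "g \<in> carrier G"
  have "continuous_map (realization K) euclideanreal (\<lambda>x. if v \<in> \<Union>K then x (a (inv\<^bsub>G\<^esub> g) v) else 0)"
    by (auto simp: continuous_map_realization_component)
  then show "continuous_map (realization K) euclideanreal (\<lambda>x. act g x v)"
    by (rule continuous_map_eq) (simp add: act_apply)
qed (use act_in in auto)

lemma act_one: "x \<in> topspace (realization K) \<Longrightarrow> act \<one>\<^bsub>G\<^esub> x = x"
  using realization_memD(5) [of x K] by (auto simp: act_apply a_one fun_eq_iff simp del: Union_iff)

lemma act_mult:
  assumes "x \<in> topspace (realization K)" "g \<in> carrier G" "h \<in> carrier G"
  shows "act (g \<otimes>\<^bsub>G\<^esub> h) x = act g (act h x)"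
proof
  fix v
  show "act (g \<otimes>\<^bsub>G\<^esub> h) x v = act g (act h x) v"
  proof (cases "v \<in> \<Union>K")
    case True
    have "a (inv\<^bsub>G\<^esub> (g \<otimes>\<^bsub>G\<^esub> h)) v = a (inv\<^bsub>G\<^esub> h) (a (inv\<^bsub>G\<^esub> g) v)"
      using a_mult [of "inv\<^bsub>G\<^esub> h" "inv\<^bsub>G\<^esub> g" v] True assms by (simp add: inv_mult_group)
    then show ?thesis using True assms a_in [of "inv\<^bsub>G\<^esub> g" v] by (simp add: act_apply act_in del: Union_iff)
  next
    case False
    then show ?thesis using assms by (simp add: act_apply act_in del: Union_iff)
  qed
qed

end

subsection \<open>Affine simplices\<close>

text \<open>Vertices may repeat in \<open>l\<close>; the barycentric weights of equal entries are
  added, which collapses the simplex accordingly.\<close>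

definition affine_simplex :: "nat \<Rightarrow> 'v list \<Rightarrow> (nat \<Rightarrow> real) \<Rightarrow> ('v \<Rightarrow> real)" where
  "affine_simplex n l = (\<lambda>x\<in>standard_simplex n. \<lambda>v. \<Sum>i\<le>n. if l ! i = v then x i else 0)"

lemma singular_simplex_affine:
  assumes K: "\<And>S R. S \<in> K \<Longrightarrow> R \<subseteq> S \<Longrightarrow> R \<in> K" and l: "set l \<in> K" "length l = Suc n"
  shows "singular_simplex n (realization K) (affine_simplex n l)"
  unfolding singular_simplex_def continuous_map_into_realization
proof (intro conjI allI)
  let ?T = "subtopology (powertop_real UNIV) (standard_simplex n)"
  have top: "topspace ?T = standard_simplex n" by (simp add: topspace_standard_simplex)
  show "affine_simplex n l \<in> extensional (standard_simplex n)" by (simp add: affine_simplex_def)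
  fix v
  have "continuous_map ?T euclideanreal (\<lambda>x. if l ! i = v then x i else 0)" for i
    by (auto intro!: continuous_map_from_subtopology continuous_map_product_projection)
  then have "continuous_map ?T euclideanreal (\<lambda>x. \<Sum>i\<le>n. if l ! i = v then x i else 0)"
    by (intro continuous_map_sum) auto
  then show "continuous_map ?T euclideanreal (\<lambda>x. affine_simplex n l x v)"
    by (rule continuous_map_eq) (simp add: top affine_simplex_def)
next
  show "affine_simplex n l \<in> topspace (subtopology (powertop_real UNIV) (standard_simplex n)) \<rightarrow> topspace (realization K)"
    unfolding topspace_standard_simplex
  proof
    fix x assume x: "x \<in> standard_simplex n"
    have nth: "l ! i \<in> set l" if "i \<le> n" for i using l(2) that by (intro nth_mem) simp
    show "affine_simplex n l x \<in> topspace (realization K)"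
    proof (rule realization_memI [OF K l(1)])
      show "0 \<le> affine_simplex n l x v" for v
        using x by (auto simp: affine_simplex_def standard_simplex_def intro!: sum_nonneg)
      show "affine_simplex n l x v = 0" if "v \<notin> set l" for v
        using x nth that by (auto simp: affine_simplex_def intro!: sum.neutral)
      have "(\<Sum>v\<in>set l. affine_simplex n l x v) = (\<Sum>i\<le>n. \<Sum>v\<in>set l. if l ! i = v then x i else 0)"
        using x by (simp add: affine_simplex_def sum.swap [of _ "{..n}"])
      also have "\<dots> = (\<Sum>i\<le>n. x i)"
        using nth by (intro sum.cong) auto
      finally show "(\<Sum>v\<in>set l. affine_simplex n l x v) = 1" using x by (simp add: standard_simplex_def)
    qed auto
  qed
qed

lemma singular_face_affine:
  assumes "length l = Suc (Suc n)" "k \<le> Suc n"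
  shows "singular_face (Suc n) k (affine_simplex (Suc n) l) = affine_simplex n (take k l @ drop (Suc k) l)"
proof (rule extensionalityI [of _ "standard_simplex n"])
  let ?m = "take k l @ drop (Suc k) l"
  fix x assume x: "x \<in> standard_simplex n"
  have lm: "?m ! i = (if i < k then l ! i else l ! Suc i)" if "i \<le> n" for i
    using assms that by (auto simp: nth_append)
  have aux: "\<not> i - Suc 0 < k \<and> Suc (i - Suc 0) = i" if "\<not> i < k" "i \<noteq> k" for i using that by linarith
  have "(\<Sum>i\<le>Suc n. if l ! i = v then simplical_face k x i else 0) = (\<Sum>i\<le>n. if ?m ! i = v then x i else 0)" for v
  proof -
    have aux: "\<not> i - Suc 0 < k \<and> Suc (i - Suc 0) = i" if "\<not> i < k" "i \<noteq> k" for i using that by linarith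
  have "(\<Sum>i\<le>Suc n. if l ! i = v then simplical_face k x i else 0)
        = (\<Sum>i\<in>{..Suc n} - {k}. if l ! i = v then simplical_face k x i else 0)"
      by (rule sum.mono_neutral_right) (auto simp: simplical_face_def)
    also have "\<dots> = (\<Sum>i\<le>n. if ?m ! i = v then x i else 0)"
      by (intro sum.reindex_bij_witness [where i = "\<lambda>i. if i < k then i else Suc i" and j = "\<lambda>i. if i < k then i else i - 1"])
        (use assms lm aux in \<open>auto simp: simplical_face_def\<close>)
    finally show ?thesis .
  qed
  then show "singular_face (Suc n) k (affine_simplex (Suc n) l) x = affine_simplex n ?m x"
    using x simplical_face_in_standard_simplex [of "Suc n" k x] assms by (simp add: singular_face_def affine_simplex_def)
qed (auto simp: singular_face_def affine_simplex_def)

lemma chain_boundary_affine: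
  assumes "length l = Suc (Suc n)"
  shows "chain_boundary (Suc n) (frag_of (affine_simplex (Suc n) l)) =
    frag_extend (\<lambda>l. frag_of (affine_simplex n l)) (list_boundary l)"
proof -
  have "chain_boundary (Suc n) (frag_of (affine_simplex (Suc n) l)) =
      (\<Sum>k\<le>Suc n. frag_cmul ((-1) ^ k) (frag_of (affine_simplex n (take k l @ drop (Suc k) l))))"
    unfolding chain_boundary_of using singular_face_affine [OF assms] by (auto intro: sum.cong)
  then show ?thesis
    unfolding list_boundary_sum assms
    by (simp add: frag_extend_sum frag_extend_cmul o_def lessThan_Suc_atMost del: sum.atMost_Suc)
qed

lemma (in simplicial_action) simplex_map_affine:
  assumes g: "g \<in> carrier G" and l: "set l \<in> K" "length l = Suc n"
  shows "simplex_map n (act g) (affine_simplex n l) = affine_simplex n (map (a g) l)"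
proof (rule extensionalityI [of _ "standard_simplex n"])
  fix x assume x: "x \<in> standard_simplex n"
  have "singular_simplex n (realization K) (affine_simplex n l)"
    by (rule singular_simplex_affine [OF _ l]) (rule K_mono)
  then have "affine_simplex n l \<in> standard_simplex n \<rightarrow> topspace (realization K)"
    by (simp add: singular_simplex_def continuous_map_into_realization topspace_standard_simplex)
  then have mem: "affine_simplex n l x \<in> topspace (realization K)" using x by blast
  have nth: "l ! i \<in> \<Union>K" if "i \<le> n" for i
    by (rule UnionI [OF l(1) nth_mem]) (use l that in simp)
  have "act g (affine_simplex n l x) v = (\<Sum>i\<le>n. if map (a g) l ! i = v then x i else 0)" for v
  proof (cases "v \<in> \<Union>K")
    case True
    have "(l ! i = a (inv\<^bsub>G\<^esub> g) v) = (map (a g) l ! i = v)" if "i \<le> n" for i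
      using a_inv [OF g nth [OF that]] a_inv [OF g True] l that by auto
    note * = this
    have "act g (affine_simplex n l x) v = affine_simplex n l x (a (inv\<^bsub>G\<^esub> g) v)"
      using True by (simp add: act_apply [OF mem] del: Union_iff)
    also have "\<dots> = (\<Sum>i\<le>n. if l ! i = a (inv\<^bsub>G\<^esub> g) v then x i else 0)"
      using x by (simp add: affine_simplex_def)
    also have "\<dots> = (\<Sum>i\<le>n. if map (a g) l ! i = v then x i else 0)"
      by (rule sum.cong [OF refl]) (use * in simp)
    finally show ?thesis .
  next
    case False
    have "map (a g) l ! i \<noteq> v" if "i \<le> n" for i
      using a_in [OF g nth [OF that]] False l that by auto
    then show ?thesis using False by (auto simp: act_apply [OF mem])
  qed
  then show "simplex_map n (act g) (affine_simplex n l) x = affine_simplex n (map (a g) l) x"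
    using x by (simp add: simplex_map_def affine_simplex_def fun_eq_iff)
qed (auto simp: simplex_map_def affine_simplex_def)

subsection \<open>The total space EG\<close>

lemma simplicial_action_EG:
  assumes "group G"
  shows "simplicial_action G (join_complex G) (\<lambda>g (i, h). (i, g \<otimes>\<^bsub>G\<^esub> h))"
proof -
  interpret group G by fact
  show ?thesis
  proof
    fix g S assume g: "g \<in> carrier G" and S: "S \<in> join_complex G"
    have "inj_on fst ((\<lambda>(i, h). (i, g \<otimes>\<^bsub>G\<^esub> h)) ` S)"
    proof (rule inj_onI)
      fix x y assume "x \<in> (\<lambda>(i, h). (i, g \<otimes>\<^bsub>G\<^esub> h)) ` S" "y \<in> (\<lambda>(i, h). (i, g \<otimes>\<^bsub>G\<^esub> h)) ` S" and eq: "fst x = fst y"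
      then obtain i h i' h' where *: "(i, h) \<in> S" "x = (i, g \<otimes>\<^bsub>G\<^esub> h)" "(i', h') \<in> S" "y = (i', g \<otimes>\<^bsub>G\<^esub> h')" by auto
      have "inj_on fst S" using S by (simp add: join_complex_def)
      from inj_onD [OF this _ *(1,3)] show "x = y" using eq * by simp
    qed
    then show "(\<lambda>(i, h). (i, g \<otimes>\<^bsub>G\<^esub> h)) ` S \<in> join_complex G"
      using S g by (auto simp: join_complex_def)
  next
    fix S R assume "S \<in> join_complex G" "R \<subseteq> S"
    then show "R \<in> join_complex G" unfolding join_complex_def
      by (auto intro: finite_subset inj_on_subset)
  qed (auto simp: join_complex_def m_assoc)
qed

lemma Union_join_complex: "\<Union>(join_complex G) = UNIV \<times> carrier G"
proof -
  have "{(i, h)} \<in> join_complex G" if "h \<in> carrier G" for i h using that by (auto simp: join_complex_def)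
  then show ?thesis by (auto simp: join_complex_def)
qed

text \<open>The fraction of the weight in column \<open>k\<close> that has not yet been moved to column \<open>k + 1\<close> at time
  \<open>t\<close>: the move takes place between the times \<open>1/(k+2)\<close> and \<open>1/(k+1)\<close>, so that column \<open>k + 1\<close> is
  vacated before column \<open>k\<close> is moved.\<close>

definition shift_frac :: "nat \<Rightarrow> real \<Rightarrow> real" where
  "shift_frac k t = max 0 (min 1 ((real k + 2) * (1 - t * (real k + 1))))"

lemma shift_frac_bounds: "0 \<le> shift_frac k t" "shift_frac k t \<le> 1"
  by (auto simp: shift_frac_def)

lemma shift_frac_0: "shift_frac k 0 = 1"
  by (simp add: shift_frac_def)

lemma shift_frac_1: "shift_frac k 1 = 0"
proof -
  have "(real k + 2) * (1 - 1 * (real k + 1)) \<le> 0" by (intro mult_nonneg_nonpos) auto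
  then show ?thesis unfolding shift_frac_def by linarith
qed

lemma shift_frac_pos: "shift_frac k t \<noteq> 0 \<Longrightarrow> t * (real k + 1) < 1"
proof (rule ccontr)
  assume "shift_frac k t \<noteq> 0" "\<not> t * (real k + 1) < 1"
  then have "(real k + 2) * (1 - t * (real k + 1)) \<le> 0" by (intro mult_nonneg_nonpos) auto
  then show False using \<open>shift_frac k t \<noteq> 0\<close> unfolding shift_frac_def by linarith
qed

lemma shift_frac_less_1: "shift_frac k t \<noteq> 1 \<Longrightarrow> 1 < t * (real k + 2)"
proof (rule ccontr)
  assume "shift_frac k t \<noteq> 1" and t: "\<not> 1 < t * (real k + 2)"
  have "(real k + 1) * (t * (real k + 2)) \<le> (real k + 1) * 1"
    using t by (intro mult_left_mono) auto
  then have "(real k + 2) * (1 - t * (real k + 1)) \<ge> 1" by (simp add: algebra_simps)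
  then show False using \<open>shift_frac k t \<noteq> 1\<close> unfolding shift_frac_def by linarith
qed

definition shift_homotopy :: "real \<Rightarrow> (nat \<times> 'g \<Rightarrow> real) \<Rightarrow> (nat \<times> 'g \<Rightarrow> real)" where
  "shift_homotopy t e = (\<lambda>(j, g). shift_frac j t * e (j, g) +
     (if j = 0 then 0 else (1 - shift_frac (j - 1) t) * e (j - 1, g)))"

lemma join_complex_mono: "S \<in> join_complex G \<Longrightarrow> R \<subseteq> S \<Longrightarrow> R \<in> join_complex G"
  unfolding join_complex_def by (auto intro: finite_subset inj_on_subset)

text \<open>The point is that each column keeps at most one nonzero entry. In column
  \<open>j\<close> something remains only while \<open>t * (j + 1) < 1\<close> and something arrives
  only when \<open>1 < t * (j + 1)\<close>; the timing of \<open>shift_frac\<close> makes these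
  exclusive.\<close>

lemma shift_homotopy_in:
  assumes e: "e \<in> topspace (EG G)"
  shows "shift_homotopy t e \<in> topspace (EG G)"
proof -
  let ?E = "{v. e v \<noteq> 0}"
  let ?S1 = "{(j, g). e (j, g) \<noteq> 0 \<and> t * (real j + 1) < 1}"
  let ?S2 = "(\<lambda>(j, g). (Suc j, g)) ` {(j, g). e (j, g) \<noteq> 0 \<and> 1 < t * (real j + 2)}"
  note e' = realization_memD [OF e [unfolded EG_def]]
  have E: "?E \<in> join_complex G" by (rule e')
  then have inj: "g = g'" if "e (j, g) \<noteq> 0" "e (j, g') \<noteq> 0" for j g g'
    using that inj_onD [of fst ?E "(j, g)" "(j, g')"] by (simp add: join_complex_def)
  have fin1: "finite ?S1" using finite_subset [OF _ e'(4), of ?S1] by auto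
  have fin2: "finite ?S2" by (intro finite_imageI finite_subset [OF _ e'(4)]) auto
  have SK: "?S1 \<union> ?S2 \<in> join_complex G"
    unfolding join_complex_def mem_Collect_eq
  proof (intro conjI inj_onI)
    show "finite (?S1 \<union> ?S2)" using fin1 fin2 by simp
    have "g \<in> carrier G" if "e (j, g) \<noteq> 0" for j g using that E by (auto simp: join_complex_def)
    then show "?S1 \<union> ?S2 \<subseteq> UNIV \<times> carrier G" by auto
    fix x y assume "x \<in> ?S1 \<union> ?S2" "y \<in> ?S1 \<union> ?S2" "fst x = fst y"
    then show "x = y" by (auto simp: inj algebra_simps)
  qed
  show ?thesis
    unfolding EG_def
  proof (rule realization_memI [where S = "?S1 \<union> ?S2"])
    show "R \<in> join_complex G" if "S \<in> join_complex G" "R \<subseteq> S" for S R :: "(nat \<times> 'a) set"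
      using that by (rule join_complex_mono)
    show zero: "shift_homotopy t e v = 0" if v: "v \<notin> ?S1 \<union> ?S2" for v
    proof -
      obtain j g where jg: "v = (j, g)" by fastforce
      have "shift_frac j t * e (j, g) = 0" using v jg shift_frac_pos [of j t] by auto
      moreover have "(1 - shift_frac (j - 1) t) * e (j - 1, g) = 0" if "j \<noteq> 0"
      proof (rule ccontr)
        assume "(1 - shift_frac (j - 1) t) * e (j - 1, g) \<noteq> 0"
        then have "e (j - 1, g) \<noteq> 0 \<and> 1 < t * (real (j - 1) + 2)" using shift_frac_less_1 [of "j - 1" t] by auto
        then have "(Suc (j - 1), g) \<in> ?S2" by force
        then show False using v jg that by simp
      qed
      ultimately show ?thesis by (cases "j = 0") (auto simp: shift_homotopy_def jg)
    qed
    show "0 \<le> shift_homotopy t e v" for v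
      using e'(1) shift_frac_bounds by (auto simp: shift_homotopy_def split: prod.splits)
    \<comment> \<open>A common index set for what stays and what arrives, so that the total weight
      splits into two sums.\<close>
    let ?F = "?E \<union> (\<lambda>(j, g). (Suc j, g)) ` ?E"
    have finF: "finite ?F" using e'(4) by simp
    let ?A = "\<lambda>v. shift_frac (fst v) t * e v"
    let ?B = "\<lambda>v. if fst v = 0 then 0 else (1 - shift_frac (fst v - 1) t) * e (fst v - 1, snd v)"
    have H: "shift_homotopy t e v = ?A v + ?B v" for v by (cases v) (simp add: shift_homotopy_def)
    have "(\<Sum>v\<in>?S1 \<union> ?S2. shift_homotopy t e v) = (\<Sum>v\<in>?F. shift_homotopy t e v)"
    proof (rule sum.mono_neutral_left [OF finF])
      show "?S1 \<union> ?S2 \<subseteq> ?F" by auto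
      show "\<forall>v\<in>?F - (?S1 \<union> ?S2). shift_homotopy t e v = 0" 
      proof
        fix v assume "v \<in> ?F - (?S1 \<union> ?S2)"
        then have "v \<notin> ?S1 \<union> ?S2" by (simp only: Diff_iff simp_thms)
        then show "shift_homotopy t e v = 0" by (rule zero)
      qed
    qed
    also have "\<dots> = (\<Sum>v\<in>?F. ?A v) + (\<Sum>v\<in>?F. ?B v)" unfolding H by (rule sum.distrib)
    also have "(\<Sum>v\<in>?F. ?A v) = (\<Sum>v\<in>?E. ?A v)" using finF by (intro sum.mono_neutral_right) auto
    also have "(\<Sum>v\<in>?F. ?B v) = (\<Sum>v\<in>(\<lambda>(j, g). (Suc j, g)) ` ?E. ?B v)"
    proof (rule sum.mono_neutral_right [OF finF])
      show "\<forall>v\<in>?F - (\<lambda>(j, g). (Suc j, g)) ` ?E. ?B v = 0"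
      proof
        fix v assume v: "v \<in> ?F - (\<lambda>(j, g). (Suc j, g)) ` ?E"
        show "?B v = 0"
        proof (rule ccontr)
          assume "?B v \<noteq> 0"
          then have "fst v \<noteq> 0" "e (fst v - 1, snd v) \<noteq> 0" by (auto split: if_splits)
          then have "v \<in> (\<lambda>(j, g). (Suc j, g)) ` ?E"
            by (intro image_eqI [of _ _ "(fst v - 1, snd v)"]) (auto simp: prod_eq_iff)
          then show False using v by blast
        qed
      qed
    qed auto
    also have "\<dots> = (\<Sum>v\<in>?E. (1 - shift_frac (fst v) t) * e v)"
      by (subst sum.reindex) (auto simp: inj_on_def case_prod_beta intro!: sum.cong)
    also have "(\<Sum>v\<in>?E. ?A v) + \<dots> = (\<Sum>v\<in>?E. e v)"
      by (simp add: sum.distrib [symmetric] algebra_simps)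
    finally show "(\<Sum>v\<in>?S1 \<union> ?S2. shift_homotopy t e v) = 1" using e'(3) by simp
    show "finite (?S1 \<union> ?S2)" using fin1 fin2 by simp
  qed (rule SK)
qed

text \<open>The first homotopy shifts every column by one. The second is the straight line to a
  vertex in the vacated column 0. Each coordinate involves at most two coordinates of the point,
  which gives continuity in the coordinatewise topology.\<close>

lemma contractible_EG:
  assumes "group G"
  shows "contractible_space (EG G)"
proof -
  interpret group G by fact
  let ?I = "top_of_set {0..1::real}"
  let ?P = "prod_topology ?I (EG G)"
  have fst_cont: "continuous_map ?P euclideanreal fst"
    using continuous_map_fst [of ?I "EG G"] by (simp add: continuous_map_in_subtopology)
  have snd_cont: "continuous_map ?P euclideanreal (\<lambda>z. snd z v)" for v
    using continuous_map_compose [OF continuous_map_snd [of ?I "EG G"] continuous_map_realization_component [of "join_complex G" v, folded EG_def]]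
    by (simp add: o_def)
  have frac_cont: "continuous_map ?P euclideanreal (\<lambda>z. shift_frac k (fst z))" for k
    unfolding shift_frac_def by (intro continuous_intros continuous_map_real_mult fst_cont) auto
  have 1: "homotopic_with (\<lambda>x. True) (EG G) (EG G) id (shift_homotopy 1)"
    unfolding homotopic_with_def
  proof (intro exI [of _ "\<lambda>z. shift_homotopy (fst z) (snd z)"] conjI allI ballI)
    have "continuous_map ?P euclideanreal (\<lambda>z. shift_homotopy (fst z) (snd z) (j, g))" for j g
    proof (cases j)
      case 0
      then show ?thesis using frac_cont snd_cont by (simp add: shift_homotopy_def continuous_map_real_mult)
    next
      case (Suc k)
      then show ?thesis
        by (simp add: shift_homotopy_def) (intro continuous_intros continuous_map_real_mult frac_cont snd_cont; simp)
    qed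
    then show "continuous_map ?P (EG G) (\<lambda>z. shift_homotopy (fst z) (snd z))"
      unfolding EG_def continuous_map_into_realization
      using shift_homotopy_in [of _ G] by (auto simp: EG_def)
  qed (auto simp: shift_homotopy_def shift_frac_0 fun_eq_iff)
  define b :: "nat \<times> 'a \<Rightarrow> real" where "b v = (if v = (0, \<one>\<^bsub>G\<^esub>) then 1 else 0)" for v
  have 2: "homotopic_with (\<lambda>x. True) (EG G) (EG G) (shift_homotopy 1) (\<lambda>x. b)"
    unfolding homotopic_with_def
  proof (intro exI [of _ "\<lambda>z v. (1 - fst z) * shift_homotopy 1 (snd z) v + fst z * b v"] conjI allI ballI)
    have s1: "shift_homotopy 1 e (j, g) = (if j = 0 then 0 else e (j - 1, g))" for e :: "nat \<times> 'a \<Rightarrow> real" and j g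
      by (simp add: shift_homotopy_def shift_frac_1)
    have "continuous_map ?P euclideanreal (\<lambda>z. shift_homotopy 1 (snd z) (j, g))" for j g
      unfolding s1 using snd_cont by auto
    then have cont: "continuous_map ?P euclideanreal (\<lambda>z. (1 - fst z) * shift_homotopy 1 (snd z) v + fst z * b v)" for v
      by (cases v) (intro continuous_intros continuous_map_real_mult fst_cont; simp)
    have "(\<lambda>v. (1 - t) * shift_homotopy 1 e v + t * b v) \<in> topspace (EG G)"
      if t: "0 \<le> t" "t \<le> 1" and e: "e \<in> topspace (EG G)" for t e
    proof -
      let ?y = "shift_homotopy 1 e"
      note y = realization_memD [OF shift_homotopy_in [OF e, of 1, unfolded EG_def]]
      let ?S = "insert (0, \<one>\<^bsub>G\<^esub>) {v. ?y v \<noteq> 0}"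
      \<comment> \<open>Column 0 is empty after the shift, so its vertex can be joined to the
        support.\<close>
      have y0: "?y (0, g) = 0" for g by (simp add: s1)
      have SK: "?S \<in> join_complex G"
        using y(2) y0 unfolding join_complex_def by (auto simp: inj_on_def) 
      show ?thesis
        unfolding EG_def
      proof (rule realization_memI [where S = ?S])
        show "R \<in> join_complex G" if "S \<in> join_complex G" "R \<subseteq> S" for S R :: "(nat \<times> 'a) set"
          using that by (rule join_complex_mono)
        show "0 \<le> (1 - t) * ?y v + t * b v" for v using t y(1) [of v] by (simp add: b_def)
        have "(\<Sum>v\<in>?S. ?y v) = (\<Sum>v | ?y v \<noteq> 0. ?y v)"
          using y(4) by (intro sum.mono_neutral_right) auto
        then have "(\<Sum>v\<in>?S. ?y v) = 1" using y(3) by simp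
        moreover have "(\<Sum>v\<in>?S. b v) = 1" using y(4) by (simp add: b_def)
        ultimately show "(\<Sum>v\<in>?S. (1 - t) * ?y v + t * b v) = 1"
          by (simp add: sum.distrib sum_distrib_left [symmetric] del: sum.insert)
        show "finite ?S" using y(4) by simp
      qed (auto simp: b_def intro: SK)
    qed
    then show "continuous_map ?P (EG G) (\<lambda>z v. (1 - fst z) * shift_homotopy 1 (snd z) v + fst z * b v)"
      unfolding EG_def continuous_map_into_realization using cont by (auto simp: EG_def)
  qed auto
  show ?thesis unfolding contractible_space_def using homotopic_with_trans [OF 1 2] by blast
qed

section \<open>The cyclic group and its actions\<close>

definition rot :: "nat \<Rightarrow> nat \<Rightarrow> nat" where "rot p = cycle_of_list [1..<Suc p]"

lemma set_rot: "set [1..<Suc p] = {1..p}"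
  by (simp only: set_upt atLeastLessThanSuc_atLeastAtMost)

lemma rot_permutes: "rot p permutes {1..p}"
  using cycle_permutes [of "[1..<Suc p]"] unfolding rot_def set_rot .

lemma rot_order: "rot p ^^ p = id"
  using cycle_is_id_root [OF distinct_upt, of 1 "Suc p"] unfolding rot_def by (simp only: length_upt diff_Suc_1)

text \<open>\<open>Suc\<close> translates residues into points of \<open>{1..p}\<close>; powers of
  \<open>rot p\<close> then become addition modulo \<open>p\<close>.\<close>

lemma rot_nth: assumes "i < p" shows "(rot p ^^ n) (Suc i) = Suc ((i + n) mod p)"
proof -
  have len: "length [1..<Suc p] = p" by (simp only: length_upt diff_Suc_1)
  have nth: "[1..<Suc p] ! j = Suc j" if "j < p" for j
    using nth_upt [of 1 j "Suc p"] that by (simp only: plus_1_eq_Suc Suc_less_eq)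
  have "map (rot p ^^ n) [1..<Suc p] ! i = rotate n [1..<Suc p] ! i"
    unfolding rot_def by (simp only: cyclic_rotation [OF distinct_upt])
  then show ?thesis
    using assms by (simp only: nth_map nth_rotate len nth mod_less_divisor add.commute)
qed

lemma rot_neq: assumes "p \<ge> 2" "j \<in> {1..p}" shows "rot p j \<noteq> j"
proof -
  obtain i where i: "j = Suc i" "i < p" using assms by (cases j) auto
  have "rot p (Suc i) = Suc ((i + 1) mod p)" using rot_nth [OF i(2), of 1] by simp
  moreover have "(i + 1) mod p \<noteq> i" using i assms by (cases "i + 1 = p") auto
  ultimately show ?thesis using i by simp
qed

lemma rot_transitive:
  assumes "j \<in> {1..p}" "k \<in> {1..p}" shows "\<exists>n. (rot p ^^ n) j = k"
proof -
  obtain i i' where i: "j = Suc i" "i < p" "k = Suc i'" "i' < p" using assms by (cases j; cases k) auto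
  have "(i + (p - i + i')) mod p = i'" using i by simp
  then show ?thesis using rot_nth [OF i(2), of "p - i + i'"] i by auto
qed

abbreviation Cp where "Cp \<equiv> cyclic_perm_group"

lemma rot_pow_sym: "rot p ^^ i \<in> carrier (sym_group p)"
  unfolding sym_group_carrier
proof (induction i)
  case 0
  show ?case using permutes_id by (simp add: id_def)
next
  case (Suc i)
  then show ?case unfolding funpow.simps by (rule permutes_compose [OF _ rot_permutes])
qed

lemma group_Cp: "group (Cp p)"
  unfolding cyclic_perm_group_def by (rule group.group_subgroup_generated [OF sym_group_is_group])

lemma mult_Cp: "g \<otimes>\<^bsub>Cp p\<^esub> h = g \<circ> h"
  by (simp add: cyclic_perm_group_def sym_group_mult)

lemma one_Cp: "\<one>\<^bsub>Cp p\<^esub> = id"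
  by (simp add: cyclic_perm_group_def sym_group_one)

lemma carrier_Cp: assumes "p > 0" shows "carrier (Cp p) = range (\<lambda>i. rot p ^^ i)"
proof -
  have gen: "carrier (Cp p) = generate (sym_group p) {rot p}"
    using rot_pow_sym [where p = p and i = 1] by (simp add: cyclic_perm_group_def carrier_subgroup_generated rot_def Int_absorb1)
  show ?thesis
    unfolding gen
  proof (intro equalityI subsetI)
    fix g assume "g \<in> generate (sym_group p) {rot p}"
    then show "g \<in> range (\<lambda>i. rot p ^^ i)"
    proof (induction rule: generate.induct)
      case one
      show ?case unfolding sym_group_one by (rule range_eqI [of _ _ 0]) simp
    next
      case (incl h)
      then show ?case by (intro range_eqI [of _ _ 1]) simp
    next
      case (inv h)
      \<comment> \<open>Finite order makes the inverse of the generator a power of it.\<close>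
      have "rot p ^^ (p - 1) \<circ> rot p = id"
        using rot_order [of p] assms funpow_add [of "p - 1" 1 "rot p"] by simp
      then have "inv\<^bsub>sym_group p\<^esub> (rot p) = rot p ^^ (p - 1)"
        using rot_permutes [of p] rot_pow_sym [where p = p and i = "p - 1"]
        by (intro group.inv_equality [OF sym_group_is_group]) (simp_all only: sym_group_mult sym_group_one sym_group_carrier)
      then show ?case using inv by auto
    next
      case (eng h1 h2)
      then obtain i j where "h1 = rot p ^^ i" "h2 = rot p ^^ j" by auto
      then show ?case using funpow_add [of i j "rot p"] by (intro range_eqI [of _ _ "i + j"]) (simp add: sym_group_mult)
    qed
  next
    fix g assume "g \<in> range (\<lambda>i. rot p ^^ i)"
    then obtain i where "g = rot p ^^ i" by blast
    moreover have "rot p ^^ i \<in> generate (sym_group p) {rot p}"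
    proof (induction i)
      case 0
      show ?case using generate.one [of "sym_group p" "{rot p}"] by (simp add: sym_group_one id_def)
    next
      case (Suc i)
      have "rot p \<in> generate (sym_group p) {rot p}" by (rule generate.incl) simp
      then show ?case using generate.eng [OF _ Suc, of "rot p"] by (simp only: sym_group_mult funpow.simps)
    qed
    ultimately show "g \<in> generate (sym_group p) {rot p}" by simp
  qed
qed

lemma rot_pow_in: "p > 0 \<Longrightarrow> rot p ^^ i \<in> carrier (Cp p)"
  by (simp add: carrier_Cp)

lemma rot_in: "p > 0 \<Longrightarrow> rot p \<in> carrier (Cp p)"
  using rot_pow_in [of p 1] by simp

lemma Cp_permutes: "p > 0 \<Longrightarrow> g \<in> carrier (Cp p) \<Longrightarrow> g permutes {1..p}"
  using rot_pow_sym by (auto simp: carrier_Cp sym_group_carrier)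

text \<open>The action in terms of its generator: orbits become sets of iterates of one continuous
  map, the form that \<open>Zp_space\<close> asks for.\<close>

definition cyclic_action :: "nat \<Rightarrow> 'a topology \<Rightarrow> ((nat \<Rightarrow> nat) \<Rightarrow> 'a \<Rightarrow> 'a) \<Rightarrow> bool" where
  "cyclic_action p X \<phi> \<longleftrightarrow> continuous_map X X (\<phi> (rot p)) \<and>
     (\<forall>x\<in>topspace X. \<forall>i. \<phi> (rot p ^^ i) x = (\<phi> (rot p) ^^ i) x)"

lemma cyclic_actionI:
  assumes "p > 0" "continuous_map X X (\<phi> (rot p))"
    and one: "\<And>x. x \<in> topspace X \<Longrightarrow> \<phi> id x = x"
    and mult: "\<And>x g h. x \<in> topspace X \<Longrightarrow> g \<in> carrier (Cp p) \<Longrightarrow> h \<in> carrier (Cp p) \<Longrightarrow> \<phi> (g \<circ> h) x = \<phi> g (\<phi> h x)"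
  shows "cyclic_action p X \<phi>"
  unfolding cyclic_action_def
proof (intro conjI ballI allI)
  fix x i assume x: "x \<in> topspace X"
  show "\<phi> (rot p ^^ i) x = (\<phi> (rot p) ^^ i) x"
  proof (induction i)
    case 0
    show ?case using one [OF x] by (simp add: id_def)
  next
    case (Suc i)
    have "\<phi> (rot p ^^ Suc i) x = \<phi> (rot p) (\<phi> (rot p ^^ i) x)"
      using mult [OF x rot_in rot_pow_in] assms(1) unfolding funpow.simps by blast
    then show ?case using Suc by (metis comp_apply funpow.simps(2))
  qed
qed fact

lemma cyclic_action_orbit:
  assumes "cyclic_action p X \<phi>" "x \<in> topspace X" "p > 0"
  shows "orbit (Cp p) \<phi> x = range (\<lambda>i. (\<phi> (rot p) ^^ i) x)"
proof -
  have "orbit (Cp p) \<phi> x = range (\<lambda>i. \<phi> (rot p ^^ i) x)"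
    unfolding orbit_def carrier_Cp [OF assms(3)] by auto
  then show ?thesis using assms by (simp add: cyclic_action_def)
qed

lemma Zp_space_orbit:
  assumes p: "prime p" and act: "cyclic_action p Y \<phi>" and H: "Hausdorff_space Y"
    and free: "\<And>y. y \<in> topspace Y \<Longrightarrow> \<phi> (rot p) y \<noteq> y"
  shows "Zp_space p Y (\<phi> (rot p)) (orbit_space (Cp p) Y \<phi>) (orbit (Cp p) \<phi>)"
proof -
  let ?s = "\<phi> (rot p)" and ?q = "orbit (Cp p) \<phi>"
  have p0: "p > 0" using p prime_gt_0_nat by blast
  have cont: "continuous_map Y Y ?s" using act by (simp add: cyclic_action_def)
  have cont_pow: "continuous_map Y Y (?s ^^ i)" for i
    by (induction i) (auto intro: continuous_map_compose [OF _ cont] simp del: comp_apply simp: id_def)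
  have s_in: "(?s ^^ i) y \<in> topspace Y" if "y \<in> topspace Y" for y i
    using continuous_map_image_subset_topspace [OF cont_pow [of i]] that by auto
  have pow: "\<phi> (rot p ^^ i) y = (?s ^^ i) y" if "y \<in> topspace Y" for y i
    using act that by (simp add: cyclic_action_def)
  have orb: "?q y = range (\<lambda>i. (?s ^^ i) y)" if "y \<in> topspace Y" for y
    by (rule cyclic_action_orbit [OF act that p0])
  have order: "(?s ^^ p) y = y" if y: "y \<in> topspace Y" for y
  proof -
    have "(?s ^^ p) y = \<phi> (rot p ^^ p) y" using pow [OF y] by simp
    also have "\<dots> = \<phi> (rot p ^^ 0) y" by (simp only: rot_order funpow_0 funpow.simps)
    also have "\<dots> = y" using pow [OF y, of 0] by simp
    finally show ?thesis .
  qed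
  have qs: "?q (?s y) = ?q y" if y: "y \<in> topspace Y" for y
  proof -
    have sy: "?s y \<in> topspace Y" using s_in [OF y, of 1] by simp
    have "(?s ^^ i) y \<in> range (\<lambda>i. (?s ^^ i) (?s y))" for i
    proof (cases i)
      case 0
      have "(?s ^^ p) y = (?s ^^ (p - 1)) (?s y)"
        using p0 funpow_add [of "p - 1" 1 ?s] by simp
      then show ?thesis using order [OF y] 0 by (metis funpow_0 rangeI)
    next
      case (Suc j)
      then show ?thesis by (intro range_eqI [of _ _ j]) (simp add: funpow_swap1)
    qed
    moreover have "(?s ^^ i) (?s y) \<in> range (\<lambda>i. (?s ^^ i) y)" for i
      by (rule range_eqI [of _ _ "Suc i"]) (simp add: funpow_swap1)
    ultimately show ?thesis unfolding orb [OF y] orb [OF sy] by blast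
  qed
  show ?thesis
  proof
    show "continuous_map Y (orbit_space (Cp p) Y \<phi>) ?q"
      by (rule quotient_imp_continuous_map [OF quotient_map_orbit])
    show "?q ` topspace Y = topspace (orbit_space (Cp p) Y \<phi>)"
      by (rule quotient_imp_surjective_map [OF quotient_map_orbit])
    show "open_map Y (orbit_space (Cp p) Y \<phi>) ?q"
      unfolding open_map_def
    proof (intro allI impI)
      fix U assume U: "openin Y U"
      then have UY: "U \<subseteq> topspace Y" by (rule openin_subset)
      \<comment> \<open>The saturation of an open set is a union of preimages under powers of the
        generator, hence open.\<close>
      have "{y \<in> topspace Y. ?q y \<in> ?q ` U} = (\<Union>i. {y \<in> topspace Y. (?s ^^ i) y \<in> U})"
      proof (intro equalityI subsetI)
        fix y assume "y \<in> {y \<in> topspace Y. ?q y \<in> ?q ` U}"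
        then obtain u where u: "y \<in> topspace Y" "u \<in> U" "?q y = ?q u" by auto
        have "u \<in> ?q u" using orb u UY by (metis (no_types, lifting) funpow_0 rangeI subsetD)
        then have "u \<in> range (\<lambda>i. (?s ^^ i) y)" using u(3) orb [OF u(1)] by simp
        then obtain i where "u = (?s ^^ i) y" by blast
        then show "y \<in> (\<Union>i. {y \<in> topspace Y. (?s ^^ i) y \<in> U})" using u by auto
      next
        fix y assume "y \<in> (\<Union>i. {y \<in> topspace Y. (?s ^^ i) y \<in> U})"
        then obtain i where y: "y \<in> topspace Y" "(?s ^^ i) y \<in> U" by auto
        have "?q ((?s ^^ i) y) = ?q y"
          by (induction i) (use qs s_in y in auto)
        then have "?q y \<in> ?q ` U" using y(2) by (metis imageI)
        then show "y \<in> {y \<in> topspace Y. ?q y \<in> ?q ` U}" using y(1) by simp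
      qed
      moreover have "openin Y (\<Union>i. {y \<in> topspace Y. (?s ^^ i) y \<in> U})"
        using openin_continuous_map_preimage [OF cont_pow U] by blast
      ultimately show "openin (orbit_space (Cp p) Y \<phi>) (?q ` U)"
        unfolding openin_orbit_space using UY by (auto simp: orbits_def)
    qed
    fix y y' assume "y \<in> topspace Y" "y' \<in> topspace Y" "?q y = ?q y'"
    then show "\<exists>i. y' = (?s ^^ i) y"
      using orb [of y] orb [of y'] by (metis (no_types, lifting) funpow_0 imageE rangeI)
  qed (use p cont order free H qs in auto)
qed


lemma cyclic_action_realization:
  assumes "simplicial_action (Cp p) K a" "p > 0"
  shows "cyclic_action p (realization K) (realization_action (Cp p) K a)"
proof -
  interpret simplicial_action "Cp p" K a by fact
  show ?thesis
    by (rule cyclic_actionI [where \<phi> = act, OF assms(2) act_continuous [OF rot_in [OF assms(2)]]])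
      (use act_one act_mult in \<open>auto simp: one_Cp mult_Cp\<close>)
qed

subsection \<open>EG for the cyclic group\<close>

context
  fixes p :: nat
  assumes p: "prime p"
begin

interpretation EGact: simplicial_action "Cp p" "join_complex (Cp p)" "\<lambda>g (i, h). (i, g \<otimes>\<^bsub>Cp p\<^esub> h)"
  by (rule simplicial_action_EG [OF group_Cp])

interpretation group "Cp p" by (rule group_Cp)

lemma p0: "p > 0" using p prime_gt_0_nat by blast

lemma cyclic_action_EG: "cyclic_action p (EG (Cp p)) (EG_action (Cp p))"
  unfolding EG_def EG_action_def
  by (rule cyclic_action_realization [OF simplicial_action_EG [OF group_Cp] p0])

lemma EG_action_apply:
  "e \<in> topspace (EG (Cp p)) \<Longrightarrow> g \<in> carrier (Cp p) \<Longrightarrow> h \<in> carrier (Cp p) \<Longrightarrow>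
    EG_action (Cp p) g e (i, g \<circ> h) = e (i, h)"
  using EGact.act_apply_image [of e g "(i, h)"]
  by (simp add: EG_def EG_action_def Union_join_complex mult_Cp del: Union_iff)

lemma EG_column_unique:
  assumes "e \<in> topspace (EG (Cp p))" "e (i, g) \<noteq> 0" "e (i, h) \<noteq> 0" shows "g = h"
  using realization_memD(2) [OF assms(1)[unfolded EG_def]] assms(2,3)
  by (auto simp: join_complex_def inj_on_def)

text \<open>The translate has nonzero coordinates at \<open>g \<circ> h\<close> and at
  \<open>h\<close> in column \<open>i\<close>, and a point has at most one per column, so
  \<open>g \<circ> h = h\<close>. This yields both freeness and injectivity of the orbit map on
  charts.\<close>

lemma EG_stabilizer:
  assumes e: "e \<in> topspace (EG (Cp p))" and g: "g \<in> carrier (Cp p)"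
    and h: "h \<in> carrier (Cp p)" "e (i, h) \<noteq> 0" "EG_action (Cp p) g e (i, h) \<noteq> 0"
  shows "g = id"
proof -
  have e': "EG_action (Cp p) g e \<in> topspace (EG (Cp p))"
    using EGact.act_in e g by (simp add: EG_def EG_action_def)
  have "EG_action (Cp p) g e (i, g \<circ> h) \<noteq> 0" using EG_action_apply [OF e g h(1)] h(2) by simp
  then have "g \<circ> h = h" using EG_column_unique [OF e'] h(3) by blast
  then show ?thesis using r_cancel_one [of h g] g h(1) by (simp add: mult_Cp one_Cp)
qed

lemma EG_free: assumes e: "e \<in> topspace (EG (Cp p))" shows "EG_action (Cp p) (rot p) e \<noteq> e"
proof
  assume eq: "EG_action (Cp p) (rot p) e = e"
  obtain i h where ih: "e (i, h) > 0" using realization_memD(6) [OF e[unfolded EG_def]] by auto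
  then have "(i, h) \<in> \<Union>(join_complex (Cp p))"
    by (intro realization_memD(5) [OF e[unfolded EG_def], of "(i, h)"]) simp
  then have "h \<in> carrier (Cp p)" by (simp add: Union_join_complex del: Union_iff)
  then have "rot p = id" using EG_stabilizer [OF e rot_in [OF p0], of h i] eq ih by simp
  then show False using rot_neq [of p 1] prime_ge_2_nat [OF p] by auto
qed

text \<open>A nonzero coordinate at \<open>(i, h)\<close> is moved to the identity by the inverse of
  \<open>h\<close>.\<close>

lemma EG_local:
  assumes e: "e \<in> topspace (EG (Cp p))"
  obtains i k where "(EG_action (Cp p) (rot p) ^^ k) e \<in> {e \<in> topspace (EG (Cp p)). e (i, id) > 0}"
proof -
  obtain i h where ih: "e (i, h) > 0" using realization_memD(6) [OF e[unfolded EG_def]] by auto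
  then have "(i, h) \<in> \<Union>(join_complex (Cp p))"
    by (intro realization_memD(5) [OF e[unfolded EG_def], of "(i, h)"]) simp
  then have h: "h \<in> carrier (Cp p)" by (simp add: Union_join_complex del: Union_iff)
  have ih': "inv\<^bsub>Cp p\<^esub> h \<in> carrier (Cp p)" "inv\<^bsub>Cp p\<^esub> h \<circ> h = id"
    using h l_inv [OF h] by (simp_all add: mult_Cp one_Cp)
  then obtain k where k: "inv\<^bsub>Cp p\<^esub> h = rot p ^^ k" using carrier_Cp [OF p0] by auto
  have "(EG_action (Cp p) (rot p) ^^ k) e = EG_action (Cp p) (inv\<^bsub>Cp p\<^esub> h) e"
    using cyclic_action_EG e k by (simp add: cyclic_action_def)
  moreover have "EG_action (Cp p) (inv\<^bsub>Cp p\<^esub> h) e (i, id) = e (i, h)"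
    using EG_action_apply [OF e ih'(1) h, of i] ih'(2) by simp
  moreover have "EG_action (Cp p) (inv\<^bsub>Cp p\<^esub> h) e \<in> topspace (EG (Cp p))"
    using EGact.act_in e ih'(1) by (simp add: EG_def EG_action_def)
  ultimately show ?thesis using that [of k i] ih by simp
qed

lemma openin_EG_chart: "openin (EG (Cp p)) {e \<in> topspace (EG (Cp p)). e (i, id) > 0}"
proof -
  have "openin (EG (Cp p)) {e \<in> topspace (EG (Cp p)). e (i, id) \<in> {0<..}}"
    using continuous_map_realization_component [of "join_complex (Cp p)" "(i, id)"]
    by (intro openin_continuous_map_preimage) (auto simp: EG_def)
  then show ?thesis by simp
qed

lemma small_Zp_space_EG:
  "small_Zp_space p (EG (Cp p)) (EG_action (Cp p) (rot p)) (BG (Cp p)) (orbit (Cp p) (EG_action (Cp p))) (\<lambda>_. True)"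
proof -
  interpret Zp_space p "EG (Cp p)" "EG_action (Cp p) (rot p)" "BG (Cp p)" "orbit (Cp p) (EG_action (Cp p))"
    unfolding BG_def
    by (rule Zp_space_orbit [OF p cyclic_action_EG _ EG_free]) (auto simp: EG_def Hausdorff_realization)
  show ?thesis
  proof
    fix e assume "e \<in> topspace (EG (Cp p))"
    then obtain i k where U: "(EG_action (Cp p) (rot p) ^^ k) e \<in> {e \<in> topspace (EG (Cp p)). e (i, id) > 0}" (is "_ \<in> ?U")
      using EG_local by blast
    \<comment> \<open>Two points of a chart in one orbit share the nonzero coordinate
      \<open>(i, id)\<close>, so the group element relating them is the identity.\<close>
    have "inj_on (orbit (Cp p) (EG_action (Cp p))) ?U"
    proof (rule inj_onI)
      fix x y assume x: "x \<in> ?U" and y: "y \<in> ?U" and eq: "orbit (Cp p) (EG_action (Cp p)) x = orbit (Cp p) (EG_action (Cp p)) y"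
      then obtain j where "y = (EG_action (Cp p) (rot p) ^^ j) x" using q_eq by blast
      then have j: "y = EG_action (Cp p) (rot p ^^ j) x" using cyclic_action_EG x by (simp add: cyclic_action_def)
      have "rot p ^^ j = id"
        using EG_stabilizer [of x "rot p ^^ j" id i] x y j rot_pow_in [OF p0] rot_pow_in [OF p0, of 0] by (simp add: id_def)
      then show "x = y" using j cyclic_action_EG x unfolding cyclic_action_def by (metis (no_types, lifting) funpow_0 mem_Collect_eq id_def funpow.simps(1))
    qed
    then show "\<exists>k U. openin (EG (Cp p)) U \<and> (EG_action (Cp p) (rot p) ^^ k) e \<in> U \<and> True
        \<and> inj_on (orbit (Cp p) (EG_action (Cp p))) U"
      using U openin_EG_chart by blast
  qed auto
qed

end

section \<open>The index of a space between the chessboard complex and the sphere\<close>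

lemma cyclic_action_prod:
  assumes a: "cyclic_action p A \<alpha>" and b: "cyclic_action p B \<beta>"
  shows "cyclic_action p (prod_topology A B) (\<lambda>g. \<lambda>(x, y)\<in>topspace A \<times> topspace B. (\<alpha> g x, \<beta> g y))"
    and "x \<in> topspace A \<Longrightarrow> y \<in> topspace B \<Longrightarrow>
      (((\<lambda>(x, y)\<in>topspace A \<times> topspace B. (\<alpha> (rot p) x, \<beta> (rot p) y)) ^^ i) (x, y))
        = ((\<alpha> (rot p) ^^ i) x, (\<beta> (rot p) ^^ i) y)"
proof -
  let ?\<psi> = "\<lambda>g. \<lambda>(x, y)\<in>topspace A \<times> topspace B. (\<alpha> g x, \<beta> g y)"
  have ca: "continuous_map A A (\<alpha> (rot p))" and cb: "continuous_map B B (\<beta> (rot p))"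
    using a b by (auto simp: cyclic_action_def)
  have in_a: "(\<alpha> (rot p) ^^ i) x \<in> topspace A" if "x \<in> topspace A" for x i
    using continuous_map_image_subset_topspace [OF ca] that by (induction i) auto
  have in_b: "(\<beta> (rot p) ^^ i) y \<in> topspace B" if "y \<in> topspace B" for y i
    using continuous_map_image_subset_topspace [OF cb] that by (induction i) auto
  show pow: "(?\<psi> (rot p) ^^ i) (x, y) = ((\<alpha> (rot p) ^^ i) x, (\<beta> (rot p) ^^ i) y)"
    if "x \<in> topspace A" "y \<in> topspace B" for x y i
    by (induction i) (use in_a in_b that in auto)
  show "cyclic_action p (prod_topology A B) ?\<psi>"
    unfolding cyclic_action_def
  proof (intro conjI ballI allI)
    have "continuous_map (prod_topology A B) (prod_topology A B) (\<lambda>z. (\<alpha> (rot p) (fst z), \<beta> (rot p) (snd z)))"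
      using continuous_map_compose [OF continuous_map_fst ca, of B] continuous_map_compose [OF continuous_map_snd cb, of A]
      by (simp add: continuous_map_paired o_def)
    then show "continuous_map (prod_topology A B) (prod_topology A B) (?\<psi> (rot p))"
      by (rule continuous_map_eq) auto
    fix z i assume "z \<in> topspace (prod_topology A B)"
    then obtain x y where z: "z = (x, y)" "x \<in> topspace A" "y \<in> topspace B" by auto
    then show "?\<psi> (rot p ^^ i) z = (?\<psi> (rot p) ^^ i) z"
      using a b pow by (simp add: cyclic_action_def)
  qed
qed

lemma chain_map_extend: "frag_extend (\<lambda>g. frag_of (simplex_map n f g)) = chain_map n f"
  by (simp add: chain_map_def o_def fun_eq_iff)

lemma fcong_chain_map: "fcong p a b \<Longrightarrow> fcong p (chain_map n f a) (chain_map n f b)"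
  by (simp only: chain_map_def fcong_extend)

lemma Zp_map_singular:
  assumes Y: "small_Zp_space p Y s Q q P" and Y': "small_Zp_space p Y' s' Q' q' (\<lambda>_. True)"
    and f: "continuous_map Y Y' f" and eq: "\<And>y. y \<in> topspace Y \<Longrightarrow> f (s y) = s' (f y)"
  shows "Zp_map p (\<lambda>n. {g. singular_simplex n Y g \<and> P (g ` standard_simplex n)}) (\<lambda>n g. chain_boundary n (frag_of g))
    (\<lambda>n. simplex_map n s) (\<lambda>n. {g. singular_simplex n Y' g \<and> True}) (\<lambda>n g. chain_boundary n (frag_of g))
    (\<lambda>n. simplex_map n s') (\<lambda>n g. frag_of (simplex_map n f g))"
proof -
  interpret Y: small_Zp_space p Y s Q q P by fact
  interpret Y': small_Zp_space p Y' s' Q' q' "\<lambda>_. True" by fact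
  show ?thesis
  proof (intro Zp_map.intro [OF Y.sing.Zp_complex_axioms Y'.sing.Zp_complex_axioms] Zp_map_axioms.intro)
    fix n g assume g: "g \<in> {g. singular_simplex (Suc n) Y g \<and> P (g ` standard_simplex (Suc n))}"
    then have "singular_chain (Suc n) Y (frag_of g)" by (simp add: singular_chain_of)
    from chain_boundary_chain_map [OF this, of f]
    show "frag_extend (\<lambda>g. chain_boundary (Suc n) (frag_of g)) (frag_of (simplex_map (Suc n) f g)) =
        frag_extend (\<lambda>g. frag_of (simplex_map n f g)) (chain_boundary (Suc n) (frag_of g))"
      by (simp add: chain_map_extend)
  next
    fix n g assume g: "g \<in> {g. singular_simplex n Y g \<and> P (g ` standard_simplex n)}"
    then have "simplex_map n (f \<circ> s) g = simplex_map n (s' \<circ> f) g"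
      using eq by (intro simplex_map_eq [of n Y]) auto
    then show "frag_of (simplex_map n f (simplex_map n s g)) =
        frag_extend (frag_of \<circ> simplex_map n s') (frag_of (simplex_map n f g))"
      by (simp add: simplex_map_compose)
    show "Poly_Mapping.keys (frag_of (simplex_map n f g)) \<subseteq> {g. singular_simplex n Y' g \<and> True}"
      using singular_simplex_simplex_map [OF _ f] g by auto
  qed auto
qed

lemma Union_chessboard_complex: "\<Union>(chessboard_complex m n) = {1..m} \<times> {1..n}"
proof -
  have "{v} \<in> chessboard_complex m n" if "v \<in> {1..m} \<times> {1..n}" for v
    using that by (auto simp: chessboard_complex_def)
  then show ?thesis unfolding chessboard_complex_def by blast
qed

lemma simplicial_action_chess:
  assumes "p > 0"
  shows "simplicial_action (Cp p) (chessboard_complex m p) (\<lambda>g (i, j). (i, g j))"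
proof (intro simplicial_action.intro)
  show "group (Cp p)" by (rule group_Cp)
  fix S assume S: "S \<in> chessboard_complex m p"
  show "finite S"
    using S finite_subset [of S "{1..m} \<times> {1..p}"] by (auto simp: chessboard_complex_def)
  show "R \<in> chessboard_complex m p" if "R \<subseteq> S" for R
    using S that by (rule chessboard_complex_subset)
  fix g assume g: "g \<in> carrier (Cp p)"
  show "(\<lambda>(i, j). (i, g j)) ` S \<in> chessboard_complex m p"
    using chessboard_complex_image [OF S Cp_permutes [OF assms g]] by (simp add: map_prod_def)
qed (auto simp: one_Cp mult_Cp)

text \<open>\<open>F\<close> maps the chessboard complex into \<open>X\<close> and yields
  injectivity below degree \<open>p - 1\<close>; \<open>v\<close> maps \<open>X\<close> to proper
  subsets and yields vanishing from degree \<open>p - 1\<close> on. \<open>v\<close> need not be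
  continuous, and \<open>v_local\<close> is the substitute.\<close>

locale index_space =
  fixes p :: nat and X :: "'a topology" and \<phi> :: "(nat \<Rightarrow> nat) \<Rightarrow> 'a \<Rightarrow> 'a"
    and F :: "(nat \<times> nat \<Rightarrow> real) \<Rightarrow> 'a" and v :: "'a \<Rightarrow> nat set"
  assumes p: "prime p" "odd p" and act: "cyclic_action p X \<phi>" and X_H: "Hausdorff_space X"
    and F_cont: "continuous_map (realization (chessboard_complex (p - 1) p)) X F"
    and F_eq: "\<And>x. x \<in> topspace (realization (chessboard_complex (p - 1) p)) \<Longrightarrow>
      F (chessboard_action (p - 1) p (rot p) x) = \<phi> (rot p) (F x)"
    and v_in: "\<And>x. x \<in> topspace X \<Longrightarrow> v x \<subseteq> {1..p} \<and> v x \<noteq> {} \<and> v x \<noteq> {1..p}"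
    and v_eq: "\<And>x. x \<in> topspace X \<Longrightarrow> v (\<phi> (rot p) x) = rot p ` v x"
    and v_local: "\<And>x. x \<in> topspace X \<Longrightarrow>
      \<exists>U. openin X U \<and> x \<in> U \<and> (\<forall>y\<in>U. \<forall>z\<in>U. card (v y) = card (v z) \<longrightarrow> v y = v z)"
begin

section \<open>The Borel construction with consistent charts\<close>

abbreviation "E \<equiv> EG (Cp p)"
abbreviation "sE \<equiv> EG_action (Cp p) (rot p)"
abbreviation "qE \<equiv> orbit (Cp p) (EG_action (Cp p))"
abbreviation "Y \<equiv> prod_topology E X"
abbreviation "\<psi> \<equiv> \<lambda>g. \<lambda>(e, x)\<in>topspace E \<times> topspace X. (EG_action (Cp p) g e, \<phi> g x)"
abbreviation "sY \<equiv> \<psi> (rot p)"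
abbreviation "Bor \<equiv> borel_construction (Cp p) X \<phi>"
abbreviation "qY \<equiv> orbit (Cp p) \<psi>"
abbreviation "A \<equiv> integer_mod_group p"

text \<open>On such a set the cardinality determines the subset, which makes sorting by cardinality
  commute with the boundary.\<close>

definition consistent :: "((nat \<times> (nat \<Rightarrow> nat) \<Rightarrow> real) \<times> 'a) set \<Rightarrow> bool" where
  "consistent S \<longleftrightarrow> (\<forall>y\<in>S. \<forall>z\<in>S. card (v (snd y)) = card (v (snd z)) \<longrightarrow> v (snd y) = v (snd z))"

lemma p_pos: "p > 0" using p prime_gt_0_nat by blast

lemma card_rot_image: "card (rot p ` w) = card w"
  by (rule card_image) (use permutes_inj [OF rot_permutes] inj_on_subset in blast)

lemma sX_in: "x \<in> topspace X \<Longrightarrow> \<phi> (rot p) x \<in> topspace X"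
  using act continuous_map_image_subset_topspace [of X X "\<phi> (rot p)"] by (auto simp: cyclic_action_def)

lemma sX_pow_in: "x \<in> topspace X \<Longrightarrow> (\<phi> (rot p) ^^ i) x \<in> topspace X"
  by (induction i) (auto simp: sX_in)

interpretation E: small_Zp_space p E sE "BG (Cp p)" qE "\<lambda>_. True"
  by (rule small_Zp_space_EG [OF p(1)])

lemma cyclic_action_Y: "cyclic_action p Y \<psi>"
  by (rule cyclic_action_prod [OF cyclic_action_EG [OF p(1)] act])

lemma Zp_space_Y: "Zp_space p Y sY Bor qY"
  unfolding borel_construction_def
proof (rule Zp_space_orbit [OF p(1) cyclic_action_Y])
  show "Hausdorff_space Y" using E.Hausdorff X_H by (simp add: Hausdorff_space_prod_topology)
  show "sY y \<noteq> y" if "y \<in> topspace Y" for y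
    using that E.s_free by auto
qed

lemma sY_pow:
  "e \<in> topspace E \<Longrightarrow> x \<in> topspace X \<Longrightarrow> (sY ^^ i) (e, x) = ((sE ^^ i) e, (\<phi> (rot p) ^^ i) x)"
  by (rule cyclic_action_prod(2) [OF cyclic_action_EG [OF p(1)] act])

text \<open>A chart is a product: the factor in \<open>EG\<close> makes the orbit map injective and
  the factor in \<open>X\<close> makes the chart consistent.\<close>

lemma small_Zp_space_Y: "small_Zp_space p Y sY Bor qY consistent"
proof -
  interpret Zp_space p Y sY Bor qY by (rule Zp_space_Y)
  show ?thesis
  proof
    show "consistent S'" if "consistent S" "S' \<subseteq> S" for S S'
      using that unfolding consistent_def by blast
    show "consistent (sY ` S)" if S: "S \<subseteq> topspace Y" "consistent S" for S
      unfolding consistent_def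
    proof (intro ballI impI)
      fix y z assume "y \<in> sY ` S" "z \<in> sY ` S" and eq: "card (v (snd y)) = card (v (snd z))"
      then obtain a b where ab: "a \<in> S" "y = sY a" "b \<in> S" "z = sY b" by blast
      obtain e x e' x' where "a = (e, x)" "b = (e', x')" by (cases a, cases b)
      with ab have *: "(e, x) \<in> S" "y = sY (e, x)" "(e', x') \<in> S" "z = sY (e', x')" by auto
      then have t: "e \<in> topspace E" "x \<in> topspace X" "e' \<in> topspace E" "x' \<in> topspace X" using S by auto
      then have vy: "v (snd y) = rot p ` v x" "v (snd z) = rot p ` v x'" using * v_eq by auto
      then have "card (v x) = card (v x')" using eq card_rot_image by simp
      then have "v x = v x'" using S(2) *(1,3) unfolding consistent_def by (metis snd_conv)
      then show "v (snd y) = v (snd z)" using vy by simp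
    qed
    fix y assume "y \<in> topspace Y"
    then obtain e x where y: "y = (e, x)" "e \<in> topspace E" "x \<in> topspace X" by auto
    obtain i k where ik: "(sE ^^ k) e \<in> {e \<in> topspace E. e (i, id) > 0}" (is "_ \<in> ?U")
      using EG_local [OF p(1) y(2)] by blast
    \<comment> \<open>The power \<open>k\<close> is dictated by the chart in \<open>EG\<close>, so
      the neighbourhood is taken at the translated point of \<open>X\<close>.\<close>
    obtain W where W: "openin X W" "(\<phi> (rot p) ^^ k) x \<in> W"
      "\<forall>y\<in>W. \<forall>z\<in>W. card (v y) = card (v z) \<longrightarrow> v y = v z"
      using v_local [OF sX_pow_in [OF y(3), of k]] by (elim exE conjE) (rule that)
    have WX: "W \<subseteq> topspace X" using W(1) openin_subset by blast
    have "openin Y (?U \<times> W)" using openin_EG_chart [OF p(1)] W by (simp add: openin_prod_Times_iff)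
    moreover have "(sY ^^ k) y \<in> ?U \<times> W" using ik W y sY_pow by simp
    moreover have "consistent (?U \<times> W)" using W(3) by (auto simp: consistent_def)
    moreover have "inj_on qY (?U \<times> W)"
    proof (rule inj_onI)
      fix a b assume a: "a \<in> ?U \<times> W" and b: "b \<in> ?U \<times> W" and eq: "qY a = qY b"
      obtain e x where ex: "a = (e, x)" "e \<in> ?U" "x \<in> W" using a by blast
      have aY: "a \<in> topspace Y" "b \<in> topspace Y" using a b WX by auto
      obtain j where j: "b = (sY ^^ j) a" using q_eq [OF aY eq] by blast
      then have b': "b = ((sE ^^ j) e, (\<phi> (rot p) ^^ j) x)" using ex WX sY_pow by auto
      have "(sE ^^ j) e = EG_action (Cp p) (rot p ^^ j) e"
        using cyclic_action_EG [OF p(1)] ex by (simp add: cyclic_action_def)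
      then have "EG_action (Cp p) (rot p ^^ j) e (i, id) \<noteq> 0" using b b' by auto
      then have id: "rot p ^^ j = id"
        using EG_stabilizer [OF p(1), of e "rot p ^^ j" id i] ex rot_pow_in [OF p_pos] rot_pow_in [OF p_pos, of 0]
        by (simp add: id_def)
      have "(sY ^^ j) a = \<psi> (rot p ^^ j) a" using cyclic_action_Y aY(1) unfolding cyclic_action_def by metis
      then have "b = \<psi> (rot p ^^ j) a" using j by (rule trans [rotated])
      also have "\<dots> = \<psi> (rot p ^^ 0) a" unfolding id by (simp add: id_def)
      also have "\<dots> = (sY ^^ 0) a" using cyclic_action_Y aY unfolding cyclic_action_def by blast
      finally show "a = b" by simp
    qed
    ultimately show "\<exists>k U. openin Y U \<and> (sY ^^ k) y \<in> U \<and> consistent U \<and> inj_on qY U"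
      by (intro exI [of _ k] exI [of _ "?U \<times> W"] conjI)
  qed
qed

interpretation Y: small_Zp_space p Y sY Bor qY consistent
  by (rule small_Zp_space_Y)

text \<open>The same space without the restriction to consistent simplices, to receive the affine
  simplices of the chessboard complex, which may be large.\<close>

interpretation YY: small_Zp_space p Y sY Bor qY "\<lambda>_. True"
  by unfold_locales (use Y.P_local in blast)+

lemma sY_fst: "y \<in> topspace Y \<Longrightarrow> fst (sY y) = sE (fst y)"
  by auto

interpretation proj: Zp_map p "\<lambda>n. {g. singular_simplex n Y g \<and> consistent (g ` standard_simplex n)}"
  "\<lambda>n g. chain_boundary n (frag_of g)" "\<lambda>n. simplex_map n sY" "\<lambda>n. {g. singular_simplex n E g \<and> True}"
  "\<lambda>n g. chain_boundary n (frag_of g)" "\<lambda>n. simplex_map n sE" "\<lambda>n g. frag_of (simplex_map n fst g)"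
  by (rule Zp_map_singular [where f = fst, OF small_Zp_space_Y E.small_Zp_space_axioms continuous_map_fst sY_fst])

interpretation proj': Zp_map p "\<lambda>n. {g. singular_simplex n Y g \<and> True}"
  "\<lambda>n g. chain_boundary n (frag_of g)" "\<lambda>n. simplex_map n sY" "\<lambda>n. {g. singular_simplex n E g \<and> True}"
  "\<lambda>n g. chain_boundary n (frag_of g)" "\<lambda>n. simplex_map n sE" "\<lambda>n g. frag_of (simplex_map n fst g)"
  by (rule Zp_map_singular [where f = fst, OF YY.small_Zp_space_axioms E.small_Zp_space_axioms continuous_map_fst sY_fst])

lemma fst_q: "y \<in> topspace Y \<Longrightarrow> fst ` qY y = qE (fst y)"
  by (auto simp: orbit_def image_iff)

lemma fst_cont: "continuous_map Bor (BG (Cp p)) ((`) fst)"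
proof -
  have q: "quotient_map Y Bor qY" unfolding borel_construction_def by (rule quotient_map_orbit)
  have "continuous_map Y (BG (Cp p)) (qE \<circ> fst)"
    by (rule continuous_map_compose [OF continuous_map_fst E.q_cont])
  then have "continuous_map Y (BG (Cp p)) ((`) fst \<circ> qY)"
    by (rule continuous_map_eq) (simp add: fst_q)
  then show ?thesis using continuous_compose_quotient_map [OF q] by blast
qed

lemma chain_map_fst_q:
  "singular_chain n Y c \<Longrightarrow> chain_map n ((`) fst) (chain_map n qY c) = chain_map n qE (chain_map n fst c)"
  using chain_map_eq [of n Y c "(`) fst \<circ> qY" "qE \<circ> fst"] fst_q by (simp add: chain_map_compose)

text \<open>Acyclicity makes \<open>w\<close> a boundary plus a term in \<open>S - 1\<close>; the
  orbit map kills the second and a cocycle kills the first.\<close>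

lemma tower_0_cocycle:
  assumes w: "E.sing.tower n True w l" and l: "[l = 0] (mod int p)" and \<theta>: "\<theta> \<in> cocycles n (BG (Cp p)) A"
  shows "\<theta> (chain_map n qE w) = 0"
proof -
  have "\<exists>x\<in>E.sing.chains n. \<exists>x'\<in>E.sing.chains (Suc n). fcong p w (E.sing.d (Suc n) x' + E.sing.T True n x)"
  proof (rule E.sing.tower_acyclic [where N = n, OF _ order_refl w l])
    fix k c assume "c \<in> E.sing.chains k" "k \<noteq> 0 \<Longrightarrow> fcong p (E.sing.d k c) 0" "k = 0 \<Longrightarrow> [aug c = 0] (mod int p)"
    then have "\<exists>x. singular_chain (Suc k) E x \<and> fcong p c (chain_boundary (Suc k) x)"
      by (intro contractible_acyclic [OF contractible_EG [OF group_Cp] p(1) E.sing_chains])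
        (auto simp: E.sing_d)
    then show "\<exists>x\<in>E.sing.chains (Suc k). fcong p c (E.sing.d (Suc k) x)"
      by (auto simp: E.sing_d singular_chain_def)
  qed
  then obtain x x' where x: "x \<in> E.sing.chains n" "x' \<in> E.sing.chains (Suc n)"
    "fcong p w (E.sing.d (Suc n) x' + E.sing.T True n x)" by blast
  have cx': "singular_chain (Suc n) E x'" and cw: "singular_chain n E w"
    using x E.sing_chains E.sing.tower_chains [OF w] by blast+
  have "fcong p (chain_map n qE w) (chain_map n qE (E.sing.d (Suc n) x' + E.sing.T True n x))"
    by (rule fcong_chain_map [OF x(3)])
  also have "\<dots> = chain_boundary (Suc n) (chain_map (Suc n) qE x')"
    using E.q_T [OF x(1)] chain_boundary_chain_map [OF cx', of qE] by (simp add: chain_map_add E.sing_d)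
  finally have "fcong p (chain_map n qE w - 0) (chain_boundary (Suc n) (chain_map (Suc n) qE x'))" by simp
  then have "\<theta> (chain_map n qE w) = \<theta> 0"
    using cocycle_homologous [OF p(1) \<theta> singular_chain_chain_map [OF cw E.q_cont] singular_chain_0
      singular_chain_chain_map [OF cx' E.q_cont]] by blast
  also have "\<dots> = 0"
    using comm_group.cochain_0 [of A \<theta> n "BG (Cp p)"] comm_group.cocycles_iff [of A \<theta> n "BG (Cp p)"] \<theta> by simp
  finally show ?thesis .
qed

subsection \<open>Vanishing in high degrees\<close>

text \<open>Cardinalities increase strictly within \<open>{1..<p}\<close>, and this alone bounds the
  length.\<close>

abbreviation colour_lists :: "nat set list set" where
  "colour_lists \<equiv> {l. (\<forall>w\<in>set l. w \<subseteq> {1..p} \<and> w \<noteq> {} \<and> w \<noteq> {1..p}) \<and> sorted_wrt (\<lambda>a b. card a < card b) l}"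

text \<open>Rotation is transitive, so an invariant nonempty subset is everything.\<close>

lemma rot_image_free:
  assumes "w \<subseteq> {1..p}" "w \<noteq> {}" "w \<noteq> {1..p}" shows "rot p ` w \<noteq> w"
proof
  assume eq: "rot p ` w = w"
  obtain j where j: "j \<in> w" using assms by blast
  have "(rot p ^^ n) j \<in> w" for n
    by (induction n) (use j eq in auto)
  then have "{1..p} \<subseteq> w" using rot_transitive [of j p] j assms by blast
  then show False using assms by blast
qed

interpretation D: Zp_complex p "\<lambda>n. {l \<in> colour_lists. length l = Suc n}" "\<lambda>_. list_boundary" "\<lambda>_. map ((`) (rot p))"
proof (rule Zp_complex_lists [OF p(1)])
  fix l k assume l: "l \<in> colour_lists"
  have "sorted_wrt (\<lambda>a b. card a < card b) (take k l @ drop (Suc k) l)"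
  proof (cases "k < length l")
    case True
    have "sorted_wrt (\<lambda>a b. card a < card b) (take k l @ l ! k # drop (Suc k) l)"
      using l id_take_nth_drop [OF True] by simp
    then show ?thesis by (auto simp: sorted_wrt_append)
  qed (use l in simp)
  then show "take k l @ drop (Suc k) l \<in> colour_lists"
    using l set_take_subset [of k l] set_drop_subset [of "Suc k" l] by auto
  have "rot p ` w \<subseteq> {1..p} \<and> rot p ` w \<noteq> {} \<and> rot p ` w \<noteq> {1..p}" if "w \<in> set l" for w
  proof -
    have w: "w \<subseteq> {1..p}" "w \<noteq> {}" "w \<noteq> {1..p}" using l that by auto
    have "rot p ` w \<subseteq> rot p ` {1..p}" using w by blast
    then have 1: "rot p ` w \<subseteq> {1..p}" using permutes_image [OF rot_permutes] by metis
    have "card w < card {1..p}" using w by (intro psubset_card_mono) auto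
    then have "rot p ` w \<noteq> {1..p}" using card_rot_image [of w] by auto
    then show ?thesis using 1 w by simp
  qed
  then show "map ((`) (rot p)) l \<in> colour_lists"
    using l by (auto simp: sorted_wrt_map card_rot_image)
  fix w assume w: "w \<in> set l"
  have pow: "((`) (rot p) ^^ n) w = (rot p ^^ n) ` w" for n by (induction n) auto
  show "((`) (rot p) ^^ p) w = w" unfolding pow rot_order by simp
  show "rot p ` w \<noteq> w" using l w by (intro rot_image_free) auto
qed

abbreviation vertex :: "nat \<Rightarrow> nat \<Rightarrow> real" where "vertex i \<equiv> (\<lambda>j. if j = i then 1 else 0)"

definition colours :: "nat \<Rightarrow> ((nat \<Rightarrow> real) \<Rightarrow> (nat \<times> (nat \<Rightarrow> nat) \<Rightarrow> real) \<times> 'a) \<Rightarrow> nat set list" where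
  "colours n f = map (\<lambda>i. v (snd (f (vertex i)))) [0..<Suc n]"

lemma length_colours [simp]: "length (colours n f) = Suc n"
  by (simp add: colours_def)

lemma nth_colours: "i \<le> n \<Longrightarrow> colours n f ! i = v (snd (f (vertex i)))"
  unfolding colours_def using nth_map [of i "[0..<Suc n]"] by (simp del: upt_Suc)

lemma set_colours: "set (colours n f) = (\<lambda>i. v (snd (f (vertex i)))) ` {..n}"
  by (simp add: colours_def atLeast0LessThan lessThan_Suc_atMost del: upt_Suc)

lemma in_set_colours:
  assumes "w \<in> set (colours n f)" obtains i where "i \<le> n" "w = v (snd (f (vertex i)))"
  using assms unfolding set_colours image_iff Bex_def atMost_iff by (elim exE conjE)

lemma vertex_face:
  "simplical_face k (vertex i) = (if i < k then vertex i else vertex (Suc i))"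
  by (auto simp: simplical_face_def fun_eq_iff)

lemma colours_face:
  assumes "k \<le> Suc n"
  shows "colours n (singular_face (Suc n) k f) = take k (colours (Suc n) f) @ drop (Suc k) (colours (Suc n) f)"
proof (rule nth_equalityI)
  fix i assume "i < length (colours n (singular_face (Suc n) k f))"
  then have i: "i \<le> n" by simp
  have "colours n (singular_face (Suc n) k f) ! i = v (snd (f (simplical_face k (vertex i))))"
    using i by (simp add: nth_colours singular_face_def)
  also have "\<dots> = (take k (colours (Suc n) f) @ drop (Suc k) (colours (Suc n) f)) ! i"
    using i assms by (auto simp: vertex_face nth_append nth_colours)
  finally show "colours n (singular_face (Suc n) k f) ! i = (take k (colours (Suc n) f) @ drop (Suc k) (colours (Suc n) f)) ! i" .
qed (use assms in auto)

text \<open>A singular simplex goes to the sorted list of the subsets at its vertices. Rotation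
  preserves cardinality, hence equivariance; consistency gives the chain map property.\<close>

interpretation colour: Zp_map p "\<lambda>n. {g. singular_simplex n Y g \<and> consistent (g ` standard_simplex n)}"
  "\<lambda>n g. chain_boundary n (frag_of g)" "\<lambda>n. simplex_map n sY"
  "\<lambda>n. {l \<in> colour_lists. length l = Suc n}" "\<lambda>_. list_boundary" "\<lambda>_. map ((`) (rot p))"
  "\<lambda>n g. asort card (colours n g)"
proof (intro Zp_map.intro [OF Y.sing.Zp_complex_axioms D.Zp_complex_axioms] Zp_map_axioms.intro)
  fix n g assume g: "g \<in> {g. singular_simplex n Y g \<and> consistent (g ` standard_simplex n)}"
  have gY: "g (vertex i) \<in> topspace Y" if "i \<le> n" for i
    using g that continuous_map_image_subset_topspace [of "subtopology (powertop_real UNIV) (standard_simplex n)" Y g] by (auto simp: singular_simplex_def topspace_standard_simplex)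
  have vin: "w \<subseteq> {1..p} \<and> w \<noteq> {} \<and> w \<noteq> {1..p}" if w: "w \<in> set (colours n g)" for w
  proof -
    obtain i where i: "i \<le> n" "w = v (snd (g (vertex i)))" using w by (rule in_set_colours)
    have "snd (g (vertex i)) \<in> topspace X" using gY [OF i(1)] by auto
    then show ?thesis using v_in i by blast
  qed
  show "Poly_Mapping.keys (asort card (colours n g)) \<subseteq> {l \<in> colour_lists. length l = Suc n}"
  proof
    fix m assume "m \<in> Poly_Mapping.keys (asort card (colours n g))"
    from keys_asort [OF this] show "m \<in> {l \<in> colour_lists. length l = Suc n}" using vin by auto
  qed
  have "colours n (simplex_map n sY g) = map ((`) (rot p)) (colours n g)"
  proof (rule nth_equalityI)
    fix i assume "i < length (colours n (simplex_map n sY g))"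
    then have i: "i \<le> n" by simp
    have "v (snd (sY (g (vertex i)))) = rot p ` v (snd (g (vertex i)))"
      using gY [OF i] v_eq by auto
    then show "colours n (simplex_map n sY g) ! i = map ((`) (rot p)) (colours n g) ! i"
      using i by (simp add: nth_colours simplex_map_def)
  qed simp
  then show "asort card (colours n (simplex_map n sY g)) = lmap ((`) (rot p)) (asort card (colours n g))"
    using lmap_asort [of card "(`) (rot p)"] card_rot_image by simp
next
  fix n g assume g: "g \<in> {g. singular_simplex (Suc n) Y g \<and> consistent (g ` standard_simplex (Suc n))}"
  \<comment> \<open>The vertices lie in the image of the simplex, where consistency identifies
    subsets of equal size.\<close>
  have cons: "a = b" if ab: "a \<in> set (colours (Suc n) g)" "b \<in> set (colours (Suc n) g)" "card a = card b" for a b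
  proof -
    obtain i where i: "i \<le> Suc n" "a = v (snd (g (vertex i)))"
      using ab(1) by (rule in_set_colours)
    obtain j where j: "j \<le> Suc n" "b = v (snd (g (vertex j)))"
      using ab(2) by (rule in_set_colours)
    have mem: "g (vertex k) \<in> g ` standard_simplex (Suc n)" if "k \<le> Suc n" for k
      using that by (intro imageI) simp
    have "consistent (g ` standard_simplex (Suc n))" using g unfolding mem_Collect_eq by (rule conjunct2)
    from bspec [OF bspec [OF this [unfolded consistent_def] mem [OF i(1)]] mem [OF j(1)]]
    show ?thesis using \<open>card a = card b\<close> unfolding i(2) j(2) by blast
  qed
  have "frag_extend (\<lambda>g. asort card (colours n g)) (chain_boundary (Suc n) (frag_of g)) =
      (\<Sum>k\<le>Suc n. frag_cmul ((-1) ^ k) (asort card (colours n (singular_face (Suc n) k g))))"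
    by (simp add: chain_boundary_of frag_extend_sum frag_extend_cmul o_def del: sum.atMost_Suc)
  also have "\<dots> = (\<Sum>k<Suc (Suc n). frag_cmul ((-1) ^ k)
      (asort card (take k (colours (Suc n) g) @ drop (Suc k) (colours (Suc n) g))))"
    by (intro sum.cong) (auto simp: colours_face)
  also have "\<dots> = frag_extend (asort card) (list_boundary (colours (Suc n) g))"
    by (simp add: list_boundary_sum frag_extend_sum frag_extend_cmul o_def del: sum.lessThan_Suc)
  also have "\<dots> = ld (asort card (colours (Suc n) g))"
    using ld_asort [of "colours (Suc n) g" card] cons by simp
  finally show "ld (asort card (colours (Suc n) g)) =
      frag_extend (\<lambda>g. asort card (colours n g)) (chain_boundary (Suc n) (frag_of g))" by simp
qed (simp add: colours_def)

lemma colour_lists_length: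
  assumes "l \<in> colour_lists" shows "length l < p"
proof -
  have "sorted_wrt (<) (map card l)" using assms by (simp add: sorted_wrt_map)
  then have "distinct (map card l)" using strict_sorted_iff by blast
  then have "length l = card (set (map card l))" using distinct_card [of "map card l"] by simp
  also have "\<dots> \<le> card {1..<p}"
  proof (intro card_mono subsetI)
    fix k assume "k \<in> set (map card l)"
    then obtain w where w: "w \<in> set l" "k = card w" by auto
    then have *: "w \<subseteq> {1..p}" "w \<noteq> {}" "w \<noteq> {1..p}" using assms by auto
    have "card w < card {1..p}" using * by (intro psubset_card_mono) auto
    moreover have "card w > 0" using * finite_subset [of w "{1..p}"] by (simp add: card_gt_0_iff)
    ultimately show "k \<in> {1..<p}" using w by simp
  qed simp
  finally show ?thesis using p_pos by simp
qed

text \<open>A cycle in the Borel construction lifts to a tower, whose value can be computed in the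
  lists of subsets, where it is 0, or in \<open>EG\<close>, where 0 forces the cocycle to vanish on
  the image.\<close>

lemma pullback_high_degree:
  assumes n: "p - 1 \<le> n" and \<theta>: "\<theta> \<in> cocycles n (BG (Cp p)) A"
  shows "cochain_pullback n Bor ((`) fst) \<theta> \<in> coboundaries n Bor A"
proof -
  have A: "comm_group A" by simp
  have \<theta>c: "\<theta> \<in> carrier (cochain_group n (BG (Cp p)) A)" using \<theta> comm_group.cocycles_iff [OF A] by blast
  have "cochain_pullback n Bor ((`) fst) \<theta> z = 0" if z: "mod_cycle p n Bor z" for z
  proof -
    obtain y l u where y: "Y.sing.tower n True y l" and u: "singular_chain (Suc n) Bor u"
      "fcong p (chain_map n qY y - z) (chain_boundary (Suc n) u)"
      using Y.lift_mod_cycle [OF z] by blast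
    have yc: "singular_chain n Y y" using Y.sing_chains [OF Y.sing.tower_chains [OF y]] .
    have "[l = 0] (mod int p)"
    \<comment> \<open>There is no list of length \<open>Suc n\<close>, so the image chain is 0 and
      bounds trivially.\<close>
    proof (rule D.tower_boundary [OF colour.h_tower [OF y], of 0 0])
      have empty: "{l \<in> colour_lists. length l = Suc n} = {}"
      proof -
        have "length l \<noteq> Suc n" if "l \<in> colour_lists" for l using colour_lists_length [OF that] n by linarith
        then show ?thesis by blast
      qed
      have "Poly_Mapping.keys (frag_extend (\<lambda>g. asort card (colours n g)) y) \<subseteq> {}"
        using CollectD [OF colour.h_chains [OF Y.sing.tower_chains [OF y]]] unfolding empty .
      then have "frag_extend (\<lambda>g. asort card (colours n g)) y = 0" by simp
      then show "fcong p (frag_extend (\<lambda>g. asort card (colours n g)) y) (D.d (Suc n) 0 + D.T True n 0)" by simp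
    qed auto
    then have 0: "\<theta> (chain_map n qE (chain_map n fst y)) = 0"
      using tower_0_cocycle [OF _ _ \<theta>] proj.h_tower [OF y] by (simp add: chain_map_extend)
    have "fcong p (chain_map n ((`) fst) (chain_map n qY y - z)) (chain_map n ((`) fst) (chain_boundary (Suc n) u))"
      by (rule fcong_chain_map [OF u(2)])
    then have hom: "fcong p (chain_map n ((`) fst) (chain_map n qY y) - chain_map n ((`) fst) z)
        (chain_boundary (Suc n) (chain_map (Suc n) ((`) fst) u))"
      using chain_boundary_chain_map [OF u(1), of "(`) fst"] by (simp add: chain_map_diff)
    have "\<theta> (chain_map n ((`) fst) (chain_map n qY y)) = \<theta> (chain_map n ((`) fst) z)"
    proof (rule cocycle_homologous [OF p(1) \<theta>])
      show "singular_chain n (BG (Cp p)) (chain_map n ((`) fst) (chain_map n qY y))"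
        by (rule singular_chain_chain_map [OF singular_chain_chain_map [OF yc Y.q_cont] fst_cont])
      show "singular_chain n (BG (Cp p)) (chain_map n ((`) fst) z)"
        using z singular_chain_chain_map [OF _ fst_cont] by blast
      show "singular_chain (Suc n) (BG (Cp p)) (chain_map (Suc n) ((`) fst) u)"
        by (rule singular_chain_chain_map [OF u(1) fst_cont])
    qed (rule hom)
    then show ?thesis using 0 chain_map_fst_q [OF yc] z by (simp add: cochain_pullback_def)
  qed
  then show ?thesis
    using coboundary_iff_mod_cycle [OF p(1) comm_group.cochain_pullback_carrier [OF A fst_cont \<theta>c]] by blast
qed

subsection \<open>Injectivity in low degrees\<close>

abbreviation "chess \<equiv> chessboard_complex (p - 1) p"
abbreviation "sC \<equiv> chessboard_action (p - 1) p (rot p)"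

interpretation Cact: simplicial_action "Cp p" chess "\<lambda>g (i, j). (i, g j)"
  by (rule simplicial_action_chess [OF p_pos])

text \<open>The chessboard complex sits in a join of \<open>p - 1\<close> copies of the group: the
  row is the join coordinate and column \<open>j\<close> stands for the group element that takes 1
  to \<open>j\<close>.\<close>

definition to_EG :: "(nat \<times> nat \<Rightarrow> real) \<Rightarrow> (nat \<times> (nat \<Rightarrow> nat) \<Rightarrow> real)" where
  "to_EG x = (\<lambda>(i, h). if h \<in> carrier (Cp p) then x (i, h 1) else 0)"

text \<open>The group acts simply transitively on \<open>{1..p}\<close>, which justifies labelling
  its elements by columns.\<close>

lemma Cp_determined:
  assumes "g \<in> carrier (Cp p)" "h \<in> carrier (Cp p)" "g 1 = h 1" shows "g = h"
proof -
  obtain a b where ab: "g = rot p ^^ a" "h = rot p ^^ b" using assms carrier_Cp [OF p_pos] by auto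
  have mod: "rot p ^^ n = rot p ^^ (n mod p)" for n
    by (rule ext) (simp add: funpow_mod_eq rot_order)
  have "a mod p = b mod p"
    using assms(3) rot_nth [of 0 p a] rot_nth [of 0 p b] p_pos unfolding ab by simp
  then show ?thesis using ab mod by metis
qed

lemma Cp_surj: assumes "j \<in> {1..p}" obtains h where "h \<in> carrier (Cp p)" "h 1 = j"
  using rot_transitive [of 1 p j] assms that rot_pow_in [OF p_pos] p_pos by (auto simp: Suc_le_eq)

lemma to_EG_in:
  assumes x: "x \<in> topspace (realization chess)" shows "to_EG x \<in> topspace E"
proof -
  note x' = realization_memD [OF x]
  let ?X = "{v. x v \<noteq> 0}"
  have X: "?X \<subseteq> {1..p - 1} \<times> {1..p}" "inj_on fst ?X" using x'(2) by (auto simp: chessboard_complex_def)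
  define k where "k j = (SOME h. h \<in> carrier (Cp p) \<and> h 1 = j)" for j
  have k: "k j \<in> carrier (Cp p) \<and> k j 1 = j" if "j \<in> {1..p}" for j
  proof -
    obtain h where "h \<in> carrier (Cp p)" "h 1 = j" using Cp_surj [OF \<open>j \<in> {1..p}\<close>] .
    then have "h \<in> carrier (Cp p) \<and> h 1 = j" by simp
    then show ?thesis unfolding k_def by (rule someI [where P = "\<lambda>h. h \<in> carrier (Cp p) \<and> h 1 = j"])
  qed
  let ?k = "\<lambda>(i, j). (i, k j)"
  let ?S = "?k ` ?X"
  have SK: "?S \<in> join_complex (Cp p)"
    unfolding join_complex_def mem_Collect_eq
  proof (intro conjI)
    show "finite ?S" using x'(4) by simp
    show "?S \<subseteq> UNIV \<times> carrier (Cp p)" using X(1) k by auto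
    show "inj_on fst ?S"
    proof (rule inj_onI)
      fix a b assume "a \<in> ?S" "b \<in> ?S" "fst a = fst b"
      obtain u where u: "u \<in> ?X" "a = ?k u" using \<open>a \<in> ?S\<close> by (rule imageE) blast
      obtain w where w: "w \<in> ?X" "b = ?k w" using \<open>b \<in> ?S\<close> by (rule imageE) blast
      have "fst u = fst w" using \<open>fst a = fst b\<close> u(2) w(2) by (simp add: case_prod_beta)
      then have "u = w" using X(2) u(1) w(1) by (rule_tac inj_onD)
      then show "a = b" using u(2) w(2) by simp
    qed
  qed
  show ?thesis
    unfolding EG_def
  proof (rule realization_memI [where S = ?S])
    show "R \<in> join_complex (Cp p)" if "S \<in> join_complex (Cp p)" "R \<subseteq> S" for S R
      using that by (rule join_complex_mono)
    show "0 \<le> to_EG x v" for v using x'(1) by (cases v) (simp add: to_EG_def)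
    show "to_EG x v = 0" if v: "v \<notin> ?S" for v
    proof (rule ccontr)
      obtain i h where ih: "v = (i, h)" by (cases v)
      assume "to_EG x v \<noteq> 0"
      then have h: "h \<in> carrier (Cp p)" "(i, h 1) \<in> ?X" by (auto simp: ih to_EG_def split: if_splits)
      then have "h 1 \<in> {1..p}" using X(1) by auto
      then have "k (h 1) = h" using k [of "h 1"] h(1) by (intro Cp_determined) auto
      then have "v \<in> ?S" using h(2) ih by (intro image_eqI [of _ _ "(i, h 1)"]) simp_all
      then show False using v by blast
    qed
    have "inj_on ?k ?X"
    proof (rule inj_onI)
      fix a b assume "a \<in> ?X" "b \<in> ?X" "?k a = ?k b"
      then show "a = b" using inj_onD [OF X(2)] by (auto simp: case_prod_beta)
    qed
    then have "(\<Sum>v\<in>?S. to_EG x v) = (\<Sum>v\<in>?X. to_EG x (?k v))" by (simp add: sum.reindex o_def)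
    also have "\<dots> = (\<Sum>v\<in>?X. x v)"
      by (rule sum.cong [OF refl]) (use k X(1) in \<open>auto simp: to_EG_def\<close>)
    finally show "(\<Sum>v\<in>?S. to_EG x v) = 1" using x'(3) by simp
    show "finite ?S" using x'(4) by simp
  qed (rule SK)
qed

lemma to_EG_cont: "continuous_map (realization chess) E to_EG"
  unfolding EG_def continuous_map_into_realization
proof (intro conjI allI)
  fix v show "continuous_map (realization chess) euclideanreal (\<lambda>x. to_EG x v)"
    by (cases v) (simp add: to_EG_def continuous_map_realization_component)
qed (use to_EG_in in \<open>auto simp: EG_def\<close>)

lemma to_EG_eq:
  assumes x: "x \<in> topspace (realization chess)" shows "to_EG (sC x) = sE (to_EG x)"
proof
  interpret group "Cp p" by (rule group_Cp)
  fix v :: "nat \<times> (nat \<Rightarrow> nat)"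
  obtain i h where v: "v = (i, h)" by (cases v)
  have r: "rot p \<in> carrier (Cp p)" by (rule rot_in [OF p_pos])
  have E: "sE (to_EG x) (i, h) = (if h \<in> carrier (Cp p) then to_EG x (i, inv\<^bsub>Cp p\<^esub> (rot p) \<circ> h) else 0)"
    using to_EG_in [OF x] unfolding EG_action_def EG_def
    by (simp add: realization_action_def Union_join_complex mult_Cp del: Union_iff)
  show "to_EG (sC x) v = sE (to_EG x) v"
  proof (cases "h \<in> carrier (Cp p)")
    case True
    have c: "inv\<^bsub>Cp p\<^esub> (rot p) \<circ> h \<in> carrier (Cp p)" using m_closed [OF inv_closed [OF r] True] by (simp add: mult_Cp)
    have "sC x (i, h 1) = x (i, (inv\<^bsub>Cp p\<^esub> (rot p)) (h 1))"
    proof (cases "(i, h 1) \<in> \<Union>chess")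
      case in_chess: True
      then show ?thesis using Cact.act_apply [OF x] by (simp add: chessboard_action_def del: Union_iff)
    next
      case False
      have "(i, (inv\<^bsub>Cp p\<^esub> (rot p)) (h 1)) \<notin> \<Union>chess"
      proof
        assume "(i, (inv\<^bsub>Cp p\<^esub> (rot p)) (h 1)) \<in> \<Union>chess"
        then have "(i, rot p ((inv\<^bsub>Cp p\<^esub> (rot p)) (h 1))) \<in> \<Union>chess"
          using Cact.a_in [OF r, of "(i, (inv\<^bsub>Cp p\<^esub> (rot p)) (h 1))"] by (simp del: Union_iff)
        moreover have "rot p ((inv\<^bsub>Cp p\<^esub> (rot p)) (h 1)) = h 1"
          using fun_cong [OF r_inv [OF r], of "h 1"] by (simp add: mult_Cp one_Cp)
        ultimately show False using False by simp
      qed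
      then have "x (i, (inv\<^bsub>Cp p\<^esub> (rot p)) (h 1)) = 0" using realization_memD(5) [OF x] by blast
      then show ?thesis using Cact.act_apply [OF x] False by (simp add: chessboard_action_def del: Union_iff)
    qed
    then show ?thesis using True c E v by (simp add: to_EG_def)
  qed (use E v in \<open>simp add: to_EG_def\<close>)
qed

definition W :: "(nat \<times> nat \<Rightarrow> real) \<Rightarrow> (nat \<times> (nat \<Rightarrow> nat) \<Rightarrow> real) \<times> 'a" where
  "W x = (to_EG x, F x)"

lemma W_cont: "continuous_map (realization chess) Y W"
proof -
  have "W = (\<lambda>x. (to_EG x, F x))" by (simp add: W_def fun_eq_iff)
  then show ?thesis using to_EG_cont F_cont by (simp only: continuous_map_paired)
qed

lemma W_eq:
  assumes x: "x \<in> topspace (realization chess)" shows "W (sC x) = sY (W x)"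
proof -
  have "F x \<in> topspace X" using F_cont x continuous_map_image_subset_topspace by blast
  then show ?thesis using to_EG_in [OF x] to_EG_eq [OF x] F_eq [OF x] by (simp add: W_def)
qed

interpretation chess: Zp_complex p "\<lambda>n. {l \<in> chess_lists p. length l = Suc n}" "\<lambda>_. list_boundary"
    "\<lambda>_. map (map_prod id (rot p))"
  by (rule Zp_complex_chess [OF p rot_permutes rot_order rot_neq]) (use prime_ge_2_nat [OF p(1)] in auto)

lemma affine_chess:
  "l \<in> {l \<in> chess_lists p. length l = Suc n} \<Longrightarrow> singular_simplex n (realization chess) (affine_simplex n l)"
  by (rule singular_simplex_affine) (auto intro: chessboard_complex_subset)

text \<open>Passage from combinatorics to topology: a list becomes the affine simplex it spans,
  pushed forward to \<open>Y\<close> by the equivariant map \<open>W\<close>.\<close>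

interpretation real: Zp_map p "\<lambda>n. {l \<in> chess_lists p. length l = Suc n}" "\<lambda>_. list_boundary"
    "\<lambda>_. map (map_prod id (rot p))" "\<lambda>n. {g. singular_simplex n Y g \<and> True}"
  "\<lambda>n g. chain_boundary n (frag_of g)" "\<lambda>n. simplex_map n sY" "\<lambda>n l. frag_of (simplex_map n W (affine_simplex n l))"
proof (intro Zp_map.intro [OF chess.Zp_complex_axioms YY.sing.Zp_complex_axioms] Zp_map_axioms.intro)
  fix n l assume l: "l \<in> {l \<in> chess_lists p. length l = Suc n}"
  note a = affine_chess [OF l]
  show "Poly_Mapping.keys (frag_of (simplex_map n W (affine_simplex n l))) \<subseteq> {g. singular_simplex n Y g \<and> True}"
    using singular_simplex_simplex_map [OF a W_cont] by simp
  have "affine_simplex n (map (map_prod id (rot p)) l) = simplex_map n sC (affine_simplex n l)"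
    using Cact.simplex_map_affine [OF rot_in [OF p_pos], of l n] l
    by (simp add: chessboard_action_def map_prod_def)
  then have "simplex_map n W (affine_simplex n (map (map_prod id (rot p)) l)) = simplex_map n (W \<circ> sC) (affine_simplex n l)"
    by (simp add: simplex_map_compose)
  also have "\<dots> = simplex_map n (sY \<circ> W) (affine_simplex n l)"
    by (rule simplex_map_eq [OF a]) (simp only: comp_apply W_eq)
  finally show "frag_of (simplex_map n W (affine_simplex n (map (map_prod id (rot p)) l))) =
      frag_extend (frag_of \<circ> simplex_map n sY) (frag_of (simplex_map n W (affine_simplex n l)))"
    by (simp add: simplex_map_compose)
next
  fix n l assume l: "l \<in> {l \<in> chess_lists p. length l = Suc (Suc n)}"
  have a: "singular_chain (Suc n) (realization chess) (frag_of (affine_simplex (Suc n) l))"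
    using affine_chess [OF l] by (simp add: singular_chain_of)
  have "chain_boundary (Suc n) (frag_of (simplex_map (Suc n) W (affine_simplex (Suc n) l)))
      = chain_map n W (chain_boundary (Suc n) (frag_of (affine_simplex (Suc n) l)))"
    using chain_boundary_chain_map [OF a, of W] by simp
  also have "\<dots> = chain_map n W (frag_extend (\<lambda>l. frag_of (affine_simplex n l)) (list_boundary l))"
    using chain_boundary_affine [of l n] l by simp
  also have "\<dots> = frag_extend (\<lambda>l. frag_of (simplex_map n W (affine_simplex n l))) (list_boundary l)"
    by (simp add: chain_map_def frag_extend_frag_extend)
  finally show "frag_extend (\<lambda>g. chain_boundary (Suc n) (frag_of g)) (frag_of (simplex_map (Suc n) W (affine_simplex (Suc n) l)))
      = frag_extend (\<lambda>l. frag_of (simplex_map n W (affine_simplex n l))) (list_boundary l)" by simp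
qed simp

text \<open>The lower layers of the tower on the fundamental cycle have the same nonzero value. If
  the layer in degree \<open>n\<close> begins with the norm, it is converted.\<close>

lemma low_degree_tower:
  assumes n: "n < p - 1"
  obtains c k where "YY.sing.tower n True c k" "\<not> [k = 0] (mod int p)"
proof -
  have "p \<noteq> 2" "p \<ge> 2" using p prime_ge_2_nat by auto
  then have p3: "p \<ge> 3" by simp
  obtain y k where y: "chess.tower (p - 2) True y k" "\<not> [k = 0] (mod int p)"
    using chess_tower [OF p rot_permutes rot_order rot_neq] prime_ge_2_nat [OF p(1)] by auto
  have "n \<le> p - 2" using n by simp
  then obtain z where z: "chess.tower n (if even (p - 2 - n) then True else \<not> True) z k"
    using chess.tower_truncate [OF y(1)] by blast
  have "chess.tower n True z k"
  proof (cases "even (p - 2 - n)")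
    case False
    have "odd (p - 2)" using p(2) p3 by simp
    moreover have "p - 2 = n + (p - 2 - n)" using \<open>n \<le> p - 2\<close> by simp
    \<comment> \<open>The norm comes first when \<open>p - 2 - n\<close> is odd; as
      \<open>p - 2\<close> is odd too, \<open>n\<close> is even and \<open>tower_convert\<close>
      applies.\<close>
    ultimately have "even n" using False by (metis even_add)
    moreover have "chess.tower n False z k" using z False by simp
    ultimately show ?thesis using chess.tower_convert by blast
  qed (use z in simp)
  then show ?thesis using that real.h_tower y(2) by blast
qed

lemma cochain_cmul_0:
  assumes \<theta>: "\<theta> \<in> carrier (cochain_group n Z A)" and a: "singular_chain n Z a" "\<theta> a = 0"
  shows "\<theta> (frag_cmul (int k) a) = 0"
proof (induction k)
  case 0
  then show ?case using comm_group.cochain_0 [of A \<theta> n Z] \<theta> by simp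
next
  case (Suc k)
  have "frag_cmul (int (Suc k)) a = frag_cmul (int k) a + a"
    using frag_cmul_distrib [of "int k" 1 a] by (simp add: add.commute)
  then show ?case
    using cochain_hom [OF \<theta> singular_chain_cmul [OF a(1)] a(1), of "int k"] Suc a by simp
qed

text \<open>A tower over any cycle of \<open>BG\<close> differs from a multiple of the image of
  \<open>c\<close> by a tower of value 0. The cocycle vanishes on the latter by acyclicity and on
  the image of \<open>c\<close> because its pullback is a coboundary.\<close>

lemma pullback_low_degree:
  assumes n: "n < p - 1" and \<theta>: "\<theta> \<in> cocycles n (BG (Cp p)) A"
    and cob: "cochain_pullback n Bor ((`) fst) \<theta> \<in> coboundaries n Bor A"
  shows "\<theta> \<in> coboundaries n (BG (Cp p)) A"
proof -
  have A: "comm_group A" by simp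
  have \<theta>c: "\<theta> \<in> carrier (cochain_group n (BG (Cp p)) A)" using \<theta> comm_group.cocycles_iff [OF A] by blast
  obtain c k where c: "YY.sing.tower n True c k" "\<not> [k = 0] (mod int p)"
    using low_degree_tower [OF n] by blast
  have cY: "c \<in> YY.sing.chains n" using YY.sing.tower_chains [OF c(1)] .
  have cc: "singular_chain n Y c" using YY.sing_chains [OF cY] .
  have "mod_cycle p n Bor (chain_map n qY c)"
  proof
    show "singular_chain n Bor (chain_map n qY c)" by (rule singular_chain_chain_map [OF cc Y.q_cont])
    show "fcong p (chain_boundary n (chain_map n qY c)) 0"
    proof (cases n)
      case (Suc m)
      obtain x where x': "fcong p (chain_boundary (Suc m) c) (YY.sing.T True m x)" "YY.sing.tower m (\<not> True) x k"
        using c(1) unfolding Suc YY.sing.tower.simps(2) YY.sing_d by (elim exE conjE) (rule that)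
      have x: "fcong p (chain_boundary n c) (YY.sing.T True m x)" "x \<in> YY.sing.chains m"
        unfolding Suc by (rule x'(1), rule YY.sing.tower_chains [OF x'(2)])
      have "fcong p (chain_map m qY (chain_boundary n c)) (chain_map m qY (YY.sing.T True m x))"
        by (rule fcong_chain_map [OF x(1)])
      then show ?thesis
        using chain_boundary_chain_map [OF cc, of qY] YY.q_T [OF x(2)] Suc by simp
    qed (simp add: chain_boundary_def)
  qed
  then have "cochain_pullback n Bor ((`) fst) \<theta> (chain_map n qY c) = 0"
    using cob coboundary_iff_mod_cycle [OF p(1) comm_group.cochain_pullback_carrier [OF A fst_cont \<theta>c]] by blast
  then have \<theta>0: "\<theta> (chain_map n qE (chain_map n fst c)) = 0"
    using chain_map_fst_q [OF cc] singular_chain_chain_map [OF cc Y.q_cont] by (simp add: cochain_pullback_def)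
  let ?c = "chain_map n fst c"
  have Ec: "E.sing.tower n True ?c k" using proj'.h_tower [OF c(1)] by (simp add: chain_map_extend)
  have "\<theta> z = 0" if z: "mod_cycle p n (BG (Cp p)) z" for z
  proof -
    obtain y l u where y: "E.sing.tower n True y l" and u: "singular_chain (Suc n) (BG (Cp p)) u"
      "fcong p (chain_map n qE y - z) (chain_boundary (Suc n) u)"
      using E.lift_mod_cycle [OF z] by blast
    have yc: "singular_chain n E y" using E.sing_chains [OF E.sing.tower_chains [OF y]] .
    have "coprime (int p) k"
      by (rule prime_imp_coprime) (use c(2) p(1) in \<open>simp_all add: cong_0_iff\<close>)
    then have "coprime k (int p)" by (simp add: coprime_commute)
    then obtain k' where k': "[k * k' = 1] (mod int p)" using cong_solve_coprime_int by blast
    \<comment> \<open>\<open>m\<close> represents \<open>l\<close> divided by \<open>k\<close>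
      modulo \<open>p\<close>; a natural representative suits \<open>cochain_cmul_0\<close>.\<close>
    define m where "m = nat ((l * k') mod int p)"
    have m: "[int m = l * k'] (mod int p)" using p_pos by (simp add: m_def cong_def)
    have "[l - int m * k = l - l * k' * k] (mod int p)"
      by (intro cong_diff cong_mult m cong_refl)
    also have "l - l * k' * k = l * (1 - k * k')" by (simp add: algebra_simps)
    also have "[l * (1 - k * k') = l * (1 - 1)] (mod int p)" by (intro cong_mult cong_diff k' cong_refl)
    finally have 0: "[l - int m * k = 0] (mod int p)" by simp
    have c': "singular_chain n E ?c" using E.sing_chains [OF E.sing.tower_chains [OF Ec]] .
    have "\<theta> (chain_map n qE (y - frag_cmul (int m) ?c)) = 0"
      by (rule tower_0_cocycle [OF E.sing.tower_lincomb [OF y Ec] 0 \<theta>])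
    moreover have "\<theta> (frag_cmul (int m) (chain_map n qE ?c)) = 0"
      by (rule cochain_cmul_0 [OF \<theta>c singular_chain_chain_map [OF c' E.q_cont] \<theta>0])
    moreover have "chain_map n qE y = chain_map n qE (y - frag_cmul (int m) ?c) + frag_cmul (int m) (chain_map n qE ?c)"
      by (simp add: chain_map_diff)
    ultimately have "\<theta> (chain_map n qE y) = 0"
      using cochain_hom [OF \<theta>c singular_chain_chain_map [OF singular_chain_diff [OF yc singular_chain_cmul [OF c']] E.q_cont]
        singular_chain_cmul [OF singular_chain_chain_map [OF c' E.q_cont]], of "int m" "int m"] by simp
    moreover have "\<theta> (chain_map n qE y) = \<theta> z"
      using cocycle_homologous [OF p(1) \<theta> singular_chain_chain_map [OF yc E.q_cont] _ u] z by blast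
    ultimately show ?thesis by simp
  qed
  then show ?thesis using coboundary_iff_mod_cycle [OF p(1) \<theta>c] by blast
qed

theorem index_eq:
  "fadell_husseini_index A (Cp p) X \<phi> = cohomology_ge (p - 1) (BG (Cp p)) A"
  unfolding fadell_husseini_index_def
  by (rule comm_group.kernel_cohomology_map_eq_ge [OF _ fst_cont pullback_high_degree pullback_low_degree]) simp_all

end

section \<open>Test maps to the sphere\<close>

definition proper_subsets :: "nat \<Rightarrow> nat set set" where
  "proper_subsets p = {\<sigma>. \<sigma> \<subseteq> {1..p} \<and> \<sigma> \<noteq> {} \<and> \<sigma> \<noteq> {1..p}}"

text \<open>The smallest excess of a value inside \<sigma> over one outside; it is positive exactly
  when \<sigma> lies strictly above its complement.\<close>

definition gap :: "nat \<Rightarrow> (nat \<Rightarrow> real) \<Rightarrow> nat set \<Rightarrow> real" where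
  "gap p t \<sigma> = Min ((\<lambda>(i, j). t i - t j) ` (\<sigma> \<times> ({1..p} - \<sigma>)))"

definition max_gap :: "nat \<Rightarrow> (nat \<Rightarrow> real) \<Rightarrow> nat set \<Rightarrow> bool" where
  "max_gap p t \<sigma> \<longleftrightarrow> \<sigma> \<in> proper_subsets p \<and> (\<forall>\<tau>\<in>proper_subsets p. gap p t \<tau> \<le> gap p t \<sigma>)"

text \<open>Ties between several largest gaps are broken by the smaller cardinality, a rule
  compatible with permutations of the coordinates.\<close>

definition cut :: "nat \<Rightarrow> (nat \<Rightarrow> real) \<Rightarrow> nat set" where
  "cut p t = (THE \<sigma>. max_gap p t \<sigma> \<and> (\<forall>\<tau>. max_gap p t \<tau> \<longrightarrow> card \<sigma> \<le> card \<tau>))"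

lemma finite_proper_subsets: "finite (proper_subsets p)"
  unfolding proper_subsets_def by (rule finite_subset [of _ "Pow {1..p}"]) auto

lemma le_gap_iff:
  assumes "\<sigma> \<in> proper_subsets p"
  shows "c \<le> gap p t \<sigma> \<longleftrightarrow> (\<forall>i\<in>\<sigma>. \<forall>j\<in>{1..p} - \<sigma>. c \<le> t i - t j)"
proof -
  have \<sigma>: "\<sigma> \<subseteq> {1..p}" "\<sigma> \<noteq> {}" "{1..p} - \<sigma> \<noteq> {}" using assms by (auto simp: proper_subsets_def)
  then have "finite \<sigma>" using finite_subset by blast
  then have "finite (\<sigma> \<times> ({1..p} - \<sigma>))" by simp
  moreover have "\<sigma> \<times> ({1..p} - \<sigma>) \<noteq> {}" using \<sigma> by blast
  ultimately show ?thesis unfolding gap_def by (subst Min_ge_iff) auto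
qed

lemma gap_le:
  assumes "\<sigma> \<in> proper_subsets p" "i \<in> \<sigma>" "j \<in> {1..p} - \<sigma>" shows "gap p t \<sigma> \<le> t i - t j"
  using le_gap_iff [OF assms(1), of "gap p t \<sigma>" t] assms(2,3) by blast

text \<open>A difference of two values changes by less than twice the perturbation.\<close>

lemma gap_perturb:
  assumes "\<sigma> \<in> proper_subsets p" "\<And>i. i \<in> {1..p} \<Longrightarrow> \<bar>t i - u i\<bar> < \<delta>"
  shows "gap p t \<sigma> - 2 * \<delta> \<le> gap p u \<sigma>"
  unfolding le_gap_iff [OF assms(1)]
proof (intro ballI)
  fix i j assume ij: "i \<in> \<sigma>" "j \<in> {1..p} - \<sigma>"
  then have "i \<in> {1..p}" using assms(1) by (auto simp: proper_subsets_def)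
  then show "gap p t \<sigma> - 2 * \<delta> \<le> u i - u j"
    using assms(2) [of i] assms(2) [of j] gap_le [OF assms(1) ij, of t] ij by auto
qed

text \<open>Otherwise each of the two sets has an element outside the other, and each of these
  elements would have the larger value.\<close>

lemma gap_pos_unique:
  assumes \<sigma>: "\<sigma> \<in> proper_subsets p" "0 < gap p t \<sigma>" and \<tau>: "\<tau> \<in> proper_subsets p" "0 < gap p t \<tau>"
    and card: "card \<sigma> = card \<tau>"
  shows "\<sigma> = \<tau>"
proof (rule ccontr)
  assume ne: "\<sigma> \<noteq> \<tau>"
  have sub: "\<sigma> \<subseteq> {1..p}" "\<tau> \<subseteq> {1..p}" using \<sigma> \<tau> by (auto simp: proper_subsets_def)
  then have "finite \<sigma>" "finite \<tau>" using finite_subset by blast+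
  then have "\<not> \<sigma> \<subseteq> \<tau>" "\<not> \<tau> \<subseteq> \<sigma>" using card ne card_subset_eq by metis+
  then obtain i j where ij: "i \<in> \<sigma>" "i \<notin> \<tau>" "j \<in> \<tau>" "j \<notin> \<sigma>" by blast
  then have "i \<in> {1..p} - \<tau>" "j \<in> {1..p} - \<sigma>" using sub by blast+
  then show False
    using gap_le [OF \<sigma>(1) ij(1), of j t] gap_le [OF \<tau>(1) ij(3), of i t] \<sigma>(2) \<tau>(2) by linarith
qed

text \<open>The set where the maximum is attained has a positive gap.\<close>

lemma ex_gap_pos:
  assumes "i \<in> {1..p}" "j \<in> {1..p}" "t i \<noteq> t j"
  shows "\<exists>\<sigma>\<in>proper_subsets p. 0 < gap p t \<sigma>"
proof -
  define m where "m = Max (t ` {1..p})"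
  have m: "t k \<le> m" if "k \<in> {1..p}" for k using that by (simp add: m_def)
  define \<sigma> where "\<sigma> = {k \<in> {1..p}. t k = m}"
  have "m \<in> t ` {1..p}" unfolding m_def using assms by (intro Max_in) auto
  then have "\<sigma> \<noteq> {}" by (auto simp: \<sigma>_def)
  moreover have "\<sigma> \<noteq> {1..p}"
  proof
    assume "\<sigma> = {1..p}"
    then have "i \<in> \<sigma>" "j \<in> \<sigma>" using assms by simp_all
    then show False using assms(3) by (simp add: \<sigma>_def)
  qed
  ultimately have V: "\<sigma> \<in> proper_subsets p" by (auto simp: proper_subsets_def \<sigma>_def)
  have \<sigma>: "finite \<sigma>" "\<sigma> \<noteq> {}" "{1..p} - \<sigma> \<noteq> {}"
    using \<open>\<sigma> \<noteq> {}\<close> \<open>\<sigma> \<noteq> {1..p}\<close> by (auto simp: \<sigma>_def)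
  have "gap p t \<sigma> \<in> (\<lambda>(i, j). t i - t j) ` (\<sigma> \<times> ({1..p} - \<sigma>))"
    unfolding gap_def using \<sigma> by (intro Min_in) auto
  then obtain k l where "k \<in> \<sigma>" "l \<in> {1..p}" "l \<notin> \<sigma>" "gap p t \<sigma> = t k - t l" by auto
  then have "0 < gap p t \<sigma>" using m [of l] by (auto simp: \<sigma>_def)
  then show ?thesis using V by blast
qed

context
  fixes p :: nat and t :: "nat \<Rightarrow> real"
  assumes nonconst: "\<exists>i\<in>{1..p}. \<exists>j\<in>{1..p}. t i \<noteq> t j"
begin

lemma max_gap_pos: assumes "max_gap p t \<sigma>" shows "\<sigma> \<in> proper_subsets p" "0 < gap p t \<sigma>"
  using ex_gap_pos nonconst assms unfolding max_gap_def by (blast, meson less_le_trans)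

text \<open>The largest gap of a nonconstant vector is positive, so two maximizers of the same least
  size coincide by \<open>gap_pos_unique\<close>.\<close>

lemma cut_ex1: "\<exists>!\<sigma>. max_gap p t \<sigma> \<and> (\<forall>\<tau>. max_gap p t \<tau> \<longrightarrow> card \<sigma> \<le> card \<tau>)"
proof -
  let ?g = "gap p t ` proper_subsets p"
  have "?g \<noteq> {}" using ex_gap_pos nonconst by blast
  then have "Max ?g \<in> ?g" using finite_proper_subsets by (intro Max_in) auto
  then obtain \<sigma> where "\<sigma> \<in> proper_subsets p" "gap p t \<sigma> = Max ?g" by auto
  then have "max_gap p t \<sigma>" by (auto simp: max_gap_def finite_proper_subsets)
  then obtain \<tau> where "max_gap p t \<tau>" "\<forall>\<rho>. max_gap p t \<rho> \<longrightarrow> card \<tau> \<le> card \<rho>"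
    using ex_has_least_nat [of "max_gap p t" \<sigma> card] by blast
  then show ?thesis using max_gap_pos gap_pos_unique by (metis dual_order.antisym)
qed

lemma cut_max_gap: "max_gap p t (cut p t)"
  using theI' [OF cut_ex1] unfolding cut_def by blast

lemma cut_proper: "cut p t \<in> proper_subsets p"
  using max_gap_pos [OF cut_max_gap] by blast

text \<open>\<open>r\<close> matches subsets bijectively, preserving gaps and cardinalities, so it
  carries the unique cut to the unique cut.\<close>

lemma cut_permutes:
  assumes r: "r permutes {1..p}" and u: "\<And>i. i \<in> {1..p} \<Longrightarrow> u (r i) = t i"
  shows "cut p u = r ` cut p t"
proof -
  have img: "r ` {1..p} = {1..p}" by (rule permutes_image [OF r])
  have inj: "inj r" by (rule permutes_inj [OF r])
  have V: "r ` \<sigma> \<in> proper_subsets p \<longleftrightarrow> \<sigma> \<in> proper_subsets p" for \<sigma>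
    using inj_image_subset_iff [OF inj, of \<sigma> "{1..p}"] inj_image_eq_iff [OF inj, of \<sigma> "{1..p}"]
    by (simp add: proper_subsets_def img img [simplified])
  have onto: "\<exists>\<sigma>. \<tau> = r ` \<sigma>" for \<tau>
    using permutes_surj [OF r] by (metis subset_UNIV subset_imageE)
  have gap: "gap p u (r ` \<sigma>) = gap p t \<sigma>" if "\<sigma> \<in> proper_subsets p" for \<sigma>
  proof -
    have "{1..p} - r ` \<sigma> = r ` ({1..p} - \<sigma>)" by (simp only: image_set_diff [OF inj] img)
    then have "r ` \<sigma> \<times> ({1..p} - r ` \<sigma>) = map_prod r r ` (\<sigma> \<times> ({1..p} - \<sigma>))" by auto
    moreover have "(\<lambda>(i, j). u i - u j) ` map_prod r r ` (\<sigma> \<times> ({1..p} - \<sigma>))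
        = (\<lambda>(i, j). t i - t j) ` (\<sigma> \<times> ({1..p} - \<sigma>))"
      unfolding image_image
      by (rule image_cong [OF refl]) (use that u in \<open>auto simp: proper_subsets_def\<close>)
    ultimately show ?thesis by (simp add: gap_def)
  qed
  have mg: "max_gap p u (r ` \<sigma>) \<longleftrightarrow> max_gap p t \<sigma>" for \<sigma>
  proof -
    have "(\<forall>\<tau>\<in>proper_subsets p. gap p u \<tau> \<le> c) \<longleftrightarrow> (\<forall>\<tau>\<in>proper_subsets p. gap p t \<tau> \<le> c)" for c
      using V gap onto by metis
    then show ?thesis using V gap by (auto simp: max_gap_def)
  qed
  have card: "card (r ` \<sigma>) = card \<sigma>" for \<sigma> by (rule card_image [OF inj_on_subset [OF inj]]) simp
  have cut: "max_gap p t (cut p t) \<and> (\<forall>\<tau>. max_gap p t \<tau> \<longrightarrow> card (cut p t) \<le> card \<tau>)"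
    using theI' [OF cut_ex1] unfolding cut_def .
  have u': "\<exists>i\<in>{1..p}. \<exists>j\<in>{1..p}. u i \<noteq> u j"
    using nonconst u permutes_in_image [OF r] by metis
  have "max_gap p u (r ` cut p t) \<and> (\<forall>\<tau>. max_gap p u \<tau> \<longrightarrow> card (r ` cut p t) \<le> card \<tau>)"
    using cut mg card onto by metis
  moreover have "\<exists>!\<sigma>. max_gap p u \<sigma> \<and> (\<forall>\<tau>. max_gap p u \<tau> \<longrightarrow> card \<sigma> \<le> card \<tau>)"
  proof (rule ex_ex1I)
    show "\<exists>\<sigma>. max_gap p u \<sigma> \<and> (\<forall>\<tau>. max_gap p u \<tau> \<longrightarrow> card \<sigma> \<le> card \<tau>)" using calculation by blast
    fix \<sigma> \<tau>
    assume a: "max_gap p u \<sigma> \<and> (\<forall>\<tau>. max_gap p u \<tau> \<longrightarrow> card \<sigma> \<le> card \<tau>)"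
      "max_gap p u \<tau> \<and> (\<forall>\<sigma>. max_gap p u \<sigma> \<longrightarrow> card \<tau> \<le> card \<sigma>)"
    obtain \<sigma>' \<tau>' where "\<sigma> = r ` \<sigma>'" "\<tau> = r ` \<tau>'" using onto by metis
    then show "\<sigma> = \<tau>" using a mg card cut_ex1 onto by metis
  qed
  ultimately show ?thesis unfolding cut_def [of p u] by (rule the1_equality [rotated])
qed

end

text \<open>Near \<open>x\<close> every cut that occurs still has a positive gap for the one vector
  \<open>f x\<close>; \<open>gap_pos_unique\<close> for this vector then gives local
  consistency.\<close>

lemma index_spaceI:
  assumes p: "prime p" "odd p" and act: "cyclic_action p X \<phi>" and X: "Hausdorff_space X"
    and F: "continuous_map (realization (chessboard_complex (p - 1) p)) X F"
      "\<And>x. x \<in> topspace (realization (chessboard_complex (p - 1) p)) \<Longrightarrow>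
        F (chessboard_action (p - 1) p (rot p) x) = \<phi> (rot p) (F x)"
    and f_cont: "\<And>i. i \<in> {1..p} \<Longrightarrow> continuous_map X euclideanreal (\<lambda>x. f x i)"
    and f_eq: "\<And>x i. x \<in> topspace X \<Longrightarrow> i \<in> {1..p} \<Longrightarrow> f (\<phi> (rot p) x) (rot p i) = f x i"
    and f: "\<And>x. x \<in> topspace X \<Longrightarrow> \<exists>i\<in>{1..p}. \<exists>j\<in>{1..p}. f x i \<noteq> f x j"
  shows "index_space p X \<phi> F (\<lambda>x. cut p (f x))"
proof (rule index_space.intro)
  fix x assume x: "x \<in> topspace X"
  show "cut p (f x) \<subseteq> {1..p} \<and> cut p (f x) \<noteq> {} \<and> cut p (f x) \<noteq> {1..p}"
    using cut_proper [OF f [OF x]] by (simp add: proper_subsets_def)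
  show "cut p (f (\<phi> (rot p) x)) = rot p ` cut p (f x)"
    by (rule cut_permutes [OF f [OF x] rot_permutes f_eq [OF x]])
  \<comment> \<open>The comparison passes from \<open>f x\<close> to \<open>f y\<close> and back,
    losing two \<delta> each time; a fifth of the gap remains.\<close>
  define \<delta> where "\<delta> = gap p (f x) (cut p (f x)) / 5"
  have \<delta>: "\<delta> > 0" using max_gap_pos [OF f [OF x] cut_max_gap [OF f [OF x]]] by (simp add: \<delta>_def)
  define U where "U = {y \<in> topspace X. \<forall>i\<in>{1..p}. \<bar>f y i - f x i\<bar> < \<delta>}"
  have "U = (\<Inter>i\<in>{1..p}. {y \<in> topspace X. f y i \<in> ball (f x i) \<delta>}) \<inter> topspace X"
    by (auto simp: U_def dist_real_def abs_minus_commute)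
  moreover have "openin X {y \<in> topspace X. f y i \<in> ball (f x i) \<delta>}" if "i \<in> {1..p}" for i
    using f_cont [OF that] by (rule openin_continuous_map_preimage) simp
  ultimately have U: "openin X U" by (simp only: openin_INT finite_atLeastAtMost)
  have pos: "cut p (f y) \<in> proper_subsets p \<and> 0 < gap p (f x) (cut p (f y))" if y: "y \<in> U" for y
  proof -
    have d: "\<bar>f y i - f x i\<bar> < \<delta>" "\<bar>f x i - f y i\<bar> < \<delta>" if "i \<in> {1..p}" for i
      using y that by (auto simp: U_def abs_minus_commute)
    have yX: "y \<in> topspace X" using y by (simp add: U_def)
    note my = cut_max_gap [OF f [OF yX]] and mx = cut_max_gap [OF f [OF x]]
    have "gap p (f x) (cut p (f x)) - 2 * \<delta> \<le> gap p (f y) (cut p (f x))"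
      by (rule gap_perturb [OF cut_proper [OF f [OF x]] d(2)])
    also have "\<dots> \<le> gap p (f y) (cut p (f y))"
      using my mx by (simp add: max_gap_def)
    finally have "gap p (f x) (cut p (f x)) - 2 * \<delta> \<le> gap p (f y) (cut p (f y))" .
    moreover have "gap p (f y) (cut p (f y)) - 2 * \<delta> \<le> gap p (f x) (cut p (f y))"
      by (rule gap_perturb [OF cut_proper [OF f [OF yX]] d(1)])
    ultimately show ?thesis using \<delta> cut_proper [OF f [OF yX]] unfolding \<delta>_def by simp
  qed
  have "\<forall>y\<in>U. \<forall>z\<in>U. card (cut p (f y)) = card (cut p (f z)) \<longrightarrow> cut p (f y) = cut p (f z)"
    using pos gap_pos_unique by blast
  then show "\<exists>U. openin X U \<and> x \<in> U \<and>
      (\<forall>y\<in>U. \<forall>z\<in>U. card (cut p (f y)) = card (cut p (f z)) \<longrightarrow> cut p (f y) = cut p (f z))"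
    using U x \<delta> by (intro exI [of _ U]) (simp add: U_def)
qed (use assms in auto)

section \<open>Column sums, the projection of rooks to columns in barycentric coordinates, and the
  two instances\<close>

definition column_sum :: "nat \<Rightarrow> (nat \<times> nat \<Rightarrow> real) \<Rightarrow> nat \<Rightarrow> real" where
  "column_sum p x j = (\<Sum>i=1..p - 1. x (i, j))"

context
  fixes p :: nat
  assumes p: "prime p"
begin

lemma p_gt_1: "p > 1" using p by (rule prime_gt_1_nat)

interpretation chess: simplicial_action "Cp p" "chessboard_complex (p - 1) p" "\<lambda>g (i, j). (i, g j)"
  by (rule simplicial_action_chess) (use p_gt_1 in simp)

lemma column_sum_rot:
  assumes x: "x \<in> topspace (realization (chessboard_complex (p - 1) p))" and j: "j \<in> {1..p}"
  shows "column_sum p (chessboard_action (p - 1) p (rot p) x) (rot p j) = column_sum p x j"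
proof -
  have "chessboard_action (p - 1) p (rot p) x (i, rot p j) = x (i, j)" if "i \<in> {1..p - 1}" for i
    using chess.act_apply_image [OF x rot_in, of "(i, j)"] p_gt_1 that j
    by (simp add: Union_chessboard_complex chessboard_action_def del: Union_iff)
  then show ?thesis unfolding column_sum_def by (intro sum.cong) auto
qed

lemma column_sum_continuous:
  "continuous_map (realization (chessboard_complex (p - 1) p)) euclideanreal (\<lambda>x. column_sum p x j)"
  unfolding column_sum_def by (intro continuous_map_sum continuous_map_realization_component) simp

lemma sum_column_sum:
  assumes x: "x \<in> topspace (realization (chessboard_complex (p - 1) p))"
  shows "(\<Sum>j=1..p. column_sum p x j) = 1"
proof -
  have "(\<Sum>j=1..p. column_sum p x j) = (\<Sum>v\<in>{1..p - 1} \<times> {1..p}. x v)"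
    unfolding column_sum_def by (subst sum.swap) (simp add: sum.cartesian_product)
  also have "\<dots> = (\<Sum>v | x v \<noteq> 0. x v)"
    using realization_memD(2) [OF x] by (intro sum.mono_neutral_right) (auto simp: chessboard_complex_def)
  finally show ?thesis using realization_memD(3) [OF x] by simp
qed

text \<open>At most \<open>p - 1\<close> rooks leave a column empty, so constant sums would all be
  0, whereas their total is 1.\<close>

lemma column_sum_nonconst:
  assumes x: "x \<in> topspace (realization (chessboard_complex (p - 1) p))"
  shows "\<exists>i\<in>{1..p}. \<exists>j\<in>{1..p}. column_sum p x i \<noteq> column_sum p x j"
proof -
  note x' = realization_memD [OF x]
  let ?S = "{v. x v \<noteq> 0}"
  have S: "?S \<subseteq> {1..p - 1} \<times> {1..p}" "inj_on fst ?S" using x'(2) by (auto simp: chessboard_complex_def)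
  have "card (snd ` ?S) \<le> card ?S" using x'(4) by (rule card_image_le)
  also have "\<dots> = card (fst ` ?S)" using S(2) by (simp add: card_image)
  also have "\<dots> \<le> card {1..p - 1}" using S(1) by (intro card_mono) auto
  also have "\<dots> < card {1..p}" using p_gt_1 by simp
  finally have "card (snd ` ?S) < card {1..p}" .
  then have "snd ` ?S \<noteq> {1..p}" by (metis less_irrefl)
  then obtain k where k: "k \<in> {1..p}" "k \<notin> snd ` ?S" using S(1) by force
  then have "x (i, k) = 0" for i by force
  then have k0: "column_sum p x k = 0" by (simp add: column_sum_def)
  show ?thesis
  proof (rule ccontr)
    assume "\<not> ?thesis"
    then have "column_sum p x j = 0" if "j \<in> {1..p}" for j using k(1) k0 that by metis
    then show False using sum_column_sum [OF x] by simp
  qed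
qed

lemma index_space_chess:
  assumes "odd p"
  shows "index_space p (realization (chessboard_complex (p - 1) p)) (chessboard_action (p - 1) p) id
    (\<lambda>x. cut p (column_sum p x))"
proof (rule index_spaceI [OF p assms])
  show "cyclic_action p (realization (chessboard_complex (p - 1) p)) (chessboard_action (p - 1) p)"
    unfolding chessboard_action_def
    by (rule cyclic_action_realization [OF simplicial_action_chess]) (use p_gt_1 in simp_all)
qed (use column_sum_continuous column_sum_rot column_sum_nonconst in \<open>simp_all add: Hausdorff_realization\<close>)

lemma topspace_W_sphere: "t \<in> topspace (W_sphere p) \<longleftrightarrow>
    (\<forall>i. i \<notin> {1..p} \<longrightarrow> t i = 0) \<and> (\<Sum>i=1..p. t i) = 0 \<and> (\<Sum>i=1..p. (t i)\<^sup>2) = 1"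
  by (simp add: W_sphere_def topspace_subtopology)

lemma continuous_map_into_W_sphere:
  "continuous_map X (W_sphere p) f \<longleftrightarrow>
    (\<forall>i. continuous_map X euclideanreal (\<lambda>x. f x i)) \<and> f \<in> topspace X \<rightarrow> topspace (W_sphere p)"
  by (auto simp: W_sphere_def continuous_map_in_subtopology continuous_map_componentwise_UNIV topspace_subtopology)

lemma W_sphere_component: "continuous_map (W_sphere p) euclideanreal (\<lambda>t. t i)"
  unfolding W_sphere_def by (intro continuous_map_from_subtopology continuous_map_product_projection) simp

lemma W_sphere_action_in:
  assumes g: "g \<in> carrier (Cp p)" and t: "t \<in> topspace (W_sphere p)"
  shows "W_sphere_action p g t \<in> topspace (W_sphere p)"
proof -
  have "inv\<^bsub>Cp p\<^esub> g permutes {1..p}"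
    using Cp_permutes group.inv_closed [OF group_Cp g] p_gt_1 by simp
  then have "(\<Sum>i=1..p. h (t ((inv\<^bsub>Cp p\<^esub> g) i))) = (\<Sum>i=1..p. h (t i))" for h :: "real \<Rightarrow> real"
    using sum.permute [of "inv\<^bsub>Cp p\<^esub> g" "{1..p}" "\<lambda>i. h (t i)"] by (simp add: o_def)
  from this [of "\<lambda>y. y"] this [of "\<lambda>y. y\<^sup>2"] show ?thesis
    using t permutes_not_in [OF \<open>inv\<^bsub>Cp p\<^esub> g permutes {1..p}\<close>]
    by (simp add: W_sphere_action_def topspace_W_sphere)
qed

lemma cyclic_action_W_sphere: "cyclic_action p (W_sphere p) (W_sphere_action p)"
proof (rule cyclic_actionI)
  interpret group "Cp p" by (rule group_Cp)
  show "p > 0" using p_gt_1 by simp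
  have "continuous_map (W_sphere p) euclideanreal (\<lambda>t. W_sphere_action p (rot p) t i)" for i
    by (rule continuous_map_eq [OF W_sphere_component [of "(inv\<^bsub>Cp p\<^esub> rot p) i"]]) (simp add: W_sphere_action_def)
  then show "continuous_map (W_sphere p) (W_sphere p) (W_sphere_action p (rot p))"
    unfolding continuous_map_into_W_sphere using W_sphere_action_in [OF rot_in] p_gt_1 by auto
  show "W_sphere_action p id t = t" if "t \<in> topspace (W_sphere p)" for t
    using that inv_one by (simp add: W_sphere_action_def one_Cp)
  show "W_sphere_action p (g \<circ> h) t = W_sphere_action p g (W_sphere_action p h t)"
    if "t \<in> topspace (W_sphere p)" "g \<in> carrier (Cp p)" "h \<in> carrier (Cp p)" for t g h
  proof -
    have "inv\<^bsub>Cp p\<^esub> (g \<circ> h) = inv\<^bsub>Cp p\<^esub> h \<circ> inv\<^bsub>Cp p\<^esub> g"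
      using inv_mult_group [OF that(2,3)] by (simp add: mult_Cp)
    then show ?thesis
      using W_sphere_action_in [OF that(3,1)] that(1) by (simp add: W_sphere_action_def)
  qed
qed

text \<open>A constant vector with coordinate sum 0 is 0 and cannot have norm 1.\<close>

lemma W_sphere_nonconst:
  assumes t: "t \<in> topspace (W_sphere p)" shows "\<exists>i\<in>{1..p}. \<exists>j\<in>{1..p}. t i \<noteq> t j"
proof (rule ccontr)
  assume "\<not> ?thesis"
  moreover have "1 \<in> {1..p}" using p_gt_1 by simp
  ultimately have c: "t i = t 1" if "i \<in> {1..p}" for i using that by blast
  have s: "(\<Sum>i=1..p. h (t i)) = real p * h (t 1)" for h :: "real \<Rightarrow> real"
  proof -
    have "(\<Sum>i=1..p. h (t i)) = (\<Sum>i=1..p. h (t 1))"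
      by (rule sum.cong [OF refl]) (rule arg_cong [OF c])
    then show ?thesis by simp
  qed
  from s [of "\<lambda>y. y"] have "t 1 = 0" using t p_gt_1 by (simp add: topspace_W_sphere)
  with s [of "\<lambda>y. y\<^sup>2"] show False using t by (simp add: topspace_W_sphere)
qed

text \<open>Orthogonal projection to \<open>W_p\<close>, normalized. The column sums add up to 1, so
  their mean is \<open>1 / p\<close>.\<close>

definition sphere_test :: "(nat \<times> nat \<Rightarrow> real) \<Rightarrow> nat \<Rightarrow> real" where
  "sphere_test x = (\<lambda>j. if j \<in> {1..p}
     then (column_sum p x j - 1 / p) / sqrt (\<Sum>k=1..p. (column_sum p x k - 1 / p)\<^sup>2) else 0)"

lemma sphere_test_norm:
  assumes x: "x \<in> topspace (realization (chessboard_complex (p - 1) p))"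
  shows "(\<Sum>k=1..p. (column_sum p x k - 1 / p)\<^sup>2) > 0"
proof -
  obtain k where "k \<in> {1..p}" "column_sum p x k \<noteq> 1 / p" using column_sum_nonconst [OF x] by metis
  then show ?thesis by (intro sum_pos2 [of _ k]) simp_all
qed

lemma sphere_test_in:
  assumes x: "x \<in> topspace (realization (chessboard_complex (p - 1) p))"
  shows "sphere_test x \<in> topspace (W_sphere p)"
proof -
  let ?N = "\<Sum>k=1..p. (column_sum p x k - 1 / p)\<^sup>2"
  have "(\<Sum>j=1..p. sphere_test x j) = (\<Sum>j=1..p. column_sum p x j - 1 / p) / sqrt ?N"
    by (simp add: sphere_test_def flip: sum_divide_distrib)
  moreover have "(\<Sum>j=1..p. (sphere_test x j)\<^sup>2) = (\<Sum>j=1..p. (column_sum p x j - 1 / p)\<^sup>2 / ?N)"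
    using sphere_test_norm [OF x] by (intro sum.cong) (simp_all add: sphere_test_def power_divide)
  ultimately show ?thesis
    using sphere_test_norm [OF x] sum_column_sum [OF x] p_gt_1
    by (simp add: topspace_W_sphere sum_subtractf sphere_test_def flip: sum_divide_distrib)
qed

lemma index_space_W_sphere:
  assumes "odd p"
  shows "index_space p (W_sphere p) (W_sphere_action p) sphere_test (cut p)"
proof (rule index_spaceI [OF p assms cyclic_action_W_sphere])
  show "Hausdorff_space (W_sphere p)"
    unfolding W_sphere_def by (intro Hausdorff_space_subtopology) (simp add: Hausdorff_space_product_topology)
  have "continuous_map (realization (chessboard_complex (p - 1) p)) euclideanreal
      (sqrt \<circ> (\<lambda>x. \<Sum>k=1..p. (column_sum p x k - 1 / p)\<^sup>2))"
    by (rule continuous_map_compose [where X' = euclideanreal])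
      (intro continuous_map_sum continuous_map_real_pow continuous_map_diff column_sum_continuous,
        auto intro!: continuous_on_real_sqrt)
  then have "continuous_map (realization (chessboard_complex (p - 1) p)) euclideanreal
      (\<lambda>x. (column_sum p x j - 1 / p) / sqrt (\<Sum>k=1..p. (column_sum p x k - 1 / p)\<^sup>2))" for j
    using p_gt_1
    by (intro continuous_map_real_divide continuous_map_diff column_sum_continuous)
      (auto simp: o_def dest: sphere_test_norm [simplified])
  then have "continuous_map (realization (chessboard_complex (p - 1) p)) euclideanreal (\<lambda>x. sphere_test x j)" for j
    unfolding sphere_test_def by (cases "j \<in> {1..p}") simp_all
  then show "continuous_map (realization (chessboard_complex (p - 1) p)) (W_sphere p) sphere_test"
    unfolding continuous_map_into_W_sphere using sphere_test_in by auto
  interpret group "Cp p" by (rule group_Cp)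
  have r: "rot p \<in> carrier (Cp p)" using p_gt_1 by (intro rot_in) simp
  have inv: "(inv\<^bsub>Cp p\<^esub> rot p) (rot p j) = j" "rot p ((inv\<^bsub>Cp p\<^esub> rot p) j) = j" for j
    using fun_cong [OF l_inv [OF r], of j] fun_cong [OF r_inv [OF r], of j] by (simp_all add: mult_Cp one_Cp)
  fix x assume x: "x \<in> topspace (realization (chessboard_complex (p - 1) p))"
  let ?x = "chessboard_action (p - 1) p (rot p) x"
  have rin: "rot p j \<in> {1..p} \<longleftrightarrow> j \<in> {1..p}" for j by (rule permutes_in_image [OF rot_permutes])
  have N: "(\<Sum>k=1..p. (column_sum p ?x k - 1 / p)\<^sup>2) = (\<Sum>k=1..p. (column_sum p x k - 1 / p)\<^sup>2)"
    unfolding sum.permute [OF rot_permutes, of "\<lambda>k. (column_sum p ?x k - 1 / p)\<^sup>2" p] o_def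
    by (rule sum.cong [OF refl]) (simp only: column_sum_rot [OF x])
  have "sphere_test ?x (rot p j) = sphere_test x j" for j
    using column_sum_rot [OF x, of j] rin [of j] unfolding sphere_test_def N by auto
  then show "sphere_test ?x = W_sphere_action p (rot p) (sphere_test x)"
    using sphere_test_in [OF x] by (auto simp: W_sphere_action_def fun_eq_iff) (metis inv(2))
next
  fix t i assume t: "t \<in> topspace (W_sphere p)"
  interpret group "Cp p" by (rule group_Cp)
  have "rot p \<in> carrier (Cp p)" using p_gt_1 by (intro rot_in) simp
  from fun_cong [OF l_inv [OF this], of i]
  show "W_sphere_action p (rot p) t (rot p i) = t i"
    using t by (simp add: W_sphere_action_def mult_Cp one_Cp)
qed (use W_sphere_component W_sphere_nonconst in simp_all)

end

theorem theorem6p6: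
  fixes p :: nat
  assumes "prime p" and "odd p"
  shows "fadell_husseini_index (integer_mod_group p) (cyclic_perm_group p)
             (realization (chessboard_complex (p - 1) p)) (chessboard_action (p - 1) p) =
           fadell_husseini_index (integer_mod_group p) (cyclic_perm_group p)
             (W_sphere p) (W_sphere_action p) \<and>
         fadell_husseini_index (integer_mod_group p) (cyclic_perm_group p)
             (W_sphere p) (W_sphere_action p) =
           cohomology_ge (p - 1) (BG (cyclic_perm_group p)) (integer_mod_group p)"
  using index_space.index_eq [OF index_space_chess [OF assms]]
    index_space.index_eq [OF index_space_W_sphere [OF assms]] by simp

end
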